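(* Let $D$ be a finite simple directed acyclic graph. The graphical arrangement of $D$ is (1) simplicial if and only if $D$ is chordful; (2) tight (with respect to the base region $\mathbb{C}_D$ corresponding to $D$) if and only if $D$ is skeletal; (3) supersolvable if and only if $D$ is chordal.
   Context: Let $D=(V,A)$ be a finite simple directed acyclic graph. The graphical arrangement of $D$ is the arrangement in $\mathbb{R}^V$ of the hyperplanes $\{x : x_u=x_v\}$ for $(u,v)\in A$. Its regions are the cones $\mathbb{C}_E=\{x : x_u\le x_v\text{ for all arcs }(u,v)\text{ of }E\}$, for $E$ an acyclic reorientation of $D$ (an acyclic directed graph with the same underlying undirected graph as $D$); the base region is $\mathbb{C}_D$. An arrangement is simplicial if all its regions are simplicial cones (after quotienting by the intersection of all hyperplanes). A central arrangement is tight with respect to a base region $B$ if for each region $R$, every pair of upper facets of $R$ intersects in a codimension $2$ face, and every pair of lower facets of $R$ intersects in a codimension $2$ face; here a facet of $R$ is lower (resp. upper) if its hyperplane separates (resp. does not separate) $R$ from $B$. A central arrangement is supersolvable if its lattice of intersections has a maximal chain of modular elements. A chord of an undirected cycle $C$ is an edge joining two non-consecutive vertices of $C$. $D$ is chordal (resp. chordful) if for any cycle $C$ of length at least $4$ in the underlying undirected graph of $D$, at least one chord (resp. all chords) of $C$ also belongs to that graph. The transitive reduction of a directed acyclic graph is obtained by deleting all arcs whose endpoints are connected by a directed path of length at least $2$; a directed graph is a forest if its underlying undirected graph has no cycle. $D$ is vertebrate if the transitive reduction of every induced subgraph of $D$ is a forest; filled if for any directed path $\pi$ in $D$ whose endpoints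 are joined by an arc of $D$, all arcs joining any two vertices of $\pi$ belong to $D$; skeletal if vertebrate and filled. *)

theory Defs
  imports "HOL-Analysis.Analysis"
begin

section \<open>Central hyperplane arrangements\<close>

text \<open>
  A central arrangement in a Euclidean space is represented by its set of hyperplanes (all
  through the origin). Regions are closed.
\<close>

definition regions :: "'a::euclidean_space set set \<Rightarrow> 'a set set" where
  "regions \<H> = closure ` components (- \<Union>\<H>)"

text \<open>
  \<open>C\<close> is the preimage, under the projection to the quotient by the subspace \<open>L\<close>, of a cone
  generated by linearly independent vectors: the conditions on \<open>S\<close> say that its elements
  have pairwise distinct, linearly independent images in the quotient.
\<close>

definition simplicial_cone_mod :: "'a::euclidean_space set \<Rightarrow> 'a set \<Rightarrow> bool" where
  "simplicial_cone_mod L C \<longleftrightarrow>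
     (\<exists>S. independent S \<and> span S \<inter> L = {0} \<and>
          C = {x + y | x y. x \<in> convex_cone hull S \<and> y \<in> L})"

definition simplicial_arrangement :: "'a::euclidean_space set set \<Rightarrow> bool" where
  "simplicial_arrangement \<H> \<longleftrightarrow> (\<forall>R \<in> regions \<H>. simplicial_cone_mod (\<Inter>\<H>) R)"

definition hyperplane_separates :: "'a::euclidean_space set \<Rightarrow> 'a set \<Rightarrow> 'a set \<Rightarrow> bool" where
  "hyperplane_separates H R B \<longleftrightarrow>
     (\<exists>a b. a \<noteq> 0 \<and> H = {x. a \<bullet> x = b} \<and> (\<forall>x\<in>R. a \<bullet> x \<le> b) \<and> (\<forall>x\<in>B. b \<le> a \<bullet> x))"

text \<open>The hyperplane supporting a facet of a (full-dimensional) region is its affine hull.\<close>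

definition lower_facet :: "'a::euclidean_space set \<Rightarrow> 'a set \<Rightarrow> 'a set \<Rightarrow> bool" where
  "lower_facet B R F \<longleftrightarrow> F facet_of R \<and> hyperplane_separates (affine hull F) R B"

definition upper_facet :: "'a::euclidean_space set \<Rightarrow> 'a set \<Rightarrow> 'a set \<Rightarrow> bool" where
  "upper_facet B R F \<longleftrightarrow> F facet_of R \<and> \<not> hyperplane_separates (affine hull F) R B"

definition codim2_face :: "'a::euclidean_space set \<Rightarrow> 'a set \<Rightarrow> bool" where
  "codim2_face R G \<longleftrightarrow> G face_of R \<and> aff_dim G = int DIM('a) - 2"

definition tight_arrangement :: "'a::euclidean_space set set \<Rightarrow> 'a set \<Rightarrow> bool" where
  "tight_arrangement \<H> B \<longleftrightarrow>
     (\<forall>R \<in> regions \<H>.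
        (\<forall>F G. upper_facet B R F \<and> upper_facet B R G \<and> F \<noteq> G \<longrightarrow> codim2_face R (F \<inter> G)) \<and>
        (\<forall>F G. lower_facet B R F \<and> lower_facet B R G \<and> F \<noteq> G \<longrightarrow> codim2_face R (F \<inter> G)))"

text \<open>
  The lattice of intersections is ordered by reverse inclusion, so that \<open>X \<inter> Y\<close> is the join
  of \<open>X\<close> and \<open>Y\<close>, and their meet is the smallest intersection containing both. The ambient
  space is the empty intersection.
\<close>

definition intersection_lattice :: "'a set set \<Rightarrow> 'a set set" where
  "intersection_lattice \<H> = Inter ` Pow \<H>"

definition flat_meet :: "'a set set \<Rightarrow> 'a set \<Rightarrow> 'a set \<Rightarrow> 'a set" where
  "flat_meet \<H> X Y = \<Inter>{Z \<in> intersection_lattice \<H>. X \<subseteq> Z \<and> Y \<subseteq> Z}"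

text \<open>
  \<open>X\<close> is modular if \<open>Z \<squnion> (X \<sqinter> Y) = (Z \<squnion> X) \<sqinter> Y\<close> for all \<open>Y\<close> and all \<open>Z\<close> below \<open>Y\<close>. The
  condition is self-dual, so it does not depend on the direction of the order.
\<close>

definition modular_flat :: "'a set set \<Rightarrow> 'a set \<Rightarrow> bool" where
  "modular_flat \<H> X \<longleftrightarrow> X \<in> intersection_lattice \<H> \<and>
     (\<forall>Y \<in> intersection_lattice \<H>. \<forall>Z \<in> intersection_lattice \<H>.
        Y \<subseteq> Z \<longrightarrow> Z \<inter> flat_meet \<H> X Y = flat_meet \<H> (Z \<inter> X) Y)"

definition supersolvable_arrangement :: "'a set set \<Rightarrow> bool" where
  "supersolvable_arrangement \<H> \<longleftrightarrow>
     (\<exists>\<C>. subset.maxchain (intersection_lattice \<H>) \<C> \<and> (\<forall>X\<in>\<C>. modular_flat \<H> X))"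

section \<open>Directed acyclic graphs\<close>

text \<open>
  A directed graph is given by its set of arcs on the vertex set \<open>UNIV\<close>. An acyclic relation
  has no loops and no pairs of opposite arcs, so \<open>acyclic A\<close> with a finite vertex type
  says precisely that \<open>A\<close> is a finite simple directed acyclic graph.
\<close>

definition edges :: "'v rel \<Rightarrow> 'v rel" where
  "edges A = A \<union> A\<inverse>"

definition undirected_cycle :: "'v rel \<Rightarrow> 'v list \<Rightarrow> bool" where
  "undirected_cycle A c \<longleftrightarrow> 3 \<le> length c \<and> distinct c \<and>
     (\<forall>i < length c. (c ! i, c ! (Suc i mod length c)) \<in> edges A)"

text \<open>Positions \<open>i < j\<close> of two non-consecutive vertices of a cycle of length \<open>n\<close>.\<close>

definition nonconsecutive :: "nat \<Rightarrow> nat \<Rightarrow> nat \<Rightarrow> bool" where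
  "nonconsecutive n i j \<longleftrightarrow> i < j \<and> j < n \<and> j \<noteq> Suc i \<and> \<not> (i = 0 \<and> Suc j = n)"

definition chordal :: "'v rel \<Rightarrow> bool" where
  "chordal A \<longleftrightarrow> (\<forall>c. undirected_cycle A c \<and> 4 \<le> length c \<longrightarrow>
     (\<exists>i j. nonconsecutive (length c) i j \<and> (c ! i, c ! j) \<in> edges A))"

definition chordful :: "'v rel \<Rightarrow> bool" where
  "chordful A \<longleftrightarrow> (\<forall>c. undirected_cycle A c \<and> 4 \<le> length c \<longrightarrow>
     (\<forall>i j. nonconsecutive (length c) i j \<longrightarrow> (c ! i, c ! j) \<in> edges A))"

definition dipath :: "'v rel \<Rightarrow> 'v list \<Rightarrow> bool" where
  "dipath A p \<longleftrightarrow> p \<noteq> [] \<and> distinct p \<and> successively (\<lambda>u v. (u, v) \<in> A) p"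

text \<open>A directed path of length at least 2 has at least 3 vertices.\<close>

definition transitive_reduction :: "'v rel \<Rightarrow> 'v rel" where
  "transitive_reduction A =
     {(u, v) \<in> A. \<not> (\<exists>p. dipath A p \<and> hd p = u \<and> last p = v \<and> 3 \<le> length p)}"

definition forest :: "'v rel \<Rightarrow> bool" where
  "forest A \<longleftrightarrow> \<not> (\<exists>c. undirected_cycle A c)"

definition vertebrate :: "'v rel \<Rightarrow> bool" where
  "vertebrate A \<longleftrightarrow> (\<forall>U. forest (transitive_reduction (A \<inter> U \<times> U)))"

text \<open>
  For acyclic \<open>A\<close>, an arc joining two vertices of a directed path is necessarily oriented
  along the path.
\<close>

definition filled :: "'v rel \<Rightarrow> bool" where
  "filled A \<longleftrightarrow> (\<forall>p. dipath A p \<and> (hd p, last p) \<in> A \<longrightarrow>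
     (\<forall>i j. i < j \<and> j < length p \<longrightarrow> (p ! i, p ! j) \<in> A))"

definition skeletal :: "'v rel \<Rightarrow> bool" where
  "skeletal A \<longleftrightarrow> vertebrate A \<and> filled A"

section \<open>Graphical arrangements\<close>

definition graphical_arrangement :: "'v::finite rel \<Rightarrow> (real ^ 'v) set set" where
  "graphical_arrangement A = {{x. x $ u = x $ v} | u v. (u, v) \<in> A}"

definition graph_cone :: "'v::finite rel \<Rightarrow> (real ^ 'v) set" where
  "graph_cone A = {x. \<forall>(u, v) \<in> A. x $ u \<le> x $ v}"

end

theory Submission
  imports Defs
begin

text \<open>
  The regions are the cones of the acyclic reorientations \<open>E\<close>, and the facets of such a cone
  correspond to the arcs of the transitive reduction of \<open>E\<close>. Linear independence of the facet
  normals shows that the cone is simplicial iff the transitive reduction is a forest. A cycle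
  with a missing chord yields a chordless cycle or a diamond (two triangles sharing an edge) with
  non-adjacent tips, whose outer edges all survive in the transitive reduction of a suitable \<open>E\<close>.

  Two facets meet in codimension 2 iff contracting both of their arcs forces no independent
  third arc to be contracted. If both facets are upper or both are lower, a forced arc
  produces either a chordless cycle or a diamond with \<open>a \<rightarrow> b \<rightarrow> c\<close> and \<open>a \<rightarrow> c\<close> in the digraph
  whose tips \<open>b\<close> and \<open>x\<close> are not adjacent. Hence tightness means that there are no such
  cycles and diamonds, and this is equivalent to being skeletal.

  For supersolvability, a perfect elimination ordering provides a maximal chain of flats given by
  initial segments; they are modular because a path leaving an initial segment returns to a
  vertex that is equal or adjacent to its start. Conversely, the last flat of a maximal chain
  that does not contain all edges of a chordless cycle misses two of them, \<open>g\<close> and \<open>h\<close>, but its join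
  with \<open>g\<close> contains \<open>h\<close>, so that the modular law fails for \<open>g\<close> below \<open>{g, h}\<close>.
\<close>

section \<open>Paths and cycles\<close>

text \<open>All geometry passes through one vector. \<open>height T\<close> counts predecessors
  under reachability in \<open>T\<close>, so it is constant on mutually reachable vertices and
  increases strictly along one-way reachability. For \<open>T\<close> equal to \<open>E\<close>,
  possibly with one or two arcs also reversed, it is a relative interior point of a region, of a
  facet, or of the intersection of two facets. The codimension question thus becomes a question on
  return paths: which arcs \<open>(a, b)\<close> of \<open>E\<close> have a path from
  \<open>b\<close> to \<open>a\<close> once two irreducible arcs may be traversed backwards? The
  obstacle is a return path that uses both reversed arcs. The base orientation enters only when the
  two arcs are consecutive and their outer ends are adjacent: arcs on the same side then form a
  directed path in \<open>A\<close>, which orients the triangle. This explains the asymmetry of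
  \<open>diamond_condition\<close>, which asks for a directed triangle but puts no direction on the
  edges at \<open>x\<close>. Linear independence and strictness are certified by explicit test
  vectors, mostly indicator vectors of vertex sets, so no ranks of flats are computed.\<close>

abbreviation walk :: "'v rel \<Rightarrow> 'v list \<Rightarrow> bool" where
  "walk R \<equiv> successively (\<lambda>u v. (u, v) \<in> R)"

abbreviation reduced :: "'v rel \<Rightarrow> 'v rel" where
  "reduced \<equiv> transitive_reduction"

lemma edges_sym: "(u, v) \<in> edges A \<longleftrightarrow> (v, u) \<in> edges A"
  by (auto simp: edges_def)

lemma edges_irrefl: "acyclic A \<Longrightarrow> (u, u) \<notin> edges A"
  by (auto simp: edges_def acyclic_def)

lemma edges_orient: "(u, v) \<in> edges A \<longleftrightarrow> (u, v) \<in> A \<or> (v, u) \<in> A"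
  by (auto simp: edges_def)

lemma acyclic_antisym: "acyclic E \<Longrightarrow> (u, v) \<in> E\<^sup>+ \<Longrightarrow> (v, u) \<in> E\<^sup>* \<Longrightarrow> False"
  by (metis acyclic_def rtrancl_trancl_trancl)

lemma rtrancl_imp_path:
  assumes "(x, y) \<in> R\<^sup>*"
  shows "\<exists>p. p \<noteq> [] \<and> hd p = x \<and> last p = y \<and> walk R p"
  using assms
proof (induction rule: converse_rtrancl_induct)
  case base
  show ?case by (rule exI[of _ "[y]"]) auto
next
  case (step x z)
  then obtain p where "p \<noteq> []" "hd p = z" "last p = y" "walk R p"
    by blast
  with step(1) show ?case by (intro exI[of _ "x # p"]) (auto simp: successively_Cons)
qed

lemma path_nth_trancl:
  assumes "walk R p" "i < j" "j < length p"
  shows "(p ! i, p ! j) \<in> R\<^sup>+"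
proof -
  have "walk (R\<^sup>+) p"
    using assms(1) by (rule successively_mono) auto
  moreover have "transp (\<lambda>u v. (u, v) \<in> R\<^sup>+)"
    by (auto simp: transp_def)
  ultimately have "sorted_wrt (\<lambda>u v. (u, v) \<in> R\<^sup>+) p"
    using successively_conv_sorted_wrt by blast
  then show ?thesis using assms(2,3) sorted_wrt_nth_less by blast
qed

lemma path_distinct:
  assumes "acyclic R" "walk R p"
  shows "distinct p"
proof -
  have "p ! i \<noteq> p ! j" if "i < j" "j < length p" for i j
    using path_nth_trancl[OF assms(2) that] assms(1) by (auto simp: acyclic_def)
  then show ?thesis
    unfolding distinct_conv_nth by (metis linorder_neqE_nat)
qed

lemma path_hd_rtrancl:
  assumes "walk R p" "x \<in> set p"
  shows "(hd p, x) \<in> R\<^sup>*"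
proof -
  obtain i where i: "i < length p" "x = p ! i" using assms(2) by (metis in_set_conv_nth)
  show ?thesis
  proof (cases "i = 0")
    case True then show ?thesis using i by (simp add: hd_conv_nth)
  next
    case False
    then have "(p ! 0, p ! i) \<in> R\<^sup>+" using path_nth_trancl[OF assms(1), of 0 i] i by auto
    then show ?thesis using i by (metis hd_conv_nth length_0_conv not_less_zero trancl_into_rtrancl)
  qed
qed

lemma path_last_rtrancl:
  assumes "walk R p" "x \<in> set p"
  shows "(x, last p) \<in> R\<^sup>*"
proof -
  obtain i where i: "i < length p" "x = p ! i" using assms(2) by (metis in_set_conv_nth)
  have ne: "p \<noteq> []" using i by auto
  show ?thesis
  proof (cases "i = length p - 1")
    case True then show ?thesis using i ne by (simp add: last_conv_nth)
  next
    case False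
    then have "(p ! i, p ! (length p - 1)) \<in> R\<^sup>+"
      using path_nth_trancl[OF assms(1), of i "length p - 1"] i by auto
    then show ?thesis using i ne by (simp add: last_conv_nth trancl_into_rtrancl)
  qed
qed

lemma path_shortcut:
  assumes "successively Q p" "i < j" "j < length p" "Q (p ! i) (p ! j)"
  shows "successively Q (take (Suc i) p @ drop j p)"
    and "hd (take (Suc i) p @ drop j p) = hd p"
    and "last (take (Suc i) p @ drop j p) = last p"
proof -
  have p: "p = take (Suc i) p @ drop (Suc i) p" "p = take j p @ drop j p" by auto
  have "successively Q (take (Suc i) p)" "successively Q (drop j p)"
    using assms(1) successively_append_iff[of Q "take (Suc i) p" "drop (Suc i) p"]
      successively_append_iff[of Q "take j p" "drop j p"] by auto
  moreover have "last (take (Suc i) p) = p ! i"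
    using assms by (subst last_conv_nth) (auto simp: nth_append min_def)
  moreover have "hd (drop j p) = p ! j" using assms by (simp add: hd_drop_conv_nth)
  ultimately show "successively Q (take (Suc i) p @ drop j p)"
    using assms(4) by (simp add: successively_append_iff)
  show "hd (take (Suc i) p @ drop j p) = hd p" using assms by (cases p) auto
  show "last (take (Suc i) p @ drop j p) = last p" using assms by simp
qed

text \<open>A path of minimal length has no shortcut. Only forward chords are excluded, which is
  enough for symmetric relations and for acyclic ones.\<close>

lemma induced_path:
  assumes "(x, y) \<in> R\<^sup>*"
  obtains p where "p \<noteq> []" "hd p = x" "last p = y" "walk R p"
    "distinct p" "\<And>i j. Suc i < j \<Longrightarrow> j < length p \<Longrightarrow> (p ! i, p ! j) \<notin> R"
proof -
  let ?P = "\<lambda>p. p \<noteq> [] \<and> hd p = x \<and> last p = y \<and> walk R p"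
  obtain p where p: "?P p" and least: "\<And>q. ?P q \<Longrightarrow> length p \<le> length q"
    using ex_has_least_nat[of ?P _ length] rtrancl_imp_path[OF assms] by metis
  have nochord: "(p ! i, p ! j) \<notin> R" if "Suc i < j" "j < length p" for i j
  proof
    assume a: "(p ! i, p ! j) \<in> R"
    have "?P (take (Suc i) p @ drop j p)"
      using path_shortcut[of "\<lambda>u v. (u, v) \<in> R" p i j] p a that by auto
    from least[OF this] that show False by auto
  qed
  have "p ! i \<noteq> p ! j" if "i < j" "j < length p" for i j
  proof
    assume a: "p ! i = p ! j"
    show False
    \<comment> \<open>A repetition of the first vertex is removed by dropping the prefix; any other
      repetition gives a forward chord from the preceding vertex.\<close>
    proof (cases i)
      case 0
      have "hd (drop j p) = p ! j" using that by (simp add: hd_drop_conv_nth)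
      also have "\<dots> = p ! 0" using a 0 by metis
      also have "\<dots> = x" using p by (metis hd_conv_nth)
      finally have "?P (drop j p)"
        using p that successively_append_iff[of _ "take j p" "drop j p"] by auto
      from least[OF this] that show False by auto
    next
      case (Suc k)
      then have "Suc k < length p" using that by linarith
      then have "(p ! k, p ! Suc k) \<in> R" using p successively_nth by fast
      then have "(p ! k, p ! i) \<in> R" unfolding Suc .
      then have "(p ! k, p ! j) \<in> R" unfolding a .
      moreover have "Suc k < j" using Suc that by linarith
      ultimately show False using nochord that by blast
    qed
  qed
  then have "distinct p" unfolding distinct_conv_nth by (metis linorder_neqE_nat)
  with p nochord that show thesis by blast
qed

lemma undirected_cycle_iff:
  "undirected_cycle A c \<longleftrightarrow> 3 \<le> length c \<and> distinct c \<and>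
     walk (edges A) c \<and> (last c, hd c) \<in> edges A"
proof (cases "3 \<le> length c")
  case True
  then have ne: "c \<noteq> []" by auto
  have "(\<forall>i < length c. (c ! i, c ! (Suc i mod length c)) \<in> edges A) \<longleftrightarrow>
    (\<forall>i. Suc i < length c \<longrightarrow> (c ! i, c ! Suc i) \<in> edges A) \<and>
    (c ! (length c - 1), c ! 0) \<in> edges A" (is "?l \<longleftrightarrow> ?r")
  proof
    assume l: ?l
    show ?r
    proof (intro conjI allI impI)
      fix i assume "Suc i < length c" then show "(c ! i, c ! Suc i) \<in> edges A" using l[rule_format, of i] by auto
    next
      have "Suc (length c - 1) = length c" "length c - 1 < length c" using True by auto
      then show "(c ! (length c - 1), c ! 0) \<in> edges A" using l[rule_format, of "length c - 1"] by simp
    qed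
  next
    assume r: ?r
    show ?l
    proof (intro allI impI)
      fix i assume i: "i < length c"
      show "(c ! i, c ! (Suc i mod length c)) \<in> edges A"
      proof (cases "Suc i = length c")
        case True
        then have "length c - 1 = i" by auto
        with r True show ?thesis by simp
      next
        case False with i r show ?thesis by auto
      qed
    qed
  qed
  then show ?thesis using True ne
    by (auto simp: undirected_cycle_def successively_conv_nth hd_conv_nth last_conv_nth)
qed (auto simp: undirected_cycle_def)

lemma undirected_cycle_rotate:
  "undirected_cycle A (xs @ ys) \<Longrightarrow> undirected_cycle A (ys @ xs)"
  unfolding undirected_cycle_iff successively_append_iff
  by (cases "xs = []"; cases "ys = []") (simp_all, blast)

lemma undirected_cycle_mono:
  assumes "undirected_cycle R c" "\<And>u v. u \<in> set c \<Longrightarrow> v \<in> set c \<Longrightarrow> (u, v) \<in> R \<Longrightarrow> (u, v) \<in> edges S"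
  shows "undirected_cycle S c"
proof -
  have "(u, v) \<in> edges S" if "u \<in> set c" "v \<in> set c" "(u, v) \<in> edges R" for u v
    using that assms(2)[of u v] assms(2)[of v u] by (metis edges_orient edges_sym)
  moreover have "Suc i mod length c < length c" if "i < length c" for i
    using that by (intro mod_less_divisor) auto
  ultimately show ?thesis using assms(1)
    by (simp add: undirected_cycle_def)
qed

text \<open>Two relations are involved because removing the ear \<open>s\<close> may also change the
  graph: the second use passes to the transitive reduction of a smaller induced subgraph.\<close>

lemma undirected_cycle_delete:
  assumes c: "undirected_cycle R (xs @ [y, s, z] @ ys)" and n: "4 \<le> length (xs @ [y, s, z] @ ys)"
    and yz: "(y, z) \<in> edges S"
    and sub: "\<And>u v. (u, v) \<in> R \<Longrightarrow> u \<noteq> s \<Longrightarrow> v \<noteq> s \<Longrightarrow> (u, v) \<in> S"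
  shows "undirected_cycle S (xs @ [y, z] @ ys)"
proof -
  have d: "distinct (xs @ [y, s, z] @ ys)" using c by (auto simp: undirected_cycle_iff)
  have e: "(u, v) \<in> edges S" if "(u, v) \<in> edges R" "u \<noteq> s" "v \<noteq> s" for u v
    using that sub by (auto simp: edges_orient)
  have "walk (edges R) ((xs @ [y]) @ [s] @ (z # ys))"
    using c by (simp add: undirected_cycle_iff)
  then have R: "walk (edges R) (xs @ [y])"
    "walk (edges R) (z # ys)"
    unfolding successively_append_iff by blast+
  have xs: "walk (edges S) (xs @ [y])"
    using R(1) by (rule successively_mono) (use d in \<open>auto intro!: e\<close>)
  have ys: "walk (edges S) (z # ys)"
    using R(2) by (rule successively_mono) (use d in \<open>auto intro!: e\<close>)
  have "walk (edges S) ((xs @ [y]) @ (z # ys))"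
    using xs ys yz by (subst successively_append_iff) auto
  moreover have "(last (z # ys), hd (xs @ [y])) \<in> edges S"
  proof (rule e)
    show "(last (z # ys), hd (xs @ [y])) \<in> edges R"
      using c by (cases xs) (auto simp: undirected_cycle_iff)
    show "last (z # ys) \<noteq> s" using d last_in_set[of "z # ys"] by auto
    show "hd (xs @ [y]) \<noteq> s" using d by (cases xs) auto
  qed
  ultimately show ?thesis using n d
    by (cases xs) (auto simp: undirected_cycle_iff)
qed

lemma closed_path_cycle:
  assumes "walk (edges R) p" "distinct p" "3 \<le> length p"
    "(hd p, last p) \<in> edges R"
  shows "undirected_cycle R p"
  using assms edges_sym by (fastforce simp: undirected_cycle_iff)

section \<open>Chordal and chordful graphs\<close>

text \<open>A chord closes the segment between its ends to a shorter cycle, so induction applies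
  there. That segment is a contiguous sublist, hence the position found in it transfers to
  \<open>c\<close> without wrap-around.\<close>

lemma chordal_ear_index:
  assumes "chordal A"
  shows "undirected_cycle A c \<Longrightarrow> 4 \<le> length c \<Longrightarrow>
    \<exists>i. Suc (Suc i) < length c \<and> (c ! i, c ! Suc (Suc i)) \<in> edges A"
proof (induction "length c" arbitrary: c rule: less_induct)
  case less
  obtain i j where ij: "nonconsecutive (length c) i j" "(c ! i, c ! j) \<in> edges A"
    using assms less.prems unfolding chordal_def by blast
  then have lt: "Suc i < j" "j < length c" "\<not> (i = 0 \<and> Suc j = length c)"
    by (auto simp: nonconsecutive_def)
  show ?case
  proof (cases "j = Suc (Suc i)")
    case True with ij lt show ?thesis by auto
  next
    case False
    define d where "d = take (Suc (j - i)) (drop i c)"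
    have len: "length d = Suc (j - i)" using lt by (simp add: d_def)
    have nth: "d ! k = c ! (i + k)" if "k \<le> j - i" for k
      using that lt by (simp add: d_def)
    have "undirected_cycle A d"
    proof (rule closed_path_cycle)
      show "distinct d" using less.prems(1) by (auto simp: d_def undirected_cycle_iff)
      show "3 \<le> length d" using len lt by auto
      show "(hd d, last d) \<in> edges A"
        using ij nth[of 0] nth[of "j - i"] len lt hd_conv_nth[of d] last_conv_nth[of d] by force
      have "walk (edges A) c" using less.prems(1) by (auto simp: undirected_cycle_iff)
      then show "walk (edges A) d"
        unfolding successively_conv_nth len using nth lt by auto
    qed
    moreover have "length d < length c" "4 \<le> length d" using len lt False by auto
    ultimately obtain k where "Suc (Suc k) < length d" "(d ! k, d ! Suc (Suc k)) \<in> edges A"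
      using less.hyps by blast
    then have "Suc (Suc (i + k)) < length c" "(c ! (i + k), c ! Suc (Suc (i + k))) \<in> edges A"
      using nth[of k] nth[of "Suc (Suc k)"] len lt by auto
    then show ?thesis by blast
  qed
qed

lemma chordal_ear:
  assumes "chordal A" "undirected_cycle A c" "4 \<le> length c"
  obtains xs y s z ys where "c = xs @ [y, s, z] @ ys" "(y, z) \<in> edges A"
proof -
  obtain i where i: "Suc (Suc i) < length c" "(c ! i, c ! Suc (Suc i)) \<in> edges A"
    using chordal_ear_index[OF assms] by blast
  have "c = take i c @ [c ! i, c ! Suc i, c ! Suc (Suc i)] @ drop (Suc (Suc (Suc i))) c"
    using i(1) by (simp add: Cons_nth_drop_Suc)
  with i(2) that show thesis by blast
qed

text \<open>The part of chordfulness missing from chordality: a 4-cycle \<open>p, x, q, y\<close>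
  with the chord \<open>pq\<close> also has the other chord.\<close>

definition diamond_free :: "'v rel \<Rightarrow> bool" where
  "diamond_free A \<longleftrightarrow> (\<forall>p q x y. (p, q) \<in> edges A \<and> (p, x) \<in> edges A \<and> (q, x) \<in> edges A \<and>
     (p, y) \<in> edges A \<and> (q, y) \<in> edges A \<and> x \<noteq> y \<longrightarrow> (x, y) \<in> edges A)"

text \<open>Cut off an ear \<open>s\<close> with neighbours \<open>y\<close>, \<open>z\<close>. The
  rest is a clique by induction, and any further vertex \<open>t\<close> forms with \<open>s\<close>
  the tips of two triangles on the edge \<open>yz\<close>.\<close>

lemma cycle_clique:
  assumes "chordal A" "diamond_free A"
  shows "undirected_cycle A c \<Longrightarrow> u \<in> set c \<Longrightarrow> v \<in> set c \<Longrightarrow> u \<noteq> v \<Longrightarrow> (u, v) \<in> edges A"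
proof (induction "length c" arbitrary: c u v rule: less_induct)
  case less
  show ?case
  proof (cases "4 \<le> length c")
    case False
    then have "length c = 3" using less.prems(1) by (auto simp: undirected_cycle_iff)
    then obtain x y z where "c = [x, y, z]"
      by (auto simp: numeral_3_eq_3 length_Suc_conv)
    then show ?thesis using less.prems by (auto simp: undirected_cycle_iff edges_orient)
  next
    case True
    then obtain xs y s z ys where c: "c = xs @ [y, s, z] @ ys" and yz: "(y, z) \<in> edges A"
      using chordal_ear assms less.prems by metis
    have "undirected_cycle A (xs @ [y, z] @ ys)"
      using less.prems(1) True yz unfolding c by (rule undirected_cycle_delete)
    from less.hyps[OF _ this] have cl: "(u, v) \<in> edges A"
      if "u \<in> set c" "v \<in> set c" "u \<noteq> v" "u \<noteq> s" "v \<noteq> s" for u v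
      using that by (auto simp: c)
    have d: "distinct c" using less.prems by (auto simp: undirected_cycle_iff)
    have sy: "(y, s) \<in> edges A" "(z, s) \<in> edges A"
      using less.prems(1) by (auto simp: c undirected_cycle_iff successively_append_iff edges_orient)
    have st: "(s, t) \<in> edges A" if "t \<in> set c" "t \<noteq> s" for t
    proof (cases "t = y \<or> t = z")
      case True then show ?thesis using sy edges_sym by metis
    next
      case False
      then have "(y, t) \<in> edges A" "(z, t) \<in> edges A" using cl[of y t] cl[of z t] that d by (auto simp: c)
      with sy yz assms(2) that(2) show ?thesis unfolding diamond_free_def by blast
    qed
    show ?thesis using cl[OF less.prems(2,3)] st less.prems edges_sym by metis
  qed
qed

lemma chordful_iff:
  assumes "acyclic A"
  shows "chordful A \<longleftrightarrow> chordal A \<and> diamond_free A"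
proof
  assume cf: "chordful A"
  have "chordal A" unfolding chordal_def
  proof (intro allI impI)
    fix c assume c: "undirected_cycle A c \<and> 4 \<le> length c"
    then have "nonconsecutive (length c) 0 2" by (auto simp: nonconsecutive_def)
    with c cf show "\<exists>i j. nonconsecutive (length c) i j \<and> (c ! i, c ! j) \<in> edges A"
      unfolding chordful_def by blast
  qed
  moreover have "diamond_free A" unfolding diamond_free_def
  proof (intro allI impI, elim conjE)
    fix p q x y
    assume e: "(p, q) \<in> edges A" "(p, x) \<in> edges A" "(q, x) \<in> edges A" "(p, y) \<in> edges A"
      "(q, y) \<in> edges A" "x \<noteq> y"
    then have "undirected_cycle A [p, x, q, y]"
      using edges_irrefl[OF assms] by (auto simp: undirected_cycle_iff edges_orient)
    moreover have "nonconsecutive (length [p, x, q, y]) 1 3" by (simp add: nonconsecutive_def)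
    ultimately have "([p, x, q, y] ! 1, [p, x, q, y] ! 3) \<in> edges A"
      using cf[unfolded chordful_def, rule_format, of "[p, x, q, y]" 1 3] by simp
    then show "(x, y) \<in> edges A" by simp
  qed
  ultimately show "chordal A \<and> diamond_free A" ..
next
  assume "chordal A \<and> diamond_free A"
  then have cl: "(c ! i, c ! j) \<in> edges A"
    if "undirected_cycle A c" "i < j" "j < length c" for c i j
    using cycle_clique[of A c "c ! i" "c ! j"] that
    by (auto simp: undirected_cycle_def nth_eq_iff_index_eq)
  show "chordful A" unfolding chordful_def nonconsecutive_def
    using cl by blast
qed

section \<open>Skeletal digraphs\<close>

text \<open>Trades the explicit bypassing path for an intermediate vertex. Acyclicity makes the
  concatenation of two paths distinct.\<close>

lemma reduced_iff:
  assumes "acyclic E"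
  shows "(u, v) \<in> reduced E \<longleftrightarrow>
    (u, v) \<in> E \<and> \<not> (\<exists>w. (u, w) \<in> E\<^sup>+ \<and> (w, v) \<in> E\<^sup>+)"
proof -
  have "(\<exists>p. dipath E p \<and> hd p = u \<and> last p = v \<and> 3 \<le> length p) \<longleftrightarrow>
    (\<exists>w. (u, w) \<in> E\<^sup>+ \<and> (w, v) \<in> E\<^sup>+)" (is "?l \<longleftrightarrow> ?r")
  proof
    assume ?l
    then obtain p where p: "dipath E p" "hd p = u" "last p = v" "3 \<le> length p" by blast
    then have s: "walk E p" and "p \<noteq> []" by (auto simp: dipath_def)
    have "(p ! 0, p ! 1) \<in> E\<^sup>+" "(p ! 1, p ! (length p - 1)) \<in> E\<^sup>+"
      using path_nth_trancl[OF s] p(4) by auto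
    with p \<open>p \<noteq> []\<close> show ?r by (auto simp: hd_conv_nth last_conv_nth)
  next
    assume ?r
    then obtain w where w: "(u, w) \<in> E\<^sup>+" "(w, v) \<in> E\<^sup>+" by blast
    obtain p where p: "p \<noteq> []" "hd p = u" "last p = w" "walk E p"
      using rtrancl_imp_path w(1) trancl_into_rtrancl by metis
    obtain q where q: "q \<noteq> []" "hd q = w" "last q = v" "walk E q"
      using rtrancl_imp_path w(2) trancl_into_rtrancl by metis
    have ne: "u \<noteq> w" "w \<noteq> v" using w assms by (auto simp: acyclic_def)
    obtain p' where p': "p = p' @ [w]" using p by (metis append_butlast_last_id)
    obtain q' where q': "q = w # q'" using q by (metis list.collapse)
    have "p' \<noteq> []" "q' \<noteq> []" using p q p' q' ne by auto
    have "walk E (p' @ w # q')"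
      using p(4) q(4) p' q' by (auto simp: successively_append_iff)
    moreover have "3 \<le> length (p' @ w # q')"
      using \<open>p' \<noteq> []\<close> \<open>q' \<noteq> []\<close> by (cases p'; cases q') auto
    moreover from calculation have "distinct (p' @ w # q')"
      using path_distinct[OF assms] by blast
    ultimately show ?l
      using p q p' q' \<open>p' \<noteq> []\<close> \<open>q' \<noteq> []\<close>
      by (intro exI[of _ "p' @ w # q'"]) (auto simp: dipath_def)
  qed
  then show ?thesis by (auto simp: transitive_reduction_def)
qed

lemma reduced_subset: "reduced E \<subseteq> E"
  by (auto simp: transitive_reduction_def)

text \<open>Fewer vertices offer fewer bypasses, so irreducible arcs stay irreducible.\<close>

lemma reduced_restrict:
  assumes "acyclic A" "(u, v) \<in> reduced (A \<inter> U \<times> U)" "u \<in> W" "v \<in> W" "W \<subseteq> U"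
  shows "(u, v) \<in> reduced (A \<inter> W \<times> W)"
proof -
  have "A \<inter> W \<times> W \<subseteq> A \<inter> U \<times> U" using assms(5) by auto
  then have "(A \<inter> W \<times> W)\<^sup>+ \<subseteq> (A \<inter> U \<times> U)\<^sup>+" by (simp add: subsetI trancl_mono)
  moreover have "acyclic (A \<inter> W \<times> W)" "acyclic (A \<inter> U \<times> U)"
    using assms(1) acyclic_subset by blast+
  moreover have "(u, v) \<in> A"
    using assms(2) reduced_subset by blast
  ultimately show ?thesis
    using assms(2-4) unfolding reduced_iff[OF \<open>acyclic (A \<inter> W \<times> W)\<close>]
      reduced_iff[OF \<open>acyclic (A \<inter> U \<times> U)\<close>] by blast
qed

text \<open>An acyclic triangle is transitive, so one of its arcs is bypassed by the other
  two.\<close>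

lemma reduced_trianglefree:
  assumes "acyclic E" "(x, y) \<in> edges (reduced E)"
    "(y, z) \<in> edges (reduced E)" "(x, z) \<in> edges E" "(x, z) \<in> edges (reduced E)"
  shows False
proof -
  have c: False if "(a, b) \<in> E" "(b, c) \<in> E" "(c, a) \<in> E" for a b c
    using that assms(1) by (meson acyclic_def trancl.simps)
  have t: False if "(a, b) \<in> E" "(b, c) \<in> E" "(a, c) \<in> reduced E" for a b c
    using that reduced_iff[OF assms(1)] by blast
  have s: "(a, b) \<in> E" if "(a, b) \<in> reduced E" for a b
    using that reduced_subset by blast
  show False using assms(2,3,5) unfolding edges_orient by (metis c t s)
qed

text \<open>If \<open>s\<close> were a source or a sink of the triangle, the third arc together with
  one arc at \<open>s\<close> would bypass the other arc at \<open>s\<close>.\<close>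

lemma triangle_orientation:
  assumes "acyclic E" "(y, s) \<in> edges (reduced E)"
    "(s, z) \<in> edges (reduced E)" "(y, z) \<in> edges E"
  shows "(y, s) \<in> reduced E \<and> (s, z) \<in> reduced E \<and> (y, z) \<in> E \<or>
     (z, s) \<in> reduced E \<and> (s, y) \<in> reduced E \<and> (z, y) \<in> E"
proof -
  have c: False if "(a, b) \<in> E" "(b, c) \<in> E" "(c, a) \<in> E" for a b c
    using that assms(1) by (meson acyclic_def trancl.simps)
  have t: False if "(a, b) \<in> E" "(b, c) \<in> E" "(a, c) \<in> reduced E" for a b c
    using that reduced_iff[OF assms(1)] by blast
  have s: "(a, b) \<in> E" if "(a, b) \<in> reduced E" for a b
    using that reduced_subset by blast
  show ?thesis using assms(2-4) unfolding edges_orient by (metis c t s)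
qed

text \<open>
  Together with chordality, this local condition is the link between the combinatorial and
  the geometric sides of the tightness criterion: both are shown equivalent to it.
\<close>

definition diamond_condition :: "'v rel \<Rightarrow> bool" where
  "diamond_condition A \<longleftrightarrow> (\<forall>a b c x. (a, b) \<in> A \<and> (b, c) \<in> A \<and> (a, c) \<in> A \<and>
     (a, x) \<in> edges A \<and> (x, c) \<in> edges A \<and> x \<noteq> b \<longrightarrow> (b, x) \<in> edges A)"

lemma diamond_conditionD:
  assumes "diamond_condition A" "(a, b) \<in> A" "(b, c) \<in> A" "(a, c) \<in> A"
    "(a, x) \<in> edges A" "(x, c) \<in> edges A" "x \<noteq> b"
  shows "(b, x) \<in> edges A"
  using assms unfolding diamond_condition_def by blast

lemma edge_along_path:
  assumes "acyclic A" "(u, v) \<in> edges A" "(u, v) \<in> A\<^sup>*"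
  shows "(u, v) \<in> A"
proof (rule ccontr)
  assume "(u, v) \<notin> A"
  then have "(v, u) \<in> A" using assms(2) by (simp add: edges_orient)
  with assms show False using acyclic_antisym by (metis r_into_trancl)
qed

text \<open>Closed by the arc from head to last, the path is a cycle. A chord from position
  \<open>a\<close> to position \<open>b\<close> splits it into the segment \<open>X\<close> and the
  shortcut \<open>Y\<close>, both again directed paths closed by an arc, and both are cliques by
  induction.\<close>

lemma dipath_clique:
  assumes "acyclic A" "chordal A" "diamond_condition A"
  shows "dipath A p \<Longrightarrow> (hd p, last p) \<in> A \<Longrightarrow> u \<in> set p \<Longrightarrow> v \<in> set p \<Longrightarrow> u \<noteq> v \<Longrightarrow> (u, v) \<in> edges A"
proof (induction "length p" arbitrary: p u v rule: less_induct)
  case less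
  have succ: "walk A p" and d: "distinct p" and ne: "p \<noteq> []"
    using less.prems(1) by (auto simp: dipath_def)
  have succ': "walk (edges A) p"
    using succ by (rule successively_mono) (auto simp: edges_orient)
  have hl: "(hd p, last p) \<in> edges A" using less.prems(2) by (simp add: edges_orient)
  show ?case
  proof (cases "4 \<le> length p")
    case False
    then have "length p = 1 \<or> length p = 2 \<or> length p = 3"
      using ne length_greater_0_conv[of p] by linarith
    then consider a where "p = [a]" | a b where "p = [a, b]" | a b c where "p = [a, b, c]"
      by (auto simp: numeral_eq_Suc length_Suc_conv)
    then show ?thesis
      by cases (use less.prems succ' hl in \<open>auto simp: edges_orient\<close>)
  next
    case True
    then have "undirected_cycle A p"
      using closed_path_cycle[OF succ' d _ hl] by simp
    then obtain a b where ab: "nonconsecutive (length p) a b" "(p ! a, p ! b) \<in> edges A"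
      using assms(2) True unfolding chordal_def by blast
    then have lt: "Suc a < b" "b < length p" "\<not> (a = 0 \<and> Suc b = length p)"
      by (auto simp: nonconsecutive_def)
    have abA: "(p ! a, p ! b) \<in> A"
      using edge_along_path[OF assms(1) ab(2)] path_nth_trancl[OF succ, of a b] lt
      by (simp add: trancl_into_rtrancl)
    define X where "X = take (Suc (b - a)) (drop a p)"
    define Y where "Y = take (Suc a) p @ drop b p"
    have lenX: "length X = Suc (b - a)" using lt by (simp add: X_def)
    have nthX: "X ! k = p ! (a + k)" if "k \<le> b - a" for k using that lt by (simp add: X_def)
    have sX: "walk A X"
      unfolding successively_conv_nth lenX using succ nthX lt by (auto simp: successively_conv_nth)
    have hlX: "hd X = p ! a" "last X = p ! b"
      using nthX[of 0] nthX[of "b - a"] lenX lt hd_conv_nth[of X] last_conv_nth[of X] by force+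
    have cX: "(u, v) \<in> edges A" if "u \<in> set X" "v \<in> set X" "u \<noteq> v" for u v
    proof (rule less.hyps[of X])
      show "length X < length p" using lenX lt by auto
      show "dipath A X" using sX d lenX by (auto simp: dipath_def X_def)
    qed (use that hlX abA in auto)
    have cY: "(u, v) \<in> edges A" if "u \<in> set Y" "v \<in> set Y" "u \<noteq> v" for u v
    proof (rule less.hyps[of Y])
      note sc = path_shortcut[of "\<lambda>u v. (u, v) \<in> A" p a b, OF succ _ lt(2) abA]
      have "a < b" using lt by simp
      show "length Y < length p" using lt by (auto simp: Y_def)
      show "dipath A Y" using sc(1)[OF \<open>a < b\<close>] path_distinct[OF assms(1) sc(1)[OF \<open>a < b\<close>]] ne
        by (simp add: dipath_def Y_def del: distinct_append)
      show "(hd Y, last Y) \<in> A" using sc(2,3)[OF \<open>a < b\<close>] less.prems(2) by (simp add: Y_def)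
    qed (use that in auto)
    have "set p = set (take a p @ X @ drop (Suc b) p)"
    proof -
      have "drop a p = X @ drop (Suc b) p"
        using lt append_take_drop_id[of "Suc (b - a)" "drop a p", symmetric] by (simp add: X_def)
      then show ?thesis by (metis append_take_drop_id)
    qed
    also have "\<dots> \<subseteq> set X \<union> set Y"
    proof -
      have "set (take a p) \<subseteq> set (take (Suc a) p)" by (simp add: set_take_subset_set_take)
      moreover have "set (drop (Suc b) p) \<subseteq> set (drop b p)" by (simp add: set_drop_subset_set_drop)
      ultimately show ?thesis by (auto simp: Y_def)
    qed
    finally have sub: "set p \<subseteq> set X \<union> set Y" .
    have inX: "p ! a \<in> set X" "p ! b \<in> set X"
      using hlX lenX by (metis hd_in_set last_in_set length_0_conv nat.distinct(1))+
    have inY: "p ! a \<in> set Y" "p ! b \<in> set Y"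
    proof -
      have "p ! a \<in> set (take (Suc a) p)" using lt by (simp add: take_Suc_conv_app_nth)
      then show "p ! a \<in> set Y" by (simp add: Y_def)
      have "p ! b \<in> set (drop b p)" using lt by (metis Cons_nth_drop_Suc list.set_intros(1))
      then show "p ! b \<in> set Y" by (simp add: Y_def)
    qed
    \<comment> \<open>\<open>w\<close> lies on the segment, so \<open>p ! a\<close>,
      \<open>w\<close>, \<open>p ! b\<close> is a directed triangle; \<open>x\<close> is adjacent to
      both of its ends inside the clique \<open>Y\<close>.\<close>
    have mixed: "(w, x) \<in> edges A" if "w \<in> set X" "w \<notin> set Y" "x \<in> set Y" "x \<notin> set X" for w x
    proof (rule diamond_conditionD[OF assms(3)])
      have w: "w \<noteq> p ! a" "w \<noteq> p ! b" and x: "x \<noteq> p ! a" "x \<noteq> p ! b"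
        using that inX inY by auto
      show "(p ! a, w) \<in> A"
        using edge_along_path[OF assms(1) cX[OF inX(1) that(1)]] w path_hd_rtrancl[OF sX that(1)] hlX by auto
      show "(w, p ! b) \<in> A"
        using edge_along_path[OF assms(1) cX[OF that(1) inX(2)]] w path_last_rtrancl[OF sX that(1)] hlX by auto
      show "(p ! a, p ! b) \<in> A" by (rule abA)
      show "(p ! a, x) \<in> edges A" "(x, p ! b) \<in> edges A"
        using cY inY that x by auto
      show "x \<noteq> w" using that by auto
    qed
    show ?thesis
      using sub less.prems(3-5) cX cY mixed edges_sym by (metis UnE subsetD)
  qed
qed

lemma chordal_diamond_imp_filled:
  assumes "acyclic A" "chordal A" "diamond_condition A"
  shows "filled A"
  unfolding filled_def
proof (intro allI impI, elim conjE)
  fix p i j assume p: "dipath A p" "(hd p, last p) \<in> A" and ij: "i < j" "j < length p"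
  then have "p ! i \<noteq> p ! j" by (auto simp: dipath_def nth_eq_iff_index_eq)
  then have "(p ! i, p ! j) \<in> edges A"
    using dipath_clique[OF assms p, of "p ! i" "p ! j"] ij by auto
  moreover have "(p ! i, p ! j) \<in> A\<^sup>+"
    using path_nth_trancl[of A p i j] p ij by (auto simp: dipath_def)
  ultimately show "(p ! i, p ! j) \<in> A"
    using edge_along_path[OF assms(1)] trancl_into_rtrancl by metis
qed

text \<open>By filledness a bypass of \<open>(y, z)\<close> gives a vertex \<open>t\<close> with
  arcs \<open>y\<close> to \<open>t\<close> to \<open>z\<close>. The diamond condition joins
  \<open>s\<close> and \<open>t\<close>, and either direction of that edge bypasses one of the
  irreducible arcs at \<open>s\<close>.\<close>

lemma ear_arc_reduced:
  assumes "acyclic A" "filled A" "diamond_condition A"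
    and ys: "(y, s) \<in> reduced (A \<inter> U \<times> U)" and sz: "(s, z) \<in> reduced (A \<inter> U \<times> U)"
    and yz: "(y, z) \<in> A" and W: "W \<subseteq> U" "s \<notin> W" "y \<in> W" "z \<in> W"
  shows "(y, z) \<in> reduced (A \<inter> W \<times> W)"
proof (rule ccontr)
  assume "\<not> ?thesis"
  then obtain p where p: "dipath (A \<inter> W \<times> W) p" "hd p = y" "last p = z" "3 \<le> length p"
    using yz W by (auto simp: transitive_reduction_def)
  have acU: "acyclic (A \<inter> U \<times> U)" using assms(1) acyclic_subset by blast
  have ysA: "(y, s) \<in> A" "(s, z) \<in> A" "s \<in> U"
    using ys sz reduced_subset by blast+
  have "dipath A p" using p(1) by (auto simp: dipath_def elim: successively_mono)
  then have fp: "(p ! i, p ! j) \<in> A" if "i < j" "j < length p" for i j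
    using assms(2) p yz that unfolding filled_def by blast
  define t where "t = p ! 1"
  have ne: "p \<noteq> []" using p by auto
  have yt: "(y, t) \<in> A" "(t, z) \<in> A"
    using fp[of 0 1] fp[of 1 "length p - 1"] p ne by (auto simp: t_def hd_conv_nth last_conv_nth)
  have "t \<in> W"
    using p ne successively_nth[of _ p 0] by (fastforce simp: t_def dipath_def)
  then have "t \<noteq> s" "t \<in> U" using W by auto
  have "(s, t) \<in> edges A"
    by (rule diamond_conditionD[OF assms(3) ysA(1,2) yz]) (use yt \<open>t \<noteq> s\<close> in \<open>auto simp: edges_orient\<close>)
  moreover have "y \<in> U" "z \<in> U" using W by auto
  ultimately have "(s, t) \<in> A \<inter> U \<times> U \<and> (t, z) \<in> A \<inter> U \<times> U \<or>
      (y, t) \<in> A \<inter> U \<times> U \<and> (t, s) \<in> A \<inter> U \<times> U"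
    using yt ysA \<open>t \<in> U\<close> by (auto simp: edges_orient)
  then show False
    using ys sz unfolding reduced_iff[OF acU] by (metis r_into_trancl')
qed

text \<open>Induction by cutting off ears. The vertex set must shrink along with the cycle, because
  the chord \<open>yz\<close> is bypassed by \<open>s\<close> and becomes irreducible only after
  \<open>s\<close> is deleted.\<close>

lemma no_reduced_cycle:
  assumes "acyclic A" "chordal A" "diamond_condition A"
  shows "\<not> undirected_cycle (reduced (A \<inter> set c \<times> set c)) c"
proof (induction "length c" arbitrary: c rule: less_induct)
  case less
  let ?R = "reduced (A \<inter> set c \<times> set c)"
  have ac: "acyclic (A \<inter> set c \<times> set c)" using assms(1) acyclic_subset by blast
  show ?case
  proof
    assume cyc: "undirected_cycle ?R c"
    have R: "(u, v) \<in> A" if "(u, v) \<in> ?R" for u v using that reduced_subset by blast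
    have cycA: "undirected_cycle A c"
      using cyc by (rule undirected_cycle_mono) (use R in \<open>auto simp: edges_orient\<close>)
    show False
    proof (cases "4 \<le> length c")
      case False
      then have "length c = 3" using cyc by (auto simp: undirected_cycle_iff)
      then obtain x y z where c: "c = [x, y, z]" by (auto simp: numeral_3_eq_3 length_Suc_conv)
      then have "(x, y) \<in> edges ?R" "(y, z) \<in> edges ?R" "(x, z) \<in> edges ?R"
        using cyc edges_sym[of z x] by (auto simp: undirected_cycle_iff)
      moreover from this(3) have "(x, z) \<in> edges (A \<inter> set c \<times> set c)"
        using reduced_subset unfolding edges_orient by blast
      ultimately show False using reduced_trianglefree[OF ac, of x y z] by blast
    next
      case True
      then obtain xs y s z ys where c: "c = xs @ [y, s, z] @ ys" and yz: "(y, z) \<in> edges A"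
        using chordal_ear[OF assms(2) cycA] by metis
      let ?W = "set (xs @ [y, z] @ ys)"
      have d: "distinct c" using cyc by (auto simp: undirected_cycle_iff)
      have W: "?W \<subseteq> set c" "s \<notin> ?W" "y \<in> ?W" "z \<in> ?W" using d by (auto simp: c)
      have e: "(y, s) \<in> edges ?R" "(s, z) \<in> edges ?R"
        using cyc by (auto simp: c undirected_cycle_iff successively_append_iff)
      have yz': "(y, z) \<in> edges (A \<inter> set c \<times> set c)" using yz W by (auto simp: edges_orient)
      have arc: "(y, z) \<in> edges (reduced (A \<inter> ?W \<times> ?W))"
        using triangle_orientation[OF ac e yz']
      proof (elim disjE conjE)
        assume "(y, s) \<in> ?R" "(s, z) \<in> ?R" "(y, z) \<in> A \<inter> set c \<times> set c"
        then show ?thesis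
          using ear_arc_reduced[OF assms(1) chordal_diamond_imp_filled[OF assms] assms(3), of y s "set c" z ?W] W
          unfolding edges_orient by blast
      next
        assume "(z, s) \<in> ?R" "(s, y) \<in> ?R" "(z, y) \<in> A \<inter> set c \<times> set c"
        then show ?thesis
          using ear_arc_reduced[OF assms(1) chordal_diamond_imp_filled[OF assms] assms(3), of z s "set c" y ?W] W
          unfolding edges_orient by blast
      qed
      have sub: "(u, v) \<in> reduced (A \<inter> ?W \<times> ?W)" if "(u, v) \<in> ?R" "u \<noteq> s" "v \<noteq> s" for u v
      proof (rule reduced_restrict[OF assms(1) that(1) _ _ W(1)])
        have "u \<in> set c" "v \<in> set c" using that reduced_subset by blast+
        then show "u \<in> ?W" "v \<in> ?W" using that by (auto simp: c)
      qed
      have "undirected_cycle (reduced (A \<inter> ?W \<times> ?W)) (xs @ [y, z] @ ys)"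
        using cyc[unfolded c] True[unfolded c] arc sub unfolding c by (rule undirected_cycle_delete)
      then show False using less.hyps[of "xs @ [y, z] @ ys"] by (simp add: c)
    qed
  qed
qed

lemma undirected_cycle_vertices:
  assumes "undirected_cycle R c" "u \<in> set c"
  shows "\<exists>v. (u, v) \<in> edges R"
  using assms by (metis in_set_conv_nth undirected_cycle_def)

lemma chordal_diamond_imp_vertebrate:
  assumes "acyclic A" "chordal A" "diamond_condition A"
  shows "vertebrate A"
  unfolding vertebrate_def forest_def
proof (intro allI notI, elim exE)
  fix U c assume c: "undirected_cycle (reduced (A \<inter> U \<times> U)) c"
  have U: "set c \<subseteq> U"
    using undirected_cycle_vertices[OF c] reduced_subset[of "A \<inter> U \<times> U"]
    unfolding edges_orient by blast
  \<comment> \<open>Deleting the vertices of \<open>U\<close> off the cycle keeps its arcs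
    irreducible.\<close>
  have "undirected_cycle (reduced (A \<inter> set c \<times> set c)) c"
    using c
  proof (rule undirected_cycle_mono)
    fix u v assume "u \<in> set c" "v \<in> set c" "(u, v) \<in> reduced (A \<inter> U \<times> U)"
    then show "(u, v) \<in> edges (reduced (A \<inter> set c \<times> set c))"
      using reduced_restrict[OF assms(1) _ _ _ U] unfolding edges_orient by blast
  qed
  with no_reduced_cycle[OF assms] show False by blast
qed

section \<open>Chordless cycles, and why skeletal digraphs satisfy the two local conditions\<close>

definition chordless_cycle :: "'v rel \<Rightarrow> 'v list \<Rightarrow> bool" where
  "chordless_cycle A c \<longleftrightarrow> undirected_cycle A c \<and> 4 \<le> length c \<and>
     (\<forall>i j. i < j \<and> j < length c \<and> (c ! i, c ! j) \<in> edges A \<longrightarrow> j = Suc i \<or> i = 0 \<and> Suc j = length c)"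

lemma chordal_iff: "chordal A \<longleftrightarrow> \<not> (\<exists>c. chordless_cycle A c)"
proof -
  have "(\<exists>i j. nonconsecutive (length c) i j \<and> (c ! i, c ! j) \<in> edges A) \<longleftrightarrow>
    \<not> (\<forall>i j. i < j \<and> j < length c \<and> (c ! i, c ! j) \<in> edges A \<longrightarrow> j = Suc i \<or> i = 0 \<and> Suc j = length c)" for c
    unfolding nonconsecutive_def by (simp, fast)
  moreover have "(\<forall>c. P c \<and> Q c \<longrightarrow> \<not> R c) \<longleftrightarrow> \<not> (\<exists>c. P c \<and> Q c \<and> R c)"
    for P Q R :: "'a list \<Rightarrow> bool"
    by blast
  ultimately show ?thesis unfolding chordal_def chordless_cycle_def by (simp only:)
qed

text \<open>Three positions that are pairwise neighbours in cyclic order exist only in a cycle of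
  length 3.\<close>

lemma chordless_trianglefree:
  assumes "chordless_cycle A c" "u \<in> set c" "v \<in> set c" "w \<in> set c" "u \<noteq> v" "v \<noteq> w" "u \<noteq> w"
    "(u, v) \<in> edges A" "(v, w) \<in> edges A" "(u, w) \<in> edges A"
  shows False
proof -
  obtain i j k where ijk: "i < length c" "u = c ! i" "j < length c" "v = c ! j" "k < length c" "w = c ! k"
    using assms(2-4) by (metis in_set_conv_nth)
  then have d: "i \<noteq> j" "j \<noteq> k" "i \<noteq> k" using assms by auto
  have adj: "b = Suc a \<or> a = 0 \<and> Suc b = length c" if "a < b" "b < length c" "(c ! a, c ! b) \<in> edges A" for a b
    using assms(1) that unfolding chordless_cycle_def by blast
  have n: "4 \<le> length c" using assms(1) by (simp add: chordless_cycle_def)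
  have e: "(c ! i, c ! j) \<in> edges A" "(c ! j, c ! k) \<in> edges A" "(c ! i, c ! k) \<in> edges A"
    "(c ! j, c ! i) \<in> edges A" "(c ! k, c ! j) \<in> edges A" "(c ! k, c ! i) \<in> edges A"
    using assms ijk edges_sym by metis+
  have "i < j \<or> j < i" "j < k \<or> k < j" "i < k \<or> k < i" using d by auto
  with adj[OF _ _ e(1)] adj[OF _ _ e(2)] adj[OF _ _ e(3)] adj[OF _ _ e(4)] adj[OF _ _ e(5)] adj[OF _ _ e(6)]
    ijk n show False by linarith
qed

text \<open>On the vertex set of a chordless cycle the reduction is a forest, so some arc between
  these vertices is bypassed. Filledness turns the bypass into a triangle.\<close>

lemma skeletal_imp_chordal:
  assumes "acyclic A" "skeletal A"
  shows "chordal A"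
proof (rule ccontr)
  assume "\<not> chordal A"
  then obtain c where c: "chordless_cycle A c" unfolding chordal_iff by blast
  then have cyc: "undirected_cycle A c" by (simp add: chordless_cycle_def)
  let ?B = "A \<inter> set c \<times> set c"
  have "forest (reduced ?B)" using assms(2) by (auto simp: skeletal_def vertebrate_def)
  then have "\<not> undirected_cycle (reduced ?B) c" by (auto simp: forest_def)
  then obtain u v where uv: "(u, v) \<in> ?B" "(u, v) \<notin> reduced ?B"
    using undirected_cycle_mono[OF cyc, of "reduced ?B"] unfolding edges_orient by blast
  then obtain p where p: "dipath ?B p" "hd p = u" "last p = v" "3 \<le> length p"
    by (auto simp: transitive_reduction_def)
  have "dipath A p" using p(1) by (auto simp: dipath_def elim: successively_mono)
  then have fp: "(p ! i, p ! j) \<in> A" if "i < j" "j < length p" for i j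
    using assms(2) p uv that unfolding skeletal_def filled_def by blast
  define t where "t = p ! 1"
  have ne: "p \<noteq> []" using p by auto
  have t: "(u, t) \<in> A" "(t, v) \<in> A"
    using fp[of 0 1] fp[of 1 "length p - 1"] p ne by (auto simp: t_def hd_conv_nth last_conv_nth)
  have "t \<in> set c"
    using p ne successively_nth[of _ p 0] by (fastforce simp: t_def dipath_def)
  moreover have "u \<noteq> v" "t \<noteq> u" "t \<noteq> v" using t uv assms(1) by (auto simp: acyclic_def)
  ultimately show False
    using chordless_trianglefree[OF c, of u t v] uv t by (auto simp: edges_orient)
qed

text \<open>If \<open>b\<close> and \<open>x\<close> were not adjacent, filledness would force
  \<open>x\<close> to lie between \<open>a\<close> and \<open>c\<close> just like \<open>b\<close>.
  The two routes from \<open>a\<close> to \<open>c\<close> then form a cycle in the reduction of the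
  subgraph induced on the four vertices.\<close>

lemma skeletal_imp_diamond_condition:
  assumes ac: "acyclic A" and sk: "skeletal A"
  shows "diamond_condition A"
  unfolding diamond_condition_def
proof (intro allI impI, elim conjE, rule ccontr)
  fix a b c x
  assume ab: "(a, b) \<in> A" and bc: "(b, c) \<in> A" and ca: "(a, c) \<in> A" and ax: "(a, x) \<in> edges A"
    and xc: "(x, c) \<in> edges A" and xb: "x \<noteq> b" and n: "(b, x) \<notin> edges A"
  have fl: "filled A" using sk by (simp add: skeletal_def)
  have n': "(b, x) \<notin> A" "(x, b) \<notin> A" using n by (auto simp: edges_orient)
  have ne: "u \<noteq> v" if "(u, v) \<in> A" for u v using that ac by (auto simp: acyclic_def)
  have cy: False if "(u, v) \<in> A" "(v, w) \<in> A" "(w, u) \<in> A" for u v w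
    using that ac by (meson acyclic_def trancl.simps)
  have asym: False if "(u, v) \<in> A" "(v, u) \<in> A" for u v
    using that ac by (meson acyclic_def trancl.simps)
  have d: "distinct [a, b, c, x]"
    using ne[OF ab] ne[OF bc] ne[OF ca] ax xc xb edges_irrefl[OF ac] by auto
  \<comment> \<open>Otherwise \<open>x, a, b, c\<close> is a directed path closed by an arc, and
    filledness joins \<open>x\<close> to \<open>b\<close>. The dual argument below uses
    \<open>a, b, c, x\<close>.\<close>
  have "(a, x) \<in> A"
  proof (rule ccontr)
    assume "(a, x) \<notin> A"
    then have xa: "(x, a) \<in> A" using ax by (simp add: edges_orient)
    then have "(x, c) \<in> A" using xc cy ca by (auto simp: edges_orient)
    then have "([x, a, b, c] ! 0, [x, a, b, c] ! 2) \<in> A"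
      using fl[unfolded filled_def, rule_format, of "[x, a, b, c]" 0 2] xa ab bc d by (auto simp: dipath_def)
    then show False using n' by simp
  qed
  moreover have "(x, c) \<in> A"
  proof (rule ccontr)
    assume "(x, c) \<notin> A"
    then have cx: "(c, x) \<in> A" using xc by (simp add: edges_orient)
    then have "(a, x) \<in> A" using ax cy ca by (auto simp: edges_orient)
    then have "([a, b, c, x] ! 1, [a, b, c, x] ! 3) \<in> A"
      using fl[unfolded filled_def, rule_format, of "[a, b, c, x]" 1 3] cx ab bc d by (auto simp: dipath_def)
    then show False using n' by simp
  qed
  moreover define B where "B = A \<inter> {a, b, c, x} \<times> {a, b, c, x}"
  have acB: "acyclic B" using ac acyclic_subset unfolding B_def by blast
  ultimately have axA: "(a, x) \<in> A" and xcA: "(x, c) \<in> A" by auto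
  have B: "B = {(a, b), (b, c), (a, c), (a, x), (x, c)}"
    unfolding B_def using ab bc ca axA xcA n' asym ne by auto
  have TR: "(u, v) \<in> reduced B" if "(u, v) \<in> {(a, b), (b, c), (a, x), (x, c)}" for u v
    unfolding reduced_iff[OF acB]
  proof (intro conjI notI)
    show "(u, v) \<in> B" using that B by auto
    assume "\<exists>w. (u, w) \<in> B\<^sup>+ \<and> (w, v) \<in> B\<^sup>+"
    then obtain w where w: "(u, w) \<in> B\<^sup>+" "(w, v) \<in> B\<^sup>+" by blast
    obtain u' where u': "(u, u') \<in> B" "(u', w) \<in> B\<^sup>*" using w(1) by (meson tranclD)
    obtain v' where v': "(v', v) \<in> B" "(w, v') \<in> B\<^sup>*" using w(2) by (meson tranclD2)
    \<comment> \<open>In \<open>B\<close> the vertices \<open>b\<close> and \<open>x\<close> have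
      \<open>a\<close> as only in-neighbour and \<open>c\<close> as only out-neighbour.\<close>
    have "u' = v \<or> v' = u"
      using u' v' that d unfolding B by auto
    then show False
    proof
      assume "u' = v"
      then show False using u' w(2) acyclic_antisym[OF acB] by blast
    next
      assume "v' = u"
      then show False using v' w(1) acyclic_antisym[OF acB] by blast
    qed
  qed
  have "undirected_cycle (reduced B) [a, b, c, x]"
    using TR d by (auto simp: undirected_cycle_iff edges_orient)
  moreover have "forest (reduced B)"
    using sk unfolding skeletal_def vertebrate_def B_def by blast
  ultimately show False by (auto simp: forest_def)
qed

lemma skeletal_iff:
  assumes "acyclic A"
  shows "skeletal A \<longleftrightarrow> chordal A \<and> diamond_condition A"
  using assms skeletal_imp_chordal skeletal_imp_diamond_condition
    chordal_diamond_imp_vertebrate chordal_diamond_imp_filled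
  by (metis skeletal_def)

section \<open>Acyclic reorientations\<close>

definition reorientation :: "'v rel \<Rightarrow> 'v rel \<Rightarrow> bool" where
  "reorientation A E \<longleftrightarrow> acyclic E \<and> edges E = edges A"

lemma reorientation_edge:
  assumes "reorientation A E" "(u, v) \<in> E"
  shows "(u, v) \<in> edges A" "(v, u) \<in> edges A"
  using assms by (auto simp: reorientation_def edges_def)

text \<open>The orientation is prescribed on \<open>U\<close>, and every edge leaving
  \<open>U\<close> points outwards. A directed path that ends in \<open>U\<close> therefore stays in
  \<open>U\<close>, so bypasses of arcs in \<open>U\<close> can be judged inside
  \<open>U\<close>.\<close>

lemma orient_by_rank:
  fixes A :: "'v::finite rel" and f :: "'v \<Rightarrow> nat"
  assumes "acyclic A" "inj_on f U"
  obtains E where "reorientation A E"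
    "\<And>u v. u \<in> U \<Longrightarrow> v \<in> U \<Longrightarrow> (u, v) \<in> E \<longleftrightarrow> (u, v) \<in> edges A \<and> f u < f v"
    "\<And>u v. (u, v) \<in> E \<Longrightarrow> v \<in> U \<Longrightarrow> u \<in> U"
proof -
  obtain g :: "'v \<Rightarrow> nat" where g: "inj g"
    using finite_imp_inj_to_nat_seg[of "UNIV :: 'v set"] by auto
  define M where "M = Suc (Max (f ` U))"
  have M: "f u < M" if "u \<in> U" for u using that by (simp add: M_def less_Suc_eq_le)
  \<comment> \<open>All vertices outside \<open>U\<close> rank above those of \<open>U\<close>; the
    injection \<open>g\<close> separates them from each other.\<close>
  define r where "r v = (if v \<in> U then f v else M + g v)" for v
  have r: "u = v" if "r u = r v" for u v
    using that assms(2) g M[of u] M[of v] by (auto simp: r_def inj_on_def split: if_splits)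
  define E where "E = {(u, v) \<in> edges A. r u < r v}"
  have "E \<subseteq> Wellfounded.measure r" by (auto simp: E_def)
  then have "acyclic E" using wf_acyclic[OF wf_measure] acyclic_subset by blast
  moreover have "edges E = edges A"
  proof -
    have "(u, v) \<in> edges E" if "(u, v) \<in> edges A" for u v
    proof -
      have "u \<noteq> v" using that edges_irrefl[OF assms(1)] by auto
      then have "r u < r v \<or> r v < r u" using r by (metis linorder_neqE_nat)
      then show ?thesis using that edges_sym[of u v A] by (auto simp: E_def edges_orient[of u v "Collect _"])
    qed
    moreover have "(u, v) \<in> edges A" if "(u, v) \<in> edges E" for u v
      using that by (auto simp: E_def edges_def)
    ultimately show ?thesis by auto
  qed
  ultimately have "reorientation A E" by (simp add: reorientation_def)
  then show thesis
  proof (rule that)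
    fix u v assume "u \<in> U" "v \<in> U"
    then show "(u, v) \<in> E \<longleftrightarrow> (u, v) \<in> edges A \<and> f u < f v" by (auto simp: E_def r_def)
  next
    fix u v assume "(u, v) \<in> E" "v \<in> U"
    then show "u \<in> U" using M[of v] by (auto simp: E_def r_def split: if_splits)
  qed
qed

lemma trancl_rank:
  fixes f :: "'v \<Rightarrow> nat"
  assumes E: "\<And>u v. u \<in> U \<Longrightarrow> v \<in> U \<Longrightarrow> (u, v) \<in> E \<Longrightarrow> f u < f v"
    "\<And>u v. (u, v) \<in> E \<Longrightarrow> v \<in> U \<Longrightarrow> u \<in> U"
    and uv: "(u, v) \<in> E\<^sup>+" "v \<in> U"
  shows "u \<in> U \<and> f u < f v"
  using uv
proof (induction rule: trancl_induct)
  case (base y)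
  then show ?case using E by blast
next
  case (step y z)
  then show ?case using E by (meson less_trans)
qed

text \<open>The ranks 0, 1, 2, 3 are given to \<open>p\<close>, \<open>x\<close>, \<open>y\<close>,
  \<open>q\<close>. The only path that could bypass an outer edge runs from \<open>x\<close> to
  \<open>y\<close>, and there is none: these two are not adjacent and no rank lies between
  theirs.\<close>

lemma diamond_orientation:
  fixes A :: "'v::finite rel"
  assumes "acyclic A" "(p, x) \<in> edges A" "(x, q) \<in> edges A" "(p, y) \<in> edges A" "(y, q) \<in> edges A"
    "(x, y) \<notin> edges A" "x \<noteq> y" "p \<noteq> q"
  obtains E where "reorientation A E"
    "{(p, x), (x, q), (p, y), (y, q)} \<subseteq> reduced E"
proof -
  define f :: "'v \<Rightarrow> nat" where "f v = (if v = p then 0 else if v = x then 1 else if v = y then 2 else 3)" for v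
  let ?U = "{p, x, y, q}"
  have ne: "p \<noteq> x" "x \<noteq> q" "p \<noteq> y" "y \<noteq> q" using assms edges_irrefl by metis+
  have f: "f p = 0" "f x = 1" "f y = 2" "f q = 3" using ne assms(7,8) by (auto simp: f_def)
  have "inj_on f ?U" using f by (auto simp: inj_on_def)
  then obtain E where E: "reorientation A E"
    "\<And>u v. u \<in> ?U \<Longrightarrow> v \<in> ?U \<Longrightarrow> (u, v) \<in> E \<longleftrightarrow> (u, v) \<in> edges A \<and> f u < f v"
    "\<And>u v. (u, v) \<in> E \<Longrightarrow> v \<in> ?U \<Longrightarrow> u \<in> ?U"
    using orient_by_rank[OF assms(1)] by metis
  have ac: "acyclic E" using E(1) by (simp add: reorientation_def)
  have rank: "u \<in> ?U \<and> f u < f v" if "(u, v) \<in> E\<^sup>+" "v \<in> ?U" for u v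
    using trancl_rank[of ?U E f, OF _ _ that] E(2,3) by blast
  have xy: "(x, y) \<notin> E\<^sup>+"
  proof
    assume "(x, y) \<in> E\<^sup>+"
    then show False
    proof (cases rule: tranclE)
      case base
      then show False using assms(6) reorientation_edge(1)[OF E(1)] by blast
    next
      case (step t)
      then have "f x < f t" "t \<in> ?U" "f t < f y"
        using rank[of x t] rank[of t y] by auto
      then show False using f by auto
    qed
  qed
  have TR: "(u, v) \<in> reduced E"
    if "(u, v) \<in> {(p, x), (x, q), (p, y), (y, q)}" for u v
    unfolding reduced_iff[OF ac]
  proof (intro conjI notI)
    show "(u, v) \<in> E" using that assms f E(2)[of u v] by auto
    assume "\<exists>w. (u, w) \<in> E\<^sup>+ \<and> (w, v) \<in> E\<^sup>+"
    then obtain w where w: "(u, w) \<in> E\<^sup>+" "(w, v) \<in> E\<^sup>+" by blast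
    have "v \<in> ?U" using that by auto
    then have "w \<in> ?U" "f w < f v" "f u < f w" using rank w by blast+
    then show False using that f w xy by auto
  qed
  then show thesis using that[OF E(1)] by blast
qed

text \<open>A bypass is split into its first arc, a middle part and its last arc, so that mostly the
  neighbours of \<open>u\<close> and \<open>v\<close> have to be examined.\<close>

lemma reducedI:
  assumes "acyclic E" "(u, v) \<in> E"
    "\<And>x y. (u, x) \<in> E \<Longrightarrow> x \<noteq> v \<Longrightarrow> (x, y) \<in> E\<^sup>* \<Longrightarrow> (y, v) \<in> E \<Longrightarrow> y \<noteq> u \<Longrightarrow> False"
  shows "(u, v) \<in> reduced E"
  unfolding reduced_iff[OF assms(1)]
proof (intro conjI notI)
  show "(u, v) \<in> E" by fact
  assume "\<exists>w. (u, w) \<in> E\<^sup>+ \<and> (w, v) \<in> E\<^sup>+"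
  then obtain w where w: "(u, w) \<in> E\<^sup>+" "(w, v) \<in> E\<^sup>+" by blast
  obtain x where x: "(u, x) \<in> E" "(x, w) \<in> E\<^sup>*" using w(1) by (meson tranclD)
  obtain y where y: "(y, v) \<in> E" "(w, y) \<in> E\<^sup>*" using w(2) by (meson tranclD2)
  have "x \<noteq> v" using x(2) w(2) acyclic_antisym[OF assms(1)] by blast
  moreover have "y \<noteq> u" using y(2) w(1) acyclic_antisym[OF assms(1)] by blast
  moreover have "(x, y) \<in> E\<^sup>*" using x y by simp
  ultimately show False using assms(3) x y by blast
qed

text \<open>
  The arcs \<open>(c\<^sub>i, c\<^sub>i\<^sub>+\<^sub>1)\<close> run forwards except for two, so no arc of the cycle is transitive,
  but contracting the two backward arcs makes the remaining ones into directed closed walks.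
\<close>

lemma chordless_orientation:
  fixes A :: "'v::finite rel"
  assumes ac: "acyclic A" and c: "chordless_cycle A c" and k: "1 \<le> k" "k + 2 \<le> length c"
  obtains E where "reorientation A E"
    "\<And>i. Suc i < length c \<Longrightarrow> i \<noteq> k \<Longrightarrow> (c ! i, c ! Suc i) \<in> reduced E"
    "(c ! Suc k, c ! k) \<in> reduced E"
    "(c ! 0, c ! (length c - 1)) \<in> reduced E"
proof -
  define n where "n = length c"
  define idx where "idx = inv_into {..<n} ((!) c)"
  \<comment> \<open>Raising position \<open>k\<close> to the top rank reverses exactly the edge
    between \<open>k\<close> and \<open>Suc k\<close>. The closing edge runs from position 0 to
    position \<open>n - 1\<close>.\<close>
  define \<rho> where "\<rho> i = (if i = k then n else i)" for i
  define f where "f v = \<rho> (idx v)" for v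
  have d: "distinct c" and n4: "4 \<le> n" and cyc: "undirected_cycle A c"
    using c by (auto simp: chordless_cycle_def undirected_cycle_def n_def)
  have inj: "inj_on ((!) c) {..<n}" using d by (auto simp: inj_on_def n_def nth_eq_iff_index_eq)
  have idx: "idx (c ! i) = i" if "i < n" for i
    unfolding idx_def using inv_into_f_f[OF inj] that by auto
  have f: "f (c ! i) = \<rho> i" if "i < n" for i using idx that by (simp add: f_def)
  have neq: "c ! i \<noteq> c ! j" if "i < n" "j < n" "i \<noteq> j" for i j
    using idx that by metis
  have "inj_on f (set c)"
  proof (rule inj_onI)
    fix u v assume "u \<in> set c" "v \<in> set c" "f u = f v"
    then show "u = v" using f by (auto simp: in_set_conv_nth n_def[symmetric] \<rho>_def split: if_splits)
  qed
  then obtain E where E: "reorientation A E"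
    "\<And>u v. u \<in> set c \<Longrightarrow> v \<in> set c \<Longrightarrow> (u, v) \<in> E \<longleftrightarrow> (u, v) \<in> edges A \<and> f u < f v"
    "\<And>u v. (u, v) \<in> E \<Longrightarrow> v \<in> set c \<Longrightarrow> u \<in> set c"
    using orient_by_rank[OF ac] by metis
  have acE: "acyclic E" using E(1) by (simp add: reorientation_def)
  have in_c: "c ! i \<in> set c" if "i < n" for i using that by (simp add: n_def)
  have adj: "j = Suc i \<or> i = 0 \<and> Suc j = n" if "i < j" "j < n" "(c ! i, c ! j) \<in> edges A" for i j
    using c that unfolding chordless_cycle_def n_def by blast
  have arcs: "j = Suc i \<and> i \<noteq> k \<or> i = Suc k \<and> j = k \<or> i = 0 \<and> Suc j = n"
    if "(c ! i, c ! j) \<in> E" "i < n" "j < n" for i j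
  proof -
    have e: "(c ! i, c ! j) \<in> edges A" "\<rho> i < \<rho> j"
      using that E(2) in_c f by auto
    then have "i \<noteq> j" by auto
    then consider "i < j" | "j < i" by linarith
    then show ?thesis
    proof cases
      case 1
      then show ?thesis using adj[OF 1 that(3) e(1)] e(2) that k by (auto simp: \<rho>_def n_def split: if_splits)
    next
      case 2
      have "(c ! j, c ! i) \<in> edges A" using e(1) edges_sym by metis
      from adj[OF 2 that(2) this] show ?thesis using e(2) k that n4 by (auto simp: \<rho>_def n_def split: if_splits)
    qed
  qed
  have arc: "(c ! i, c ! j) \<in> E" if "(c ! i, c ! j) \<in> edges A" "i < n" "j < n" "\<rho> i < \<rho> j" for i j
    using that E(2) in_c f by auto
  have consec: "(c ! i, c ! Suc i) \<in> edges A" if "Suc i < n" for i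
    using cyc that successively_nth by (fastforce simp: undirected_cycle_iff n_def)
  have wrap: "(c ! 0, c ! (n - 1)) \<in> edges A"
  proof -
    have "c \<noteq> []" using n4 by (auto simp: n_def)
    then have "last c = c ! (n - 1)" "hd c = c ! 0" by (simp_all add: n_def last_conv_nth hd_conv_nth)
    then show ?thesis using cyc edges_sym by (metis undirected_cycle_iff)
  qed
  have E_in: "\<exists>i<n. u = c ! i" if "(u, v) \<in> E" "v \<in> set c" for u v
    using E(3)[OF that] by (metis in_set_conv_nth n_def)
  have reach: "\<exists>i<n. x = c ! i" "\<And>i j. x = c ! i \<Longrightarrow> y = c ! j \<Longrightarrow> i < n \<Longrightarrow> j < n \<Longrightarrow> \<rho> i \<le> \<rho> j"
    if "(x, y) \<in> E\<^sup>*" "y \<in> set c" for x y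
  proof -
    have r: "x = y \<or> x \<in> set c \<and> f x < f y"
    proof (cases "x = y")
      case False
      then have "(x, y) \<in> E\<^sup>+" using that(1) by (metis rtranclD)
      then show ?thesis using trancl_rank[of "set c" E f x y] E(2,3) that(2) by blast
    qed simp
    then show "\<exists>i<n. x = c ! i" using that(2) by (metis in_set_conv_nth n_def)
    show "\<And>i j. x = c ! i \<Longrightarrow> y = c ! j \<Longrightarrow> i < n \<Longrightarrow> j < n \<Longrightarrow> \<rho> i \<le> \<rho> j"
      using r f by (metis less_imp_le order_refl)
  qed
  have TR: "(c ! i, c ! j) \<in> reduced E"
    if ij: "i < n" "j < n" and e: "(c ! i, c ! j) \<in> E"
      and no: "\<And>a b. (c ! i, c ! a) \<in> E \<Longrightarrow> a \<noteq> j \<Longrightarrow> (c ! b, c ! j) \<in> E \<Longrightarrow> b \<noteq> i \<Longrightarrow>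
        \<rho> a \<le> \<rho> b \<Longrightarrow> (c ! a, c ! b) \<in> E\<^sup>* \<Longrightarrow> a < n \<Longrightarrow> b < n \<Longrightarrow> False" for i j
  proof (rule reducedI[OF acE e])
    fix x y assume xy: "(c ! i, x) \<in> E" "x \<noteq> c ! j" "(x, y) \<in> E\<^sup>*" "(y, c ! j) \<in> E" "y \<noteq> c ! i"
    obtain b where b: "b < n" "y = c ! b" using E_in[OF xy(4)] in_c ij by blast
    obtain a where a: "a < n" "x = c ! a" using reach(1)[OF xy(3)] b in_c by blast
    show False using no[of a b] xy a b reach(2)[OF xy(3) _ a(2) b(2) a(1) b(1)] in_c by auto
  qed
  show thesis
  proof (rule that[OF E(1)])
    fix i assume i: "Suc i < length c" "i \<noteq> k"
    then have i': "Suc i < n" by (simp add: n_def)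
    show "(c ! i, c ! Suc i) \<in> reduced E"
    proof (rule TR)
      show "(c ! i, c ! Suc i) \<in> E" using arc[OF consec[OF i']] i i' by (auto simp: \<rho>_def)
      fix a b assume h: "(c ! i, c ! a) \<in> E" "a \<noteq> Suc i" "(c ! b, c ! Suc i) \<in> E" "b \<noteq> i"
        "\<rho> a \<le> \<rho> b" "a < n" "b < n"
      then show False using arcs[OF h(1)] arcs[OF h(3)] i' n4 k by (auto simp: \<rho>_def n_def split: if_splits)
    qed (use i' in auto)
  next
    have k': "Suc k < n" using k by (simp add: n_def)
    show "(c ! Suc k, c ! k) \<in> reduced E"
    proof (rule TR)
      show "(c ! Suc k, c ! k) \<in> E" using arc[of "Suc k" k] consec[OF k'] edges_sym[of "c ! k" "c ! Suc k" A] k'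
        by (auto simp: \<rho>_def)
      fix a b assume h: "(c ! Suc k, c ! a) \<in> E" "a \<noteq> k" "(c ! b, c ! k) \<in> E" "b \<noteq> Suc k"
        "\<rho> a \<le> \<rho> b" "a < n" "b < n"
      then show False using arcs[OF h(1)] arcs[OF h(3)] k' n4 k by (auto simp: \<rho>_def n_def split: if_splits)
    qed (use k' in auto)
  next
    have n1: "n - 1 < n" "n - 1 \<noteq> k" using n4 k by (auto simp: n_def)
    have "(c ! 0, c ! (n - 1)) \<in> reduced E"
    proof (rule TR)
      show "(c ! 0, c ! (n - 1)) \<in> E" using arc[OF wrap] n1 n4 k by (auto simp: \<rho>_def)
      fix a b assume h: "(c ! 0, c ! a) \<in> E" "a \<noteq> n - 1" "(c ! b, c ! (n - 1)) \<in> E" "b \<noteq> 0"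
        "\<rho> a \<le> \<rho> b" "(c ! a, c ! b) \<in> E\<^sup>*" "a < n" "b < n"
      have a: "a = 1" using arcs[OF h(1)] h k n4 by auto
      have b: "Suc b = n - 1" "b \<noteq> k" using arcs[OF h(3)] h k n4 n1 by auto
      \<comment> \<open>Traced backwards from position \<open>n - 2\<close>, the path cannot cross
        the reversed edge at \<open>k\<close>, so it never comes down to position 1.\<close>
      have "\<exists>i. k < i \<and> i < n - 1 \<and> c ! a = c ! i"
        using h(6)
      proof (induction rule: converse_rtrancl_induct)
        case base
        show ?case using b k n4 by (intro exI[of _ b]) (auto simp: n_def)
      next
        case (step y z)
        then obtain i where i: "k < i" "i < n - 1" "z = c ! i" by blast
        then obtain j where j: "j < n" "y = c ! j" using E_in[OF step(1)] in_c[of i] by auto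
        have "i < n" using i by simp
        with arcs[of j i] step(1) i j have "k < j \<and> j < n - 1" by auto
        with j show ?case by blast
      qed
      then show False using a k n4 neq[of 1] by force
    qed (use n1 n4 in auto)
    then show "(c ! 0, c ! (length c - 1)) \<in> reduced E" by (simp add: n_def)
  qed
qed

lemma chordless_cycle_rotate1:
  assumes "chordless_cycle A c"
  shows "chordless_cycle A (rotate1 c)"
proof -
  obtain x xs where c: "c = x # xs" using assms by (cases c) (auto simp: chordless_cycle_def)
  have adj: "j = Suc i \<or> i = 0 \<and> Suc j = length c" if "i < j" "j < length c" "(c ! i, c ! j) \<in> edges A" for i j
    using assms that unfolding chordless_cycle_def by blast
  have "j = Suc i \<or> i = 0 \<and> Suc j = length c"
    if "i < j" "j < length c" "((xs @ [x]) ! i, (xs @ [x]) ! j) \<in> edges A" for i j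
  proof (cases "j < length xs")
    case True
    then show ?thesis using adj[of "Suc i" "Suc j"] that by (auto simp: c nth_append)
  next
    case False
    then have "j = length xs" using that by (auto simp: c)
    then have "(c ! 0, c ! Suc i) \<in> edges A"
      using that edges_sym[of x "xs ! i" A] by (auto simp: c nth_append)
    then show ?thesis using adj[of 0 "Suc i"] that \<open>j = length xs\<close> by (auto simp: c)
  qed
  moreover have "undirected_cycle A (xs @ [x])"
    using undirected_cycle_rotate[of A "[x]" xs] assms by (simp add: c chordless_cycle_def)
  ultimately show ?thesis using assms unfolding chordless_cycle_def by (auto simp: c)
qed

lemma chordless_cycle_rotate: "chordless_cycle A c \<Longrightarrow> chordless_cycle A (rotate m c)"
  by (induction m) (auto simp: chordless_cycle_rotate1)

text \<open>Pigeonhole on the directions of three consecutive edges, followed by a rotation.\<close>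

lemma chordless_aligned:
  assumes ac: "acyclic A" and c: "chordless_cycle A c"
  obtains c' k where "chordless_cycle A c'" "1 \<le> k" "k + 2 \<le> length c'"
    "(c' ! 0, c' ! (length c' - 1)) \<in> A \<and> (c' ! Suc k, c' ! k) \<in> A \<or>
     (c' ! (length c' - 1), c' ! 0) \<in> A \<and> (c' ! k, c' ! Suc k) \<in> A"
proof -
  define n where "n = length c"
  have n4: "4 \<le> n" and cyc: "undirected_cycle A c" using c by (auto simp: chordless_cycle_def n_def)
  have e: "(c ! i, c ! Suc i) \<in> A \<or> (c ! Suc i, c ! i) \<in> A" if "i < 3" for i
    using cyc n4 that successively_nth[of "\<lambda>u v. (u, v) \<in> edges A" c i] by (auto simp: undirected_cycle_iff n_def edges_orient)
  have "\<exists>i j. i < j \<and> j < 3 \<and> ((c ! i, c ! Suc i) \<in> A \<and> (c ! j, c ! Suc j) \<in> A \<or>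
      (c ! Suc i, c ! i) \<in> A \<and> (c ! Suc j, c ! j) \<in> A)"
  proof -
    have "(0::nat) < 1" "(1::nat) < 2" "(0::nat) < 2" "(1::nat) < 3" "(2::nat) < 3" "(0::nat) < 3" by auto
    then show ?thesis using e[of 0] e[of 1] e[of 2] by metis
  qed
  then obtain i j where ij: "i < j" "j < 3" "(c ! i, c ! Suc i) \<in> A \<and> (c ! j, c ! Suc j) \<in> A \<or>
      (c ! Suc i, c ! i) \<in> A \<and> (c ! Suc j, c ! j) \<in> A" by blast
  \<comment> \<open>The rotation turns edge \<open>j\<close> into the closing edge, and edge
    \<open>i\<close> moves to position \<open>k\<close>.\<close>
  define c' where "c' = rotate (Suc j) c"
  define k where "k = n + i - Suc j"
  have len: "length c' = n" by (simp add: c'_def n_def)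
  have nth: "c' ! m = c ! ((Suc j + m) mod n)" if "m < n" for m
    using that nth_rotate[of m c "Suc j"] unfolding c'_def n_def by (simp del: rotate_Suc)
  have "c' ! 0 = c ! Suc j" using nth[of 0] ij n4 by simp
  moreover have "c' ! (n - 1) = c ! j" using nth[of "n - 1"] ij n4 by (simp add: mod_if)
  moreover have "c' ! k = c ! i" using nth[of k] ij n4 by (simp add: k_def)
  moreover have "c' ! Suc k = c ! Suc i"
  proof -
    have "Suc j + Suc k = Suc i + n" using ij n4 by (simp add: k_def)
    moreover have "Suc k < n" using ij n4 by (simp add: k_def)
    ultimately have "c' ! Suc k = c ! ((Suc i + n) mod n)" using nth[of "Suc k"] by simp
    also have "(Suc i + n) mod n = Suc i" using ij n4 by (simp del: add_Suc)
    finally show ?thesis .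
  qed
  moreover have "chordless_cycle A c'" using chordless_cycle_rotate[OF c] unfolding c'_def .
  moreover have "1 \<le> k" "k + 2 \<le> n" using ij n4 by (auto simp: k_def)
  ultimately show thesis using that[of c' k] ij(3) len by auto
qed

section \<open>Arcs forced to collapse when two irreducible arcs are contracted\<close>

lemma reorientation_path_edge:
  assumes "reorientation A E" "(u, v) \<in> edges A" "(u, v) \<in> E\<^sup>*"
  shows "(u, v) \<in> E"
  using assms edge_along_path[of E u v] by (simp add: reorientation_def)

lemma between_reduced:
  assumes "acyclic E" "(u, v) \<in> reduced E" "(u, x) \<in> E\<^sup>*" "(x, v) \<in> E\<^sup>*"
  shows "x = u \<or> x = v"
  using assms by (metis rtranclD reduced_iff)

text \<open>Both \<open>a\<close> and \<open>b\<close> lie weakly between \<open>u\<close> and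
  \<open>v\<close>, hence are among them, and acyclicity excludes \<open>a = v\<close> and
  \<open>b = u\<close>.\<close>

lemma arc_between_reduced:
  assumes "acyclic E" "(u, v) \<in> reduced E" "(a, b) \<in> E" "(u, a) \<in> E\<^sup>*" "(b, v) \<in> E\<^sup>*"
  shows "a = u \<and> b = v"
proof -
  have "(u, b) \<in> E\<^sup>*" "(a, v) \<in> E\<^sup>*" using assms by auto
  then have "a = u \<or> a = v" "b = u \<or> b = v"
    using between_reduced[OF assms(1,2)] assms by blast+
  moreover have "a \<noteq> v" using assms(1,3,5) acyclic_antisym[OF assms(1)] by blast
  moreover have "b \<noteq> u" using assms(1,3,4) acyclic_antisym[OF assms(1)] by blast
  ultimately show ?thesis by blast
qed

text \<open>The arcs \<open>(u, v)\<close> and \<open>(w, z)\<close> close up two induced directed paths to a chordless cycle.\<close>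

lemma disjoint_arcs_not_linked:
  assumes ch: "chordal A" and E: "reorientation A E"
    and e: "(u, v) \<in> reduced E" "(w, z) \<in> reduced E"
    and d: "distinct [u, v, w, z]" and uz: "(u, z) \<in> E\<^sup>*" and wv: "(w, v) \<in> E\<^sup>*"
  shows False
proof -
  have ac: "acyclic E" using E by (simp add: reorientation_def)
  obtain p where p: "p \<noteq> []" "hd p = u" "last p = z" "walk E p"
    "distinct p" "\<And>i j. Suc i < j \<Longrightarrow> j < length p \<Longrightarrow> (p ! i, p ! j) \<notin> E"
    using induced_path[OF uz] by blast
  obtain q where q: "q \<noteq> []" "hd q = w" "last q = v" "walk E q"
    "distinct q" "\<And>i j. Suc i < j \<Longrightarrow> j < length q \<Longrightarrow> (q ! i, q ! j) \<notin> E"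
    using induced_path[OF wv] by blast
  have pP: "(u, x) \<in> E\<^sup>*" "(x, z) \<in> E\<^sup>*" if "x \<in> set p" for x
    using path_hd_rtrancl[OF p(4) that] path_last_rtrancl[OF p(4) that] p by auto
  have qQ: "(w, x) \<in> E\<^sup>*" "(x, v) \<in> E\<^sup>*" if "x \<in> set q" for x
    using path_hd_rtrancl[OF q(4) that] path_last_rtrancl[OF q(4) that] q by auto
  \<comment> \<open>A common vertex would lie between \<open>u\<close> and \<open>v\<close> and also
    between \<open>w\<close> and \<open>z\<close>, but irreducible arcs have nothing strictly
    between their ends.\<close>
  have disj: "set p \<inter> set q = {}"
  proof -
    have False if "x \<in> set p" "x \<in> set q" for x
      using between_reduced[OF ac e(1) pP(1)[OF that(1)] qQ(2)[OF that(2)]]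
        between_reduced[OF ac e(2) qQ(1)[OF that(2)] pP(2)[OF that(1)]] d by auto
    then show ?thesis by blast
  qed
  have eE: "(u, v) \<in> E" "(w, z) \<in> E" using e reduced_subset by blast+
  have len: "2 \<le> length p" "2 \<le> length q"
  proof -
    have "length p \<noteq> 1" "length q \<noteq> 1" using p q d by (auto simp: length_Suc_conv)
    moreover have "length p \<noteq> 0" "length q \<noteq> 0" using p q by auto
    ultimately show "2 \<le> length p" "2 \<le> length q" by linarith+
  qed
  have edges: "(x, y) \<in> edges A" if "(x, y) \<in> E" for x y using reorientation_edge[OF E that] by simp
  have cyc: "undirected_cycle A (p @ q)"
  proof (rule closed_path_cycle)
    have "walk (edges A) p" "walk (edges A) q"
      using p(4) q(4) by (auto elim!: successively_mono intro: edges)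
    moreover have "(last p, hd q) \<in> edges A" using p q edges[OF eE(2)] edges_sym by metis
    ultimately show "walk (edges A) (p @ q)"
      by (simp add: successively_append_iff)
    show "distinct (p @ q)" using p q disj by simp
    show "3 \<le> length (p @ q)" using len by simp
    show "(hd (p @ q), last (p @ q)) \<in> edges A" using p q edges[OF eE(1)] by simp
  qed
  have "j = Suc i \<or> i = 0 \<and> Suc j = length (p @ q)"
    if ij: "i < j" "j < length (p @ q)" "((p @ q) ! i, (p @ q) ! j) \<in> edges A" for i j
  proof -
    consider "j < length p" | "length p \<le> i" | "i < length p" "length p \<le> j" by linarith
    then show ?thesis
    proof cases
      case 1
      then have "(p ! i, p ! j) \<in> E"
        using ij reorientation_path_edge[OF E] path_nth_trancl[OF p(4), of i j]
        by (simp add: nth_append trancl_into_rtrancl)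
      then show ?thesis using p(6)[of i j] 1 ij by linarith
    next
      case 2
      define i' j' where "i' = i - length p" and "j' = j - length p"
      have i': "i = length p + i'" "j = length p + j'" "i' < j'" "j' < length q"
        using 2 ij by (auto simp: i'_def j'_def)
      then have "(q ! i', q ! j') \<in> E"
        using ij reorientation_path_edge[OF E] path_nth_trancl[OF q(4), of i' j']
        by (simp add: nth_append trancl_into_rtrancl)
      then show ?thesis using q(6)[of i' j'] i' by linarith
    next
      case 3
      define j' where "j' = j - length p"
      have j': "j = length p + j'" "j' < length q" using 3 ij by (auto simp: j'_def)
      \<comment> \<open>An arc from \<open>p\<close> to \<open>q\<close> lies on a path from
        \<open>u\<close> to \<open>v\<close>, an arc from \<open>q\<close> to \<open>p\<close> on a
        path from \<open>w\<close> to \<open>z\<close>. Irreducibility leaves only the two closing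
        edges.\<close>
      have "(p ! i, q ! j') \<in> E \<or> (q ! j', p ! i) \<in> E"
        using ij 3 j' E by (simp add: nth_append reorientation_def edges_orient[of _ _ E, symmetric])
      then show ?thesis
      proof
        assume "(p ! i, q ! j') \<in> E"
        then have "p ! i = u \<and> q ! j' = v"
          using arc_between_reduced[OF ac e(1)] pP(1) qQ(2) 3 j' by simp
        then have "p ! i = p ! 0" "q ! j' = q ! (length q - 1)"
          using p q by (auto simp: hd_conv_nth last_conv_nth)
        then have "i = 0" "j' = length q - 1"
          using p(1,5) q(1,5) 3 j' by (auto simp: nth_eq_iff_index_eq)
        then show ?thesis using j' len by auto
      next
        assume "(q ! j', p ! i) \<in> E"
        then have "q ! j' = w \<and> p ! i = z"
          using arc_between_reduced[OF ac e(2)] pP(2) qQ(1) 3 j' by simp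
        then have "p ! i = p ! (length p - 1)" "q ! j' = q ! 0"
          using p q by (auto simp: hd_conv_nth last_conv_nth)
        then have "i = length p - 1" "j' = 0"
          using p(1,5) q(1,5) 3 j' by (auto simp: nth_eq_iff_index_eq)
        then show ?thesis using j' p(1) by simp
      qed
    qed
  qed
  then have "chordless_cycle A (p @ q)"
    using cyc len by (auto simp: chordless_cycle_def)
  with ch show False by (auto simp: chordal_iff)
qed

text \<open>A second route from \<open>a\<close> to \<open>c\<close> yields an induced path
  \<open>q\<close> round \<open>b\<close>, and irreducibility makes \<open>b\<close> adjacent only
  to the ends of \<open>q\<close>. Without the arc \<open>(a, c)\<close>, \<open>q\<close> and
  \<open>b\<close> form a chordless cycle. With it, \<open>q\<close> alone is a chordless cycle, or
  a triangle to which the diamond condition applies.\<close>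

lemma consecutive_arcs_not_linked:
  assumes ac': "acyclic A" and ch: "chordal A" and dc: "diamond_condition A" and E: "reorientation A E"
    and e: "(a, b) \<in> reduced E" "(b, c) \<in> reduced E"
    and type: "(a, b) \<in> A \<and> (b, c) \<in> A \<or> (b, a) \<in> A \<and> (c, b) \<in> A"
    and ax: "(a, x) \<in> E\<^sup>+" and xc: "(x, c) \<in> E\<^sup>+" and xb: "x \<noteq> b"
  shows False
proof -
  have ac: "acyclic E" using E by (simp add: reorientation_def)
  \<comment> \<open>Banning \<open>b\<close> and the direct arc forces a path from \<open>a\<close>
    to \<open>c\<close> in \<open>R\<close> to have an inner vertex other than
    \<open>b\<close>.\<close>
  define R where "R = {(y, z) \<in> E. y \<noteq> b \<and> z \<noteq> b \<and> (y, z) \<noteq> (a, c)}"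
  have eE: "(a, b) \<in> E" "(b, c) \<in> E" using e reduced_subset by blast+
  have nb1: "(b, x) \<notin> E\<^sup>*"
    using between_reduced[OF ac e(2), of x] xc xb acyclic_antisym[OF ac xc]
    by (metis rtrancl.rtrancl_refl trancl_into_rtrancl)
  have nb2: "(x, b) \<notin> E\<^sup>*"
    using between_reduced[OF ac e(1), of x] ax xb acyclic_antisym[OF ac ax]
    by (metis rtrancl.rtrancl_refl trancl_into_rtrancl)
  have "(y, x) \<in> E\<^sup>* \<longrightarrow> (a, y) \<in> R\<^sup>*" if "(a, y) \<in> E\<^sup>*" for y
    using that
  proof (induction rule: rtrancl_induct)
    case base show ?case by simp
  next
    case (step y z)
    show ?case
    proof
      assume zx: "(z, x) \<in> E\<^sup>*"
      then have yx: "(y, x) \<in> E\<^sup>*" using step by simp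
      have "(y, z) \<in> R" using step(2) zx yx nb1 acyclic_antisym[OF ac xc] by (auto simp: R_def)
      then show "(a, z) \<in> R\<^sup>*" using step yx by simp
    qed
  qed
  then have aR: "(a, x) \<in> R\<^sup>*" using ax by (simp add: trancl_into_rtrancl)
  have "(x, y) \<in> E\<^sup>* \<longrightarrow> (y, c) \<in> R\<^sup>*" if "(y, c) \<in> E\<^sup>*" for y
    using that
  proof (induction rule: converse_rtrancl_induct)
    case base show ?case by simp
  next
    case (step y z)
    show ?case
    proof
      assume xy: "(x, y) \<in> E\<^sup>*"
      then have xz: "(x, z) \<in> E\<^sup>*" using step by simp
      have "(y, z) \<in> R" using step(1) xz xy nb2 acyclic_antisym[OF ac ax] by (auto simp: R_def)
      then show "(y, c) \<in> R\<^sup>*" using step xz by (meson converse_rtrancl_into_rtrancl)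
    qed
  qed
  then have "(x, c) \<in> R\<^sup>*" using xc by (simp add: trancl_into_rtrancl)
  with aR have acR: "(a, c) \<in> R\<^sup>*" by simp
  then obtain q where q: "q \<noteq> []" "hd q = a" "last q = c" "walk R q"
    "distinct q" "\<And>i j. Suc i < j \<Longrightarrow> j < length q \<Longrightarrow> (q ! i, q ! j) \<notin> R"
    using induced_path[OF acR] by blast
  have qE: "walk E q" using q(4) by (rule successively_mono) (auto simp: R_def)
  have qP: "(a, y) \<in> E\<^sup>*" "(y, c) \<in> E\<^sup>*" if "y \<in> set q" for y
    using path_hd_rtrancl[OF qE that] path_last_rtrancl[OF qE that] q by auto
  have acne: "a \<noteq> c" using ax xc ac by (metis acyclic_def trancl_trans)
  have len: "3 \<le> length q"
  proof -
    have "length q \<noteq> 1" using q acne by (auto simp: length_Suc_conv)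
    moreover have "length q \<noteq> 2" using q by (auto simp: R_def numeral_2_eq_2 length_Suc_conv)
    moreover have "length q \<noteq> 0" using q by simp
    ultimately show ?thesis by linarith
  qed
  have ends: "q ! 0 = a" "q ! (length q - 1) = c" using q by (auto simp: hd_conv_nth last_conv_nth)
  have bq: "b \<notin> set q"
  proof
    assume "b \<in> set q"
    then obtain i where i: "i < length q" "q ! i = b" by (metis in_set_conv_nth)
    then have "i \<noteq> 0" using ends eE ac by (auto simp: acyclic_def)
    then obtain k where k: "i = Suc k" using not0_implies_Suc by blast
    then have "(q ! k, q ! i) \<in> R" using successively_nth[OF q(4), of k] i by simp
    then show False using i by (simp add: R_def)
  qed
  have nbq: "y = a \<or> y = c" if "y \<in> set q" "(b, y) \<in> edges A" for y
  proof -
    have "(b, y) \<in> E \<or> (y, b) \<in> E" using that(2) E by (simp add: reorientation_def edges_orient[symmetric])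
    then show ?thesis
      using arc_between_reduced[OF ac e(2), of b y] qP(2)[OF that(1)]
        arc_between_reduced[OF ac e(1), of y b] qP(1)[OF that(1)] by auto
  qed
  have edges: "(y, z) \<in> edges A" if "(y, z) \<in> E" for y z using reorientation_edge[OF E that] by simp
  have qA: "walk (edges A) q"
    using qE by (rule successively_mono) (auto intro: edges)
  have chord: "j = Suc i \<or> i = 0 \<and> Suc j = length q \<and> (a, c) \<in> E"
    if "i < j" "j < length q" "(q ! i, q ! j) \<in> edges A" for i j
  proof -
    have "(q ! i, q ! j) \<in> E"
      using that reorientation_path_edge[OF E] path_nth_trancl[OF qE, of i j]
      by (simp add: trancl_into_rtrancl)
    moreover have "q ! i \<noteq> b" "q ! j \<noteq> b" using bq that by (metis less_trans nth_mem)+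
    ultimately have "(q ! i, q ! j) \<in> R \<or> (q ! i, q ! j) = (a, c) \<and> (a, c) \<in> E" by (auto simp: R_def)
    then show ?thesis
    proof
      assume "(q ! i, q ! j) \<in> R"
      then show ?thesis using q(6)[of i j] that by linarith
    next
      assume "(q ! i, q ! j) = (a, c) \<and> (a, c) \<in> E"
      then have "q ! i = q ! 0" "q ! j = q ! (length q - 1)" "(a, c) \<in> E" using ends by auto
      moreover from this have "i = 0" "j = length q - 1"
        using nth_eq_iff_index_eq[OF q(5), of i 0] nth_eq_iff_index_eq[OF q(5), of j "length q - 1"]
          that(1,2) by linarith+
      ultimately show ?thesis using len by auto
    qed
  qed
  show False
  proof (cases "(a, c) \<in> E")
    case True
    have cyc: "undirected_cycle A q"
      using closed_path_cycle[OF qA q(5) len] q(2,3) edges[OF True] by simp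
    show False
    proof (cases "4 \<le> length q")
      case True
      then have "chordless_cycle A q" using cyc chord by (auto simp: chordless_cycle_def)
      with ch show False by (auto simp: chordal_iff)
    next
      case False
      then have "length q = 3" using len by simp
      then obtain y where qy: "q = [a, y, c]" using q(2,3) by (auto simp: numeral_3_eq_3 length_Suc_conv)
      have y: "(a, y) \<in> edges A" "(y, c) \<in> edges A" "y \<noteq> b" "y \<noteq> a" "y \<noteq> c"
        using qA bq q(5) by (auto simp: qy)
      \<comment> \<open>Here both arcs being on the same side matters: \<open>a, b, c\<close> or its
        reverse is a directed path in \<open>A\<close>, which fixes the direction of the edge
        \<open>ac\<close> in \<open>A\<close>.\<close>
      have "(b, y) \<in> edges A" using type
      proof
        assume t: "(a, b) \<in> A \<and> (b, c) \<in> A"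
        then have "(a, c) \<in> A\<^sup>*" by auto
        then have "(a, c) \<in> A" using edge_along_path[OF ac' edges[OF True]] by simp
        then show ?thesis using diamond_conditionD[OF dc, of a b c y] t y by blast
      next
        assume t: "(b, a) \<in> A \<and> (c, b) \<in> A"
        then have "(c, a) \<in> A\<^sup>*" by auto
        then have "(c, a) \<in> A" using edge_along_path[OF ac', of c a] edges[OF True] edges_sym by metis
        then show ?thesis using diamond_conditionD[OF dc, of c b a y] t y edges_sym by metis
      qed
      then show False using nbq[of y] y by (simp add: qy)
    qed
  next
    case False
    have cyc: "undirected_cycle A (q @ [b])"
    proof (rule closed_path_cycle)
      have "(last q, b) \<in> edges A" using q(3) edges[OF eE(2)] edges_sym by metis
      then show "walk (edges A) (q @ [b])"
        using qA by (simp add: successively_append_iff)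
      show "distinct (q @ [b])" using q(5) bq by simp
      show "3 \<le> length (q @ [b])" using len by simp
      show "(hd (q @ [b]), last (q @ [b])) \<in> edges A" using q(1,2) edges[OF eE(1)] by simp
    qed
    have "j = Suc i \<or> i = 0 \<and> Suc j = length (q @ [b])"
      if ij: "i < j" "j < length (q @ [b])" "((q @ [b]) ! i, (q @ [b]) ! j) \<in> edges A" for i j
    proof (cases "j < length q")
      case True
      then show ?thesis using chord[of i j] ij False by (auto simp: nth_append)
    next
      case j: False
      then have j: "j = length q" using ij by simp
      then have "(b, q ! i) \<in> edges A" using ij edges_sym[of b "q ! i" A] by (simp add: nth_append)
      then have "q ! i = q ! 0 \<or> q ! i = q ! (length q - 1)" using nbq[of "q ! i"] ends ij j by simp
      then have "i = 0 \<or> i = length q - 1"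
        using nth_eq_iff_index_eq[OF q(5), of i 0] nth_eq_iff_index_eq[OF q(5), of i "length q - 1"]
          ij j len by linarith
      then show ?thesis using j len by auto
    qed
    then have "chordless_cycle A (q @ [b])"
      using cyc len by (auto simp: chordless_cycle_def)
    with ch show False by (auto simp: chordal_iff)
  qed
qed

text \<open>The case of a return path through both reversed arcs: from \<open>b\<close> to
  \<open>v\<close>, back to \<open>u\<close>, on to \<open>z\<close>, back to \<open>w\<close>, on
  to \<open>a\<close>. A common head or a common tail puts \<open>(a, b)\<close> between the ends of
  a single irreducible arc; the other two coincidence patterns are the two preceding lemmas.\<close>

lemma forced_arc_cross:
  assumes A: "acyclic A" "chordal A" "diamond_condition A" and E: "reorientation A E"
    and e: "(u, v) \<in> reduced E" "(w, z) \<in> reduced E"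
    and type: "(u, v) \<in> A \<and> (w, z) \<in> A \<or> (v, u) \<in> A \<and> (z, w) \<in> A"
    and ab: "(a, b) \<in> E" and uz: "(u, z) \<in> E\<^sup>*" and wa: "(w, a) \<in> E\<^sup>*" and bv: "(b, v) \<in> E\<^sup>*"
  shows "(a, b) = (u, v) \<or> (a, b) = (w, z) \<or> z = u \<and> a = w \<and> b = v"
proof -
  have ac: "acyclic E" using E by (simp add: reorientation_def)
  have eE: "(u, v) \<in> E" "(w, z) \<in> E" using e reduced_subset by blast+
  have wv: "(w, v) \<in> E\<^sup>+" using wa ab bv by (meson rtrancl_into_trancl1 trancl_rtrancl_trancl)
  then have wvne: "w \<noteq> v" using ac by (auto simp: acyclic_def)
  have ne: "u \<noteq> v" "w \<noteq> z" using eE ac by (auto simp: acyclic_def)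
  consider "z = u" | "v = z" | "u = w" | "distinct [u, v, w, z]" using wvne ne by auto
  then show ?thesis
  proof cases
    case 1
    show ?thesis
    proof (rule ccontr)
      assume n: "\<not> ?thesis"
      have "\<exists>x. (w, x) \<in> E\<^sup>+ \<and> (x, v) \<in> E\<^sup>+ \<and> x \<noteq> u"
      proof (cases "a = w")
        case False
        have "a \<noteq> u"
          using arc_between_reduced[OF ac e(1) ab _ bv] n by auto
        moreover have "(w, a) \<in> E\<^sup>+" using wa False by (metis rtranclD)
        moreover have "(a, v) \<in> E\<^sup>+" using ab bv by (meson r_into_trancl trancl_rtrancl_trancl)
        ultimately show ?thesis by blast
      next
        case True
        then have "b \<noteq> v" "b \<noteq> u" using n 1 by auto
        moreover have "(b, v) \<in> E\<^sup>+" using bv \<open>b \<noteq> v\<close> by (metis rtranclD)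
        ultimately show ?thesis using ab True by blast
      qed
      then obtain x where x: "(w, x) \<in> E\<^sup>+" "(x, v) \<in> E\<^sup>+" "x \<noteq> u" by blast
      show False
        using consecutive_arcs_not_linked[OF A E, of w u v x] e type x unfolding 1 by blast
    qed
  next
    case 2
    then show ?thesis using arc_between_reduced[OF ac e(2) ab wa] bv by auto
  next
    case 3
    then show ?thesis using arc_between_reduced[OF ac e(1) ab _ bv] wa by auto
  next
    case 4
    then show ?thesis
      using disjoint_arcs_not_linked[OF A(2) E e 4 uz] wv by (auto simp: trancl_into_rtrancl)
  qed
qed

text \<open>The return path uses none, one or both of the reversed arcs. The last two alternatives
  are harmless for the codimension: the arc joins the outer ends of two consecutive arcs, so its
  equation follows from theirs.\<close>

lemma forced_arc:
  assumes A: "acyclic A" "chordal A" "diamond_condition A" and E: "reorientation A E"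
    and e: "(u, v) \<in> reduced E" "(w, z) \<in> reduced E"
    and type: "(u, v) \<in> A \<and> (w, z) \<in> A \<or> (v, u) \<in> A \<and> (z, w) \<in> A"
    and ab: "(a, b) \<in> E" and ba: "(b, a) \<in> (E \<union> {(v, u), (z, w)})\<^sup>*"
  shows "(a, b) = (u, v) \<or> (a, b) = (w, z) \<or> z = u \<and> a = w \<and> b = v \<or> v = w \<and> a = u \<and> b = z"
proof -
  have ac: "acyclic E" using E by (simp add: reorientation_def)
  have one: "(x, y) \<in> E\<^sup>* \<or> (x, z) \<in> E\<^sup>* \<and> (w, y) \<in> E\<^sup>*"
    if "(x, y) \<in> (insert (z, w) E)\<^sup>*" for x y
    using that by (auto simp: rtrancl_insert)
  have "(b, a) \<in> (insert (v, u) (insert (z, w) E))\<^sup>*" using ba by (simp add: insert_commute)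
  then consider "(b, a) \<in> (insert (z, w) E)\<^sup>*"
    | "(b, v) \<in> (insert (z, w) E)\<^sup>*" "(u, a) \<in> (insert (z, w) E)\<^sup>*"
    by (auto simp: rtrancl_insert[of v u])
  then show ?thesis
  proof cases
    case 1
    from one[OF this] show ?thesis
      using acyclic_antisym[OF ac] ab arc_between_reduced[OF ac e(2) ab] by blast
  next
    case 2
    from one[OF 2(1)] one[OF 2(2)] show ?thesis
    proof (elim disjE conjE)
      assume "(b, v) \<in> E\<^sup>*" "(u, a) \<in> E\<^sup>*"
      then show ?thesis using arc_between_reduced[OF ac e(1) ab] by blast
    next
      assume "(b, v) \<in> E\<^sup>*" "(u, z) \<in> E\<^sup>*" "(w, a) \<in> E\<^sup>*"
      then show ?thesis using forced_arc_cross[OF A E e type ab] by blast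
    next
      assume "(b, z) \<in> E\<^sup>*" "(w, v) \<in> E\<^sup>*" "(u, a) \<in> E\<^sup>*"
      then show ?thesis using forced_arc_cross[OF A E e(2,1) _ ab] type by blast
    next
      assume "(b, z) \<in> E\<^sup>*" "(w, a) \<in> E\<^sup>*"
      then show ?thesis using arc_between_reduced[OF ac e(2) ab] by blast
    qed
  qed
qed

text \<open>Induction on the number of vertices strictly between the ends: splitting at such a
  vertex lowers the number for both halves.\<close>

lemma reduced_rtrancl:
  fixes E :: "'v::finite rel"
  assumes "acyclic E"
  shows "(u, v) \<in> E\<^sup>+ \<Longrightarrow> (u, v) \<in> (reduced E)\<^sup>*"
proof (induction "card {w. (u, w) \<in> E\<^sup>+ \<and> (w, v) \<in> E\<^sup>+}" arbitrary: u v rule: less_induct)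
  case less
  show ?case
  proof (cases "\<exists>w. (u, w) \<in> E\<^sup>+ \<and> (w, v) \<in> E\<^sup>+")
    case True
    then obtain w where w: "(u, w) \<in> E\<^sup>+" "(w, v) \<in> E\<^sup>+" by blast
    have nw: "(w, w) \<notin> E\<^sup>+" using assms by (auto simp: acyclic_def)
    have "{x. (u, x) \<in> E\<^sup>+ \<and> (x, w) \<in> E\<^sup>+} \<subset> {x. (u, x) \<in> E\<^sup>+ \<and> (x, v) \<in> E\<^sup>+}"
      using w nw by (auto intro: trancl_trans)
    moreover have "{x. (w, x) \<in> E\<^sup>+ \<and> (x, v) \<in> E\<^sup>+} \<subset> {x. (u, x) \<in> E\<^sup>+ \<and> (x, v) \<in> E\<^sup>+}"
      using w nw by (auto intro: trancl_trans)
    ultimately have "(u, w) \<in> (reduced E)\<^sup>*" "(w, v) \<in> (reduced E)\<^sup>*"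
      using less.hyps w by (simp_all add: psubset_card_mono)
    then show ?thesis by simp
  next
    case False
    then have "(u, v) \<in> E" using less.prems by (meson r_into_trancl tranclE)
    with False have "(u, v) \<in> reduced E" by (simp add: reduced_iff[OF assms])
    then show ?thesis by simp
  qed
qed

text \<open>Take a vertex \<open>m\<close> of the cycle with no \<open>E\<close>-arc to another
  vertex of the cycle. Its two cycle neighbours both point to it and are adjacent, since the cycle
  spans a clique; the arc between them bypasses one of the two arcs into \<open>m\<close>.\<close>

lemma chordful_imp_reduction_forest:
  fixes A :: "'v::finite rel"
  assumes ac': "acyclic A" and cf: "chordful A" and E: "reorientation A E"
  shows "forest (reduced E)"
  unfolding forest_def
proof
  assume "\<exists>c. undirected_cycle (reduced E) c"
  then obtain c where c: "undirected_cycle (reduced E) c" by blast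
  have ac: "acyclic E" using E by (simp add: reorientation_def)
  have R: "(x, y) \<in> E" if "(x, y) \<in> reduced E" for x y
    using that reduced_subset by blast
  have cA: "undirected_cycle A c"
    using c by (rule undirected_cycle_mono) (use R reorientation_edge[OF E] in blast)
  have "chordal A" "diamond_free A" using cf chordful_iff[OF ac'] by auto
  note clique = cycle_clique[OF this cA]
  have "wf (E\<inverse>)" using finite_acyclic_wf_converse[OF _ ac] by simp
  moreover have "set c \<noteq> {}" using c by (auto simp: undirected_cycle_def)
  ultimately obtain m where m: "m \<in> set c" "\<And>x. (m, x) \<in> E \<Longrightarrow> x \<notin> set c"
    by (metis converse_iff wfE_min equals0I)
  obtain xs ys where split: "c = xs @ m # ys" using m(1) by (metis in_set_conv_decomp)
  have c': "undirected_cycle (reduced E) (m # ys @ xs)"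
    using undirected_cycle_rotate[of _ xs "m # ys"] c by (simp add: split)
  then have "2 \<le> length (ys @ xs)" by (auto simp: undirected_cycle_iff)
  define l where "l = ys @ xs"
  have l: "2 \<le> length l" "undirected_cycle (reduced E) (m # l)" "set l \<subseteq> set c"
    using \<open>2 \<le> length (ys @ xs)\<close> c' by (auto simp: l_def split)
  have "l \<noteq> []" using l by auto
  define y z where "y = hd l" and "z = last l"
  have "y \<noteq> z"
  proof
    assume "y = z"
    then have "l ! 0 = l ! (length l - 1)" using \<open>l \<noteq> []\<close> by (simp add: y_def z_def hd_conv_nth last_conv_nth)
    moreover have "distinct l" using l by (simp add: undirected_cycle_iff)
    ultimately show False
      using l(1) nth_eq_iff_index_eq[of l 0 "length l - 1"] by linarith
  qed
  have yz: "y \<in> set c" "z \<in> set c" using l \<open>l \<noteq> []\<close> by (auto simp: y_def z_def)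
  have "(m, y) \<in> edges (reduced E)" "(z, m) \<in> edges (reduced E)"
    using l(2) \<open>l \<noteq> []\<close> by (auto simp: undirected_cycle_iff successively_Cons y_def z_def)
  then have TR: "(y, m) \<in> reduced E" "(z, m) \<in> reduced E"
    using m(2) yz R unfolding edges_orient by blast+
  have "(y, z) \<in> E \<or> (z, y) \<in> E"
    using clique[OF yz \<open>y \<noteq> z\<close>] E by (simp add: reorientation_def edges_orient[symmetric])
  then show False
    using TR R unfolding reduced_iff[OF ac] by blast
qed

lemma reduction_forest_imp_chordful:
  fixes A :: "'v::finite rel"
  assumes ac: "acyclic A" and fo: "\<And>E. reorientation A E \<Longrightarrow> forest (reduced E)"
  shows "chordful A"
  unfolding chordful_iff[OF ac]
proof
  show "chordal A"
    unfolding chordal_iff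
  proof
    assume "\<exists>c. chordless_cycle A c"
    then obtain c where c: "chordless_cycle A c" by blast
    then have n: "4 \<le> length c" and cyc: "undirected_cycle A c" by (auto simp: chordless_cycle_def)
    \<comment> \<open>The largest admissible position; every admissible \<open>k\<close> makes all
      edges of the cycle irreducible.\<close>
    define k where "k = length c - 2"
    have k: "1 \<le> k" "k + 2 \<le> length c" using n by (auto simp: k_def)
    obtain E where E: "reorientation A E"
      "\<And>i. Suc i < length c \<Longrightarrow> i \<noteq> k \<Longrightarrow> (c ! i, c ! Suc i) \<in> reduced E"
      "(c ! Suc k, c ! k) \<in> reduced E"
      "(c ! 0, c ! (length c - 1)) \<in> reduced E"
      using chordless_orientation[OF ac c k] by metis
    have "undirected_cycle (reduced E) c"
    proof (rule closed_path_cycle)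
      show "walk (edges (reduced E)) c"
        unfolding successively_conv_nth edges_orient using E(2,3) by metis
      show "distinct c" "3 \<le> length c" using cyc by (auto simp: undirected_cycle_def)
      have "c \<noteq> []" using n by auto
      then show "(hd c, last c) \<in> edges (reduced E)"
        using E(4) by (simp add: hd_conv_nth last_conv_nth edges_orient)
    qed
    with fo[OF E(1)] show False by (auto simp: forest_def)
  qed
  show "diamond_free A"
    unfolding diamond_free_def
  proof (intro allI impI, elim conjE, rule ccontr)
    fix p q x y
    assume h: "(p, q) \<in> edges A" "(p, x) \<in> edges A" "(q, x) \<in> edges A" "(p, y) \<in> edges A"
      "(q, y) \<in> edges A" "x \<noteq> y" "(x, y) \<notin> edges A"
    have ne: "p \<noteq> q" "p \<noteq> x" "q \<noteq> x" "p \<noteq> y" "q \<noteq> y" using h edges_irrefl[OF ac] by metis+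
    obtain E where E: "reorientation A E" "{(p, x), (x, q), (p, y), (y, q)} \<subseteq> reduced E"
      using diamond_orientation[OF ac, of p x q y] h ne edges_sym by metis
    then have "undirected_cycle (reduced E) [p, x, q, y]"
      using ne h(6) by (auto simp: undirected_cycle_iff edges_orient)
    with fo[OF E(1)] show False by (auto simp: forest_def)
  qed
qed

section \<open>Regions and facets of graphical arrangements\<close>

text \<open>A normal vector of the hyperplane of an arc, so that facts about
  \<open>{x. a \<bullet> x = b}\<close> apply.\<close>

definition arc_vector :: "'v::finite \<Rightarrow> 'v \<Rightarrow> real ^ 'v" where
  "arc_vector u v = axis v 1 - axis u 1"

lemma inner_arc_vector [simp]: "arc_vector u v \<bullet> x = x $ v - x $ u"
  by (simp add: arc_vector_def inner_diff_left inner_axis')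

text \<open>\<open>T\<close> may contain directed cycles: reversing an arc in addition to
  \<open>E\<close> models its contraction, and the vertices that it merges receive equal
  values.\<close>

definition height :: "'v::finite rel \<Rightarrow> real ^ 'v" where
  "height T = (\<chi> v. real (card {w. (w, v) \<in> T\<^sup>*}))"

lemma height_mono: "(a, b) \<in> T\<^sup>* \<Longrightarrow> height T $ a \<le> height T $ b"
  by (auto simp: height_def intro!: card_mono)

lemma height_less:
  assumes "(a, b) \<in> T\<^sup>*" "(b, a) \<notin> T\<^sup>*"
  shows "height T $ a < height T $ b"
proof -
  have "{w. (w, a) \<in> T\<^sup>*} \<subset> {w. (w, b) \<in> T\<^sup>*}" using assms by auto
  then show ?thesis by (simp add: height_def psubset_card_mono)
qed

lemma height_acyclic:
  assumes "acyclic E" "(u, v) \<in> E"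
  shows "height E $ u < height E $ v"
  using assms acyclic_antisym[OF assms(1), of u v] by (intro height_less) auto

definition open_cone :: "'v::finite rel \<Rightarrow> (real ^ 'v) set" where
  "open_cone E = {x. \<forall>(u, v) \<in> E. x $ u < x $ v}"

lemma height_in_open_cone: "acyclic E \<Longrightarrow> height E \<in> open_cone E"
  by (auto simp: open_cone_def height_acyclic)

lemma open_cone_subset: "open_cone E \<subseteq> graph_cone E"
  by (fastforce simp: open_cone_def graph_cone_def)

lemma open_open_cone: "open (open_cone E)" for E :: "'v::finite rel"
proof -
  have "open_cone E = (\<Inter>(u, v) \<in> E. {x. x $ u < x $ v})" by (auto simp: open_cone_def)
  moreover have "open {x :: real ^ 'v. x $ u < x $ v}" for u v
    by (intro open_Collect_less continuous_intros)
  ultimately show ?thesis by (auto intro!: open_INT)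
qed

lemma closed_graph_cone: "closed (graph_cone E)" for E :: "'v::finite rel"
proof -
  have "graph_cone E = (\<Inter>(u, v) \<in> E. {x. x $ u \<le> x $ v})" by (auto simp: graph_cone_def)
  moreover have "closed {x :: real ^ 'v. x $ u \<le> x $ v}" for u v
    by (intro closed_Collect_le continuous_intros)
  ultimately show ?thesis by (auto intro!: closed_INT)
qed

lemma convex_open_cone: "convex (open_cone E)" for E :: "'v::finite rel"
proof -
  have "open_cone E = (\<Inter>(u, v) \<in> E. {x. x $ u < x $ v})" by (auto simp: open_cone_def)
  moreover have "convex {x :: real ^ 'v. x $ u < x $ v}" for u v
    using convex_halfspace_gt[of 0 "arc_vector u v"] by simp
  ultimately show ?thesis by (auto intro!: convex_INT)
qed

text \<open>Adding a small positive multiple of \<open>height E\<close> makes all the weak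
  inequalities strict.\<close>

lemma closure_open_cone:
  fixes E :: "'v::finite rel"
  assumes "acyclic E"
  shows "closure (open_cone E) = graph_cone E"
proof
  show "closure (open_cone E) \<subseteq> graph_cone E"
    using closure_minimal[OF open_cone_subset closed_graph_cone] .
  show "graph_cone E \<subseteq> closure (open_cone E)"
  proof
    fix x assume x: "x \<in> graph_cone E"
    let ?s = "\<lambda>n. x + inverse (real (Suc n)) *\<^sub>R height E"
    have "?s n \<in> open_cone E" for n
      using x height_acyclic[OF assms]
      by (auto simp: open_cone_def graph_cone_def intro!: add_le_less_mono divide_strict_right_mono split: prod.splits)
    moreover have "?s \<longlonglongrightarrow> x + 0 *\<^sub>R height E"
      by (intro tendsto_intros LIMSEQ_inverse_real_of_nat)
    ultimately show "x \<in> closure (open_cone E)"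
      unfolding closure_sequential by (intro exI[of _ ?s]) simp
  qed
qed

text \<open>A point off all hyperplanes orients every edge by its coordinates. A connected set off
  the hyperplanes cannot change such an orientation, by the intermediate value theorem.\<close>

lemma regions_graphical_arrangement:
  fixes A :: "'v::finite rel"
  assumes ac: "acyclic A"
  shows "regions (graphical_arrangement A) = graph_cone ` {E. reorientation A E}"
proof -
  define U :: "(real ^ 'v) set" where "U = - \<Union>(graphical_arrangement A)"
  have U: "x \<in> U \<longleftrightarrow> (\<forall>(u, v) \<in> A. x $ u \<noteq> x $ v)" for x
    by (auto simp: U_def graphical_arrangement_def)
  have comp: "connected_component_set U x = open_cone E" if E: "reorientation A E" and x: "x \<in> open_cone E" for E x
  proof (rule connected_component_unique[OF x])
    show "connected (open_cone E)" by (simp add: convex_connected convex_open_cone)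
    show "open_cone E \<subseteq> U"
    proof
      fix y assume y: "y \<in> open_cone E"
      have "y $ u \<noteq> y $ v" if "(u, v) \<in> A" for u v
      proof -
        have "(u, v) \<in> edges E" using that E by (auto simp: reorientation_def edges_def)
        then show ?thesis using y by (auto simp: open_cone_def edges_def)
      qed
      then show "y \<in> U" by (auto simp: U)
    qed
    fix C assume C: "x \<in> C" "C \<subseteq> U" "connected C"
    show "C \<subseteq> open_cone E"
    proof
      fix y assume y: "y \<in> C"
      have "y $ u < y $ v" if uv: "(u, v) \<in> E" for u v
      proof (rule ccontr)
        assume "\<not> y $ u < y $ v"
        moreover have "x $ u < x $ v" using x uv by (auto simp: open_cone_def)
        ultimately have "\<exists>z\<in>C. arc_vector u v \<bullet> z = 0"
          by (intro connected_ivt_hyperplane[OF C(3) y C(1)]) auto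
        then obtain z where "z \<in> U" "z $ u = z $ v" using C by auto
        moreover have "(u, v) \<in> A \<or> (v, u) \<in> A"
          using reorientation_edge[OF E uv] by (auto simp: edges_orient)
        ultimately show False by (auto simp: U)
      qed
      then show "y \<in> open_cone E" by (auto simp: open_cone_def)
    qed
  qed
  have "components U = open_cone ` {E. reorientation A E}"
  proof (intro subset_antisym subsetI)
    fix C assume "C \<in> components U"
    then obtain x where x: "x \<in> U" "C = connected_component_set U x" by (auto simp: components_iff)
    define E where "E = {(u, v) \<in> edges A. x $ u < x $ v}"
    have "acyclic E"
    proof (rule acyclicI, intro allI notI)
      fix u assume "(u, u) \<in> E\<^sup>+"
      moreover have "x $ a < x $ b" if "(a, b) \<in> E\<^sup>+" for a b
        using that by (induction rule: trancl_induct) (auto simp: E_def)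
      ultimately show False by blast
    qed
    moreover have "edges E = edges A"
      using x(1) by (fastforce simp: U E_def edges_def)
    ultimately have "reorientation A E" by (simp add: reorientation_def)
    moreover have "x \<in> open_cone E" by (auto simp: open_cone_def E_def)
    ultimately show "C \<in> open_cone ` {E. reorientation A E}" using comp x by auto
  next
    fix C assume "C \<in> open_cone ` {E. reorientation A E}"
    then obtain E where E: "reorientation A E" "C = open_cone E" by auto
    then have "height E \<in> open_cone E" by (auto simp: reorientation_def height_in_open_cone)
    with comp[OF E(1) this] E(2) connected_component_subset[of U "height E"]
    show "C \<in> components U" unfolding components_iff by blast
  qed
  then have "regions (graphical_arrangement A) = closure ` open_cone ` {E. reorientation A E}"
    by (simp add: regions_def U_def)
  also have "\<dots> = graph_cone ` {E. reorientation A E}"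
    unfolding image_image by (intro image_cong) (auto simp: reorientation_def closure_open_cone)
  finally show ?thesis .
qed

lemma graph_cone_rtrancl:
  assumes "x \<in> graph_cone E" "(u, v) \<in> E\<^sup>*"
  shows "x $ u \<le> x $ v"
  using assms(2)
proof (induction rule: rtrancl_induct)
  case (step y z)
  then show ?case using assms(1) by (fastforce simp: graph_cone_def)
qed simp

text \<open>The inequality of a bypassed arc follows from those along the bypass.\<close>

lemma graph_cone_reduced:
  fixes E :: "'v::finite rel"
  assumes "acyclic E"
  shows "graph_cone (reduced E) = graph_cone E"
proof
  show "graph_cone E \<subseteq> graph_cone (reduced E)"
    using reduced_subset[of E] by (auto simp: graph_cone_def)
  show "graph_cone (reduced E) \<subseteq> graph_cone E"
  proof
    fix x assume x: "x \<in> graph_cone (reduced E)"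
    have "x $ u \<le> x $ v" if "(u, v) \<in> E" for u v
      using graph_cone_rtrancl[OF x reduced_rtrancl[OF assms]] that by blast
    then show "x \<in> graph_cone E" by (auto simp: graph_cone_def)
  qed
qed

text \<open>Contracting an arc of the transitive reduction creates no directed cycle.\<close>

lemma facet_interior_point:
  fixes E :: "'v::finite rel"
  assumes ac: "acyclic E" and uv: "(u, v) \<in> reduced E"
  obtains x :: "real ^ 'v" where "x $ u = x $ v"
    "\<And>a b. (a, b) \<in> E \<Longrightarrow> (a, b) \<noteq> (u, v) \<Longrightarrow> x $ a < x $ b"
proof
  let ?T = "insert (v, u) E"
  have uvE: "(u, v) \<in> E" using uv reduced_subset by blast
  show "height ?T $ u = height ?T $ v"
    using uvE by (intro order_antisym height_mono) auto
  fix a b assume ab: "(a, b) \<in> E" "(a, b) \<noteq> (u, v)"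
  have "(b, a) \<notin> ?T\<^sup>*"
    unfolding rtrancl_insert
    using acyclic_antisym[OF ac, of a b] arc_between_reduced[OF ac uv ab(1)] ab by blast
  then show "height ?T $ a < height ?T $ b"
    using ab by (intro height_less) auto
qed

text \<open>Witnesses that the inequality of an irreducible arc is irredundant: with that arc
  replaced by its reverse, no path from \<open>u\<close> to \<open>v\<close> remains, because it
  would be a bypass.\<close>

lemma facet_exterior_point:
  fixes E :: "'v::finite rel"
  assumes ac: "acyclic E" and uv: "(u, v) \<in> reduced E"
  obtains x :: "real ^ 'v" where "x $ v < x $ u"
    "\<And>a b. (a, b) \<in> E \<Longrightarrow> (a, b) \<noteq> (u, v) \<Longrightarrow> x $ a \<le> x $ b"
proof
  let ?E = "E - {(u, v)}"
  let ?T = "insert (v, u) ?E"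
  have uvE: "(u, v) \<in> E" using uv reduced_subset by blast
  have "(u, v) \<notin> ?E\<^sup>*"
  proof
    assume "(u, v) \<in> ?E\<^sup>*"
    moreover have "u \<noteq> v" using uvE ac by (auto simp: acyclic_def)
    ultimately obtain x where x: "(u, x) \<in> ?E" "(x, v) \<in> ?E\<^sup>*" by (meson converse_rtranclE)
    then have "(x, v) \<in> E\<^sup>*" by (meson Diff_subset rtrancl_mono subsetD)
    then show False using arc_between_reduced[OF ac uv, of u x] x by auto
  qed
  then have "(u, v) \<notin> ?T\<^sup>*" unfolding rtrancl_insert by blast
  then show "height ?T $ v < height ?T $ u" by (intro height_less) auto
  show "height ?T $ a \<le> height ?T $ b" if "(a, b) \<in> E" "(a, b) \<noteq> (u, v)" for a b
    using that by (intro height_mono) auto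
qed

definition graph_facet :: "'v::finite rel \<Rightarrow> 'v \<Rightarrow> 'v \<Rightarrow> (real ^ 'v) set" where
  "graph_facet E u v = graph_cone E \<inter> {x. x $ u = x $ v}"

lemma affine_hull_graph_cone:
  fixes E :: "'v::finite rel"
  assumes "acyclic E"
  shows "affine hull (graph_cone E) = UNIV"
proof -
  have "open_cone E \<subseteq> interior (graph_cone E)"
    by (simp add: interior_maximal open_cone_subset open_open_cone)
  then show ?thesis
    using height_in_open_cone[OF assms] by (intro affine_hull_nonempty_interior) auto
qed

lemma facet_of_graph_cone:
  fixes E :: "'v::finite rel"
  assumes ac: "acyclic E"
  shows "F facet_of graph_cone E \<longleftrightarrow> (\<exists>u v. (u, v) \<in> reduced E \<and> F = graph_facet E u v)"
proof -
  \<comment> \<open>The facet criterion for polyhedra takes the normal vector as a function of the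
    half-space, so the arc has to be recovered from its half-space; this is the purpose of
    \<open>hs_inj\<close> and \<open>pk\<close>.\<close>
  define hs :: "'v \<times> 'v \<Rightarrow> (real ^ 'v) set" where "hs p = {x. x $ fst p \<le> x $ snd p}" for p
  have hs_inj: "p = q" if "hs p = hs q" "fst p \<noteq> snd p" "fst q \<noteq> snd q" for p q
  proof -
    have "axis (fst p) 1 \<notin> hs p" "- axis (snd p) 1 \<notin> hs p"
      using that(2) by (auto simp: hs_def axis_def)
    then have "axis (fst p) 1 \<notin> hs q" "- axis (snd p) 1 \<notin> hs q" using that(1) by auto
    then show ?thesis
      using that(3) by (auto simp: hs_def axis_def prod_eq_iff split: if_splits)
  qed
  let ?R = "reduced E"
  have irr: "fst p \<noteq> snd p" if "p \<in> ?R" for p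
    using that reduced_subset[of E] ac by (cases p) (auto simp: acyclic_def)
  define pk where "pk h = inv_into ?R hs h" for h
  have "inj_on hs ?R" using hs_inj irr by (auto intro!: inj_onI)
  then have pk: "pk (hs p) = p" if "p \<in> ?R" for p using that by (simp add: pk_def)
  define a where "a h = arc_vector (snd (pk h)) (fst (pk h))" for h
  have "graph_cone E = \<Inter> (hs ` ?R)"
    unfolding graph_cone_reduced[OF ac, symmetric] by (fastforce simp: graph_cone_def hs_def)
  have "F facet_of graph_cone E \<longleftrightarrow> (\<exists>h. h \<in> hs ` ?R \<and> F = graph_cone E \<inter> {x. a h \<bullet> x = 0})"
  proof (rule facet_of_polyhedron_explicit)
    show "finite (hs ` ?R)" by simp
    show "graph_cone E = affine hull graph_cone E \<inter> \<Inter> (hs ` ?R)"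
      unfolding affine_hull_graph_cone[OF ac] using \<open>graph_cone E = \<Inter> (hs ` ?R)\<close> by simp
    fix h assume "h \<in> hs ` ?R"
    then obtain p where p: "p \<in> ?R" "h = hs p" by auto
    have "a h \<bullet> axis (fst p) 1 = 1"
      using p pk irr[OF p(1)] by (simp add: a_def axis_def)
    then have "a h \<noteq> 0" by (metis inner_zero_left zero_neq_one)
    moreover have "h = {x. a h \<bullet> x \<le> 0}" using p pk by (simp add: a_def) (simp add: hs_def)
    ultimately show "a h \<noteq> 0 \<and> h = {x. a h \<bullet> x \<le> 0}" by blast
  next
    fix F' assume F': "F' \<subset> hs ` ?R"
    then obtain p where p: "p \<in> ?R" "hs p \<notin> F'" by auto
    obtain x :: "real ^ 'v" where x: "x $ snd p < x $ fst p"
      "\<And>a b. (a, b) \<in> E \<Longrightarrow> (a, b) \<noteq> p \<Longrightarrow> x $ a \<le> x $ b"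
      using facet_exterior_point[OF ac, of "fst p" "snd p"] p by auto
    have "x \<in> \<Inter> F'"
    proof
      fix h assume "h \<in> F'"
      then obtain q where "q \<in> ?R" "h = hs q" using F' by blast
      moreover from this have "q \<noteq> p" using p(2) \<open>h \<in> F'\<close> by blast
      ultimately have q: "q \<in> ?R" "h = hs q" "q \<noteq> p" by blast+
      then have "q \<in> E" using reduced_subset by blast
      then show "x \<in> h" using x(2)[of "fst q" "snd q"] q by (simp add: hs_def)
    qed
    moreover have "x \<notin> graph_cone E"
    proof
      assume "x \<in> graph_cone E"
      then have "x \<in> hs p" using \<open>graph_cone E = \<Inter> (hs ` ?R)\<close> p(1) by blast
      then show False using x(1) by (simp add: hs_def)
    qed
    moreover have "graph_cone E \<subseteq> \<Inter> F'" using \<open>graph_cone E = \<Inter> (hs ` ?R)\<close> F' by auto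
    ultimately show "graph_cone E \<subset> affine hull graph_cone E \<inter> \<Inter> F'"
      by (auto simp: affine_hull_graph_cone[OF ac])
  qed
  also have "\<dots> \<longleftrightarrow> (\<exists>p \<in> ?R. F = graph_cone E \<inter> {x. x $ fst p = x $ snd p})"
    using pk by (force simp: a_def)
  finally show ?thesis by (simp add: graph_facet_def Bex_def)
qed

text \<open>By \<open>facet_interior_point\<close> the facet contains a nonempty relatively open
  piece of its hyperplane.\<close>

lemma affine_hull_graph_facet:
  fixes E :: "'v::finite rel"
  assumes ac: "acyclic E" and uv: "(u, v) \<in> reduced E"
  shows "affine hull (graph_facet E u v) = {x. x $ u = x $ v}"
proof
  have M: "{x. x $ u = x $ v} = {x. arc_vector u v \<bullet> x = 0}" by auto
  have aff: "affine {x :: real ^ 'v. x $ u = x $ v}" unfolding M by (rule affine_hyperplane)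
  show "affine hull (graph_facet E u v) \<subseteq> {x. x $ u = x $ v}"
    by (intro hull_minimal aff) (auto simp: graph_facet_def)
  let ?O = "open_cone (E - {(u, v)})"
  obtain x :: "real ^ 'v" where "x $ u = x $ v"
    "\<And>a b. (a, b) \<in> E \<Longrightarrow> (a, b) \<noteq> (u, v) \<Longrightarrow> x $ a < x $ b"
    using facet_interior_point[OF ac uv] by blast
  then have "x \<in> {x. x $ u = x $ v} \<inter> ?O" by (auto simp: open_cone_def)
  then have "{x. x $ u = x $ v} \<inter> ?O \<noteq> {}" by blast
  then have "affine hull ({x. x $ u = x $ v} \<inter> ?O) = {x. x $ u = x $ v}"
    using affine_hull_affine_Int_open[OF aff open_open_cone] aff by (simp add: affine_hull_eq)
  moreover have "{x. x $ u = x $ v} \<inter> ?O \<subseteq> graph_facet E u v"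
  proof
    fix x assume x: "x \<in> {x. x $ u = x $ v} \<inter> ?O"
    have "x $ a \<le> x $ b" if "(a, b) \<in> E" for a b
      using x that by (cases "(a, b) = (u, v)") (auto simp: open_cone_def intro: less_imp_le)
    then show "x \<in> graph_facet E u v" using x by (auto simp: graph_facet_def graph_cone_def)
  qed
  from hull_mono[OF this] have "affine hull ({x. x $ u = x $ v} \<inter> ?O) \<subseteq> affine hull (graph_facet E u v)" .
  ultimately show "{x. x $ u = x $ v} \<subseteq> affine hull (graph_facet E u v)" by simp
qed

text \<open>Separation allows any normal vector. It is never computed: if both cones lay on the same
  side, a segment-like connected half-space containing interior points of both would have to meet
  the hyperplane.\<close>

lemma hyperplane_separates_graph_cone:
  fixes A E :: "'v::finite rel"
  assumes ac: "acyclic A" and E: "reorientation A E" and uv: "(u, v) \<in> E"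
  shows "hyperplane_separates {x. x $ u = x $ v} (graph_cone E) (graph_cone A) \<longleftrightarrow> (v, u) \<in> A"
proof
  assume vu: "(v, u) \<in> A"
  have "u \<noteq> v" using vu ac by (auto simp: acyclic_def)
  have "arc_vector v u \<bullet> axis u 1 = 1" using \<open>u \<noteq> v\<close> by (simp add: axis_def)
  then have "arc_vector v u \<noteq> 0" by (metis inner_zero_left zero_neq_one)
  moreover have "{x. x $ u = x $ v} = {x. arc_vector v u \<bullet> x = 0}" by auto
  moreover have "\<forall>x\<in>graph_cone E. arc_vector v u \<bullet> x \<le> 0" using uv by (auto simp: graph_cone_def)
  moreover have "\<forall>x\<in>graph_cone A. 0 \<le> arc_vector v u \<bullet> x" using vu by (auto simp: graph_cone_def)
  ultimately show "hyperplane_separates {x. x $ u = x $ v} (graph_cone E) (graph_cone A)"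
    unfolding hyperplane_separates_def by blast
next
  assume "hyperplane_separates {x. x $ u = x $ v} (graph_cone E) (graph_cone A)"
  then obtain a b where ab: "{x. x $ u = x $ v} = {x. a \<bullet> x = b}"
    "\<forall>x\<in>graph_cone E. a \<bullet> x \<le> b" "\<forall>x\<in>graph_cone A. b \<le> a \<bullet> x"
    unfolding hyperplane_separates_def by blast
  show "(v, u) \<in> A"
  proof (rule ccontr)
    assume "(v, u) \<notin> A"
    then have uvA: "(u, v) \<in> A" using reorientation_edge[OF E uv] by (simp add: edges_orient)
    have acE: "acyclic E" using E by (simp add: reorientation_def)
    have "convex {x. arc_vector u v \<bullet> x > 0}" by (rule convex_halfspace_gt)
    then have "connected {x. arc_vector u v \<bullet> x > 0}" by (rule convex_connected)
    moreover have "height E \<in> {x. arc_vector u v \<bullet> x > 0}" "height A \<in> {x. arc_vector u v \<bullet> x > 0}"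
      using height_acyclic[OF acE uv] height_acyclic[OF ac uvA] by auto
    moreover have "a \<bullet> height E \<le> b" "b \<le> a \<bullet> height A"
      using ab height_in_open_cone[OF acE] height_in_open_cone[OF ac] open_cone_subset by blast+
    ultimately obtain z where "z \<in> {x. arc_vector u v \<bullet> x > 0}" "a \<bullet> z = b"
      by (meson connected_ivt_hyperplane)
    moreover have "z \<in> {x. x $ u = x $ v}" unfolding ab(1) using \<open>a \<bullet> z = b\<close> by simp
    ultimately show False by simp
  qed
qed

lemma lower_facet_graph_cone:
  fixes A E :: "'v::finite rel"
  assumes ac: "acyclic A" and E: "reorientation A E"
  shows "lower_facet (graph_cone A) (graph_cone E) F \<longleftrightarrow>
    (\<exists>u v. (u, v) \<in> reduced E \<and> (v, u) \<in> A \<and> F = graph_facet E u v)"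
proof -
  have acE: "acyclic E" using E by (simp add: reorientation_def)
  have "hyperplane_separates (affine hull (graph_facet E u v)) (graph_cone E) (graph_cone A) \<longleftrightarrow> (v, u) \<in> A"
    if "(u, v) \<in> reduced E" for u v
    using that affine_hull_graph_facet[OF acE that] hyperplane_separates_graph_cone[OF ac E, of u v]
      reduced_subset by auto
  then show ?thesis unfolding lower_facet_def facet_of_graph_cone[OF acE] by blast
qed

lemma upper_facet_graph_cone:
  fixes A E :: "'v::finite rel"
  assumes ac: "acyclic A" and E: "reorientation A E"
  shows "upper_facet (graph_cone A) (graph_cone E) F \<longleftrightarrow>
    (\<exists>u v. (u, v) \<in> reduced E \<and> (u, v) \<in> A \<and> F = graph_facet E u v)"
proof -
  have acE: "acyclic E" using E by (simp add: reorientation_def)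
  have "hyperplane_separates (affine hull (graph_facet E u v)) (graph_cone E) (graph_cone A) \<longleftrightarrow> (u, v) \<notin> A"
    if uv: "(u, v) \<in> reduced E" for u v
  proof -
    have uvE: "(u, v) \<in> E" using uv reduced_subset by blast
    have "(u, v) \<in> edges A" using reorientation_edge[OF E uvE] by simp
    moreover have "\<not> ((u, v) \<in> A \<and> (v, u) \<in> A)" using ac by (meson acyclic_def trancl.simps)
    ultimately show ?thesis
      using affine_hull_graph_facet[OF acE uv] hyperplane_separates_graph_cone[OF ac E uvE]
      by (auto simp: edges_orient)
  qed
  then show ?thesis unfolding upper_facet_def facet_of_graph_cone[OF acE] by blast
qed

section \<open>Simplicial arrangements\<close>

text \<open>An induced path avoiding the arc would close up with it to a cycle; it has at least
  three vertices because the opposite arc is absent.\<close>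

lemma arc_not_bypassed_in_forest:
  assumes ac: "acyclic F" and fo: "forest F" and uv: "(u, v) \<in> F"
  shows "(v, u) \<notin> (edges (F - {(u, v)}))\<^sup>*"
proof
  assume "(v, u) \<in> (edges (F - {(u, v)}))\<^sup>*"
  then obtain p where p: "p \<noteq> []" "hd p = v" "last p = u"
    "walk (edges (F - {(u, v)})) p" "distinct p"
    using induced_path[of v u] by metis
  have ne: "u \<noteq> v" using uv ac by (auto simp: acyclic_def)
  have "(v, u) \<notin> F" using uv ac by (meson acyclic_def trancl.simps)
  then have "length p \<noteq> 2"
    using p by (auto simp: numeral_2_eq_2 length_Suc_conv edges_orient)
  moreover have "length p \<noteq> 1" using p ne by (auto simp: length_Suc_conv)
  moreover have "length p \<noteq> 0" using p by simp
  ultimately have len: "3 \<le> length p" by linarith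
  have "walk (edges F) p"
    using p(4) by (rule successively_mono) (auto simp: edges_orient)
  then have "undirected_cycle F p"
    using p(5) len by (rule closed_path_cycle) (use p uv in \<open>auto simp: edges_orient\<close>)
  with fo show False by (auto simp: forest_def)
qed

lemma convex_cone_hull_sum:
  assumes "finite I" "\<And>i. i \<in> I \<Longrightarrow> 0 \<le> c i" "\<And>i. i \<in> I \<Longrightarrow> s i \<in> S"
  shows "(\<Sum>i\<in>I. c i *\<^sub>R s i) \<in> convex_cone hull S"
  using assms
proof (induction I rule: finite_induct)
  case empty
  show ?case by (simp add: convex_cone_hull_contains_0)
next
  case (insert i I)
  then show ?case by (simp add: convex_cone_hull_add convex_cone_hull_mul hull_inc)
qed

lemma convex_cone_hull_finite_subset:
  assumes "finite S"
  shows "convex_cone hull S \<subseteq> {\<Sum>s\<in>S. c s *\<^sub>R s | c. \<forall>s\<in>S. 0 \<le> c s}"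
proof (rule hull_minimal)
  let ?K = "{\<Sum>s\<in>S. c s *\<^sub>R s | c. \<forall>s\<in>S. 0 \<le> c s}"
  show "S \<subseteq> ?K"
  proof
    fix t assume "t \<in> S"
    then have "t = (\<Sum>s\<in>S. (if s = t then 1 else 0) *\<^sub>R s)"
      using assms by (simp add: if_distrib[of "\<lambda>c. c *\<^sub>R _"] cong: if_cong)
    then show "t \<in> ?K"
      by (intro CollectI exI[of _ "\<lambda>s. if s = t then 1 else 0"]) simp
  qed
  show "convex_cone ?K"
    unfolding convex_cone_iff
  proof (intro conjI ballI allI impI)
    show "0 \<in> ?K"
      by (intro CollectI exI[of _ "\<lambda>_. 0"]) simp
    fix x y assume "x \<in> ?K" "y \<in> ?K"
    then obtain c d where "x = (\<Sum>s\<in>S. c s *\<^sub>R s)" "y = (\<Sum>s\<in>S. d s *\<^sub>R s)" "\<forall>s\<in>S. 0 \<le> c s" "\<forall>s\<in>S. 0 \<le> d s"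
      by auto
    then show "x + y \<in> ?K"
      by (intro CollectI exI[of _ "\<lambda>s. c s + d s"]) (simp add: scaleR_add_left sum.distrib)
  next
    fix x and r :: real assume "x \<in> ?K" "0 \<le> r"
    then obtain c where "x = (\<Sum>s\<in>S. c s *\<^sub>R s)" "\<forall>s\<in>S. 0 \<le> c s" by auto
    then show "r *\<^sub>R x \<in> ?K"
      using \<open>0 \<le> r\<close> by (intro CollectI exI[of _ "\<lambda>s. r * c s"]) (simp add: scaleR_sum_right)
  qed
qed

text \<open>In a forest the functionals \<open>f p\<close> of the irreducible arcs have a dual
  system \<open>s p\<close>. The vectors \<open>s p\<close> generate the cone modulo the lineality
  space \<open>?L\<close>, and the coefficient of \<open>s p\<close> in a point \<open>x\<close> is
  \<open>f p x\<close>.\<close>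

lemma graph_cone_mod_simplicial:
  fixes E :: "'v::finite rel"
  assumes ac: "acyclic E" and fo: "forest (reduced E)"
  shows "simplicial_cone_mod {x. \<forall>(u, v) \<in> E. x $ u = x $ v} (graph_cone E)"
proof -
  let ?F = "reduced E"
  let ?L = "{x :: real ^ 'v. \<forall>(u, v) \<in> E. x $ u = x $ v}"
  have acF: "acyclic ?F" using ac reduced_subset acyclic_subset by blast
  define f :: "'v \<times> 'v \<Rightarrow> real ^ 'v \<Rightarrow> real" where "f p x = x $ snd p - x $ fst p" for p x
  have f_lin: "f p (x + y) = f p x + f p y" "f p (x - y) = f p x - f p y" "f p (r *\<^sub>R x) = r * f p x" "f p 0 = 0" for p x y r
    by (simp_all add: f_def algebra_simps)
  have f_sum: "f p (sum g I) = (\<Sum>i\<in>I. f p (g i))" for p I and g :: "'v \<times> 'v \<Rightarrow> real ^ 'v"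
    by (simp add: f_def sum_subtractf)
  \<comment> \<open>Indicator of the component containing the head of \<open>p\<close> after
    \<open>p\<close> is removed; only \<open>p\<close> itself has its ends on different
    sides.\<close>
  define s :: "'v \<times> 'v \<Rightarrow> real ^ 'v" where
    "s p = (\<chi> w. if (snd p, w) \<in> (edges (?F - {p}))\<^sup>* then 1 else 0)" for p
  have dual: "f q (s p) = (if q = p then 1 else 0)" if "p \<in> ?F" "q \<in> ?F" for p q
  proof (cases "q = p")
    case True
    then show ?thesis
      using arc_not_bypassed_in_forest[OF acF fo, of "fst p" "snd p"] that by (simp add: f_def s_def)
  next
    case False
    then have "(fst q, snd q) \<in> ?F - {p}" using that by simp
    then have "(fst q, snd q) \<in> edges (?F - {p})" "(snd q, fst q) \<in> edges (?F - {p})"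
      unfolding edges_orient by blast+
    then have "(snd p, fst q) \<in> (edges (?F - {p}))\<^sup>* \<longleftrightarrow> (snd p, snd q) \<in> (edges (?F - {p}))\<^sup>*"
      by (meson rtrancl.rtrancl_into_rtrancl)
    with False show ?thesis by (simp add: f_def s_def)
  qed
  have f_comb: "f q (\<Sum>p\<in>?F. c p *\<^sub>R s p) = c q" if "q \<in> ?F" for q c
  proof -
    have "f q (\<Sum>p\<in>?F. c p *\<^sub>R s p) = (\<Sum>p\<in>?F. if q = p then c p else 0)"
      unfolding f_sum by (intro sum.cong) (auto simp: f_lin dual that)
    then show ?thesis using that by simp
  qed
  have inj: "inj_on s ?F"
  proof (rule inj_onI)
    fix p q assume pq: "p \<in> ?F" "q \<in> ?F" "s p = s q"
    then show "p = q" using dual[OF pq(1,1)] dual[OF pq(2,1)] by (auto split: if_splits)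
  qed
  have span: "\<exists>c. x = (\<Sum>p\<in>?F. c p *\<^sub>R s p)" if x: "x \<in> span (s ` ?F)" for x
  proof -
    obtain u where "x = (\<Sum>v\<in>s ` ?F. u v *\<^sub>R v)" using x span_finite[of "s ` ?F"] by auto
    then have "x = (\<Sum>p\<in>?F. u (s p) *\<^sub>R s p)" by (simp add: sum.reindex[OF inj])
    then show ?thesis by (rule exI[of _ "\<lambda>p. u (s p)"])
  qed
  have L: "x \<in> ?L" if "\<And>p. p \<in> ?F \<Longrightarrow> f p x = 0" for x
  proof -
    have "x $ u = x $ v" if "(u, v) \<in> ?F\<^sup>*" for u v
      using that
    proof (induction rule: rtrancl_induct)
      case (step y z)
      then show ?case using \<open>\<And>p. p \<in> ?F \<Longrightarrow> f p x = 0\<close>[of "(y, z)"] by (simp add: f_def)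
    qed simp
    then show ?thesis using reduced_rtrancl[OF ac] by blast
  qed
  have L': "f p x = 0" if "x \<in> ?L" "p \<in> ?F" for x p
    using that reduced_subset[of E] by (force simp: f_def)
  have cone: "x \<in> graph_cone E \<longleftrightarrow> (\<forall>p \<in> ?F. 0 \<le> f p x)" for x
    unfolding graph_cone_reduced[OF ac, symmetric] by (force simp: graph_cone_def f_def)
  have "independent (s ` ?F)"
  proof (rule independent_if_scalars_zero)
    show "finite (s ` ?F)" by simp
    fix g x assume g: "(\<Sum>x\<in>s ` ?F. g x *\<^sub>R x) = 0" and "x \<in> s ` ?F"
    then obtain q where q: "q \<in> ?F" "x = s q" by auto
    have "(\<Sum>p\<in>?F. g (s p) *\<^sub>R s p) = 0" using g by (simp add: sum.reindex[OF inj])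
    then show "g x = 0" using f_comb[OF q(1), of "\<lambda>p. g (s p)"] q by (simp add: f_lin)
  qed
  moreover have "span (s ` ?F) \<inter> ?L = {0}"
  proof
    show "span (s ` ?F) \<inter> ?L \<subseteq> {0}"
    proof
      fix x assume x: "x \<in> span (s ` ?F) \<inter> ?L"
      then obtain c where c: "x = (\<Sum>p\<in>?F. c p *\<^sub>R s p)" using span by blast
      have "c p = 0" if "p \<in> ?F" for p using f_comb[OF that, of c] L'[of x p] x c that by simp
      then show "x \<in> {0}" by (simp add: c)
    qed
    show "{0} \<subseteq> span (s ` ?F) \<inter> ?L" by (auto simp: span_zero)
  qed
  moreover have "graph_cone E = {x + y | x y. x \<in> convex_cone hull (s ` ?F) \<and> y \<in> ?L}"
  proof (intro subset_antisym subsetI)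
    fix x assume x: "x \<in> graph_cone E"
    let ?y = "\<Sum>p\<in>?F. f p x *\<^sub>R s p"
    have "?y \<in> convex_cone hull (s ` ?F)"
      using x cone by (intro convex_cone_hull_sum) auto
    moreover have "x - ?y \<in> ?L" by (rule L) (simp add: f_lin f_comb)
    ultimately show "x \<in> {x + y | x y. x \<in> convex_cone hull (s ` ?F) \<and> y \<in> ?L}"
      by (intro CollectI exI[of _ ?y] exI[of _ "x - ?y"]) simp
  next
    fix z assume "z \<in> {x + y | x y. x \<in> convex_cone hull (s ` ?F) \<and> y \<in> ?L}"
    then obtain x y where z: "z = x + y" "x \<in> convex_cone hull (s ` ?F)" "y \<in> ?L" by blast
    have "convex_cone hull (s ` ?F) \<subseteq> graph_cone E"
    proof (rule hull_minimal)
      show "s ` ?F \<subseteq> graph_cone E" using cone dual by auto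
      show "convex_cone (graph_cone E)" unfolding convex_cone_iff by (auto simp: cone f_lin)
    qed
    then show "z \<in> graph_cone E" using z L'[OF z(3)] by (auto simp: cone f_lin)
  qed
  ultimately show ?thesis unfolding simplicial_cone_mod_def by blast
qed

text \<open>In a simplicial cone every facet misses exactly one generator, and different facets miss
  different ones. The generator missed by the facet of \<open>(u, v)\<close> is the required
  vector.\<close>

lemma simplicial_imp_dual_vectors:
  fixes E :: "'v::finite rel"
  assumes ac: "acyclic E" and si: "simplicial_cone_mod {x. \<forall>(u, v) \<in> E. x $ u = x $ v} (graph_cone E)"
    and e: "(u, v) \<in> reduced E"
  obtains z :: "real ^ 'v" where "z $ u < z $ v"
    "\<And>a b. (a, b) \<in> reduced E \<Longrightarrow> (a, b) \<noteq> (u, v) \<Longrightarrow> z $ a = z $ b"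
proof -
  let ?F = "reduced E"
  let ?L = "{x :: real ^ 'v. \<forall>(u, v) \<in> E. x $ u = x $ v}"
  obtain S where ind: "independent S" and SL: "span S \<inter> ?L = {0}"
    and C: "graph_cone E = {x + y | x y. x \<in> convex_cone hull S \<and> y \<in> ?L}"
    using si unfolding simplicial_cone_mod_def by blast
  have fin: "finite S" using independent_bound[OF ind] by blast
  define f :: "'v \<times> 'v \<Rightarrow> real ^ 'v \<Rightarrow> real" where "f p x = x $ snd p - x $ fst p" for p x
  have f_lin: "f p (x + y) = f p x + f p y" "f p (x - y) = f p x - f p y" "f p (r *\<^sub>R x) = r * f p x" for p x y r
    by (simp_all add: f_def algebra_simps)
  have f_sum: "f p (\<Sum>i\<in>I. c i *\<^sub>R i) = (\<Sum>i\<in>I. c i * f p i)" for p c and I :: "(real ^ 'v) set"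
    by (simp add: f_def sum_subtractf right_diff_distrib)
  have FE: "p \<in> E" if "p \<in> ?F" for p using that reduced_subset by blast
  have f_L: "f p x = 0" if "x \<in> ?L" "p \<in> E" for x p using that by (force simp: f_def)
  have zero_L: "0 \<in> ?L" by simp
  have decomp: "\<exists>c l. x = (\<Sum>s\<in>S. c s *\<^sub>R s) + l \<and> (\<forall>s\<in>S. 0 \<le> c s) \<and> l \<in> ?L" if "x \<in> graph_cone E" for x
    using that convex_cone_hull_finite_subset[OF fin] unfolding C by blast
  have S_cone: "s \<in> graph_cone E" if "s \<in> S" for s
    unfolding C using that zero_L by (intro CollectI exI[of _ s] exI[of _ 0]) (simp add: hull_inc)
  have f_S: "0 \<le> f p s" if "s \<in> S" "p \<in> E" for s p
    using S_cone[OF that(1)] that(2) by (cases p) (auto simp: graph_cone_def f_def)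
  have uniq: "c s = d s"
    if "(\<Sum>s\<in>S. c s *\<^sub>R s) - (\<Sum>s\<in>S. d s *\<^sub>R s) \<in> ?L" "s \<in> S" for c d s
  proof -
    have "(\<Sum>s\<in>S. (c s - d s) *\<^sub>R s) = (\<Sum>s\<in>S. c s *\<^sub>R s) - (\<Sum>s\<in>S. d s *\<^sub>R s)"
      by (simp add: scaleR_diff_left sum_subtractf)
    moreover have "(\<Sum>s\<in>S. (c s - d s) *\<^sub>R s) \<in> span S"
      by (intro span_sum span_scale span_base)
    ultimately have "(\<Sum>s\<in>S. (c s - d s) *\<^sub>R s) \<in> span S \<inter> ?L" using that(1) by simp
    then have "(\<Sum>s\<in>S. (c s - d s) *\<^sub>R s) = 0" unfolding SL by simp
    then have "c s - d s = 0" using independentD[OF ind fin subset_refl, of "\<lambda>s. c s - d s"] that(2) by blast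
    then show ?thesis by simp
  qed
  have L_sub: "l - l' \<in> ?L" if "l \<in> ?L" "l' \<in> ?L" for l l' using that by fastforce
  \<comment> \<open>Besides the generator \<open>s\<close> off the facet of \<open>p\<close>, an
    interior point \<open>x\<close> of that facet is recorded, with coefficient 0 at
    \<open>s\<close>; it later tells different facets apart.\<close>
  have facet: "\<exists>s x c l. s \<in> S \<and> 0 < f p s \<and> (\<forall>t\<in>S. t \<noteq> s \<longrightarrow> f p t = 0) \<and>
      x = (\<Sum>s\<in>S. c s *\<^sub>R s) + l \<and> l \<in> ?L \<and> c s = 0 \<and> (\<forall>q\<in>E. q \<noteq> p \<longrightarrow> 0 < f q x)"
    if p: "p \<in> ?F" for p
  proof -
    obtain x :: "real ^ 'v" where x': "x $ fst p = x $ snd p"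
      "\<And>a b. (a, b) \<in> E \<Longrightarrow> (a, b) \<noteq> (fst p, snd p) \<Longrightarrow> x $ a < x $ b"
      using facet_interior_point[OF ac, of "fst p" "snd p"] p unfolding prod.collapse by blast
    have x: "f p x = 0" "\<And>q. q \<in> E \<Longrightarrow> q \<noteq> p \<Longrightarrow> 0 < f q x"
      using x' by (auto simp: f_def)
    have xC: "x \<in> graph_cone E"
    proof -
      have "0 \<le> f q x" if "q \<in> E" for q using x(1) x(2)[OF that] less_imp_le[of 0 "f q x"] by (cases "q = p") simp_all
      then show ?thesis by (force simp: graph_cone_def f_def)
    qed
    obtain c l where c: "x = (\<Sum>s\<in>S. c s *\<^sub>R s) + l" "\<forall>s\<in>S. 0 \<le> c s" "l \<in> ?L"
      using decomp[OF xC] by blast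
    have fx: "f q x = (\<Sum>s\<in>S. c s * f q s)" if "q \<in> E" for q
      using f_L[OF c(3) that] by (simp add: c(1) f_lin f_sum)
    have c0: "c s * f p s = 0" if "s \<in> S" for s
    proof -
      have "(\<Sum>s\<in>S. c s * f p s) = 0" using fx[OF FE[OF p]] x(1) by simp
      then show ?thesis using sum_nonneg_eq_0_iff[OF fin, of "\<lambda>s. c s * f p s"] c(2) f_S[OF _ FE[OF p]] that by simp
    qed
    have "\<exists>s\<in>S. 0 < f p s"
    proof (rule ccontr)
      assume "\<not> ?thesis"
      then have z: "f p s = 0" if "s \<in> S" for s using f_S[OF that FE[OF p]] that by force
      obtain d l where d: "height E = (\<Sum>s\<in>S. d s *\<^sub>R s) + l" "l \<in> ?L"
        using decomp[of "height E"] height_in_open_cone[OF ac] open_cone_subset by blast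
      have "f p (height E) = 0" using z f_L[OF d(2) FE[OF p]] by (simp add: d(1) f_lin f_sum)
      then show False using height_acyclic[OF ac, of "fst p" "snd p"] FE[OF p] by (simp add: f_def)
    qed
    then obtain s where s: "s \<in> S" "0 < f p s" by blast
    have others: "f p t = 0" if t: "t \<in> S" "t \<noteq> s" for t
    proof (rule ccontr)
      assume "f p t \<noteq> 0"
      then have ft: "0 < f p t" using f_S[OF t(1) FE[OF p]] by simp
      \<comment> \<open>Two generators off the facet combine to a direction along its hyperplane. A
        small move from the interior point \<open>x\<close> in that direction stays in the
        cone.\<close>
      define y where "y = f p t *\<^sub>R s - f p s *\<^sub>R t"
      have "x \<in> open_cone (E - {p})" using x(2) by (force simp: open_cone_def f_def)
      then obtain r where r: "0 < r" "ball x r \<subseteq> open_cone (E - {p})"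
        using open_open_cone open_contains_ball by blast
      define \<epsilon> where "\<epsilon> = r / (norm y + 1)"
      have ny: "0 < norm y + 1" using norm_ge_zero[of y] by linarith
      have eps: "0 < \<epsilon>" using r ny by (simp add: \<epsilon>_def)
      have "norm (\<epsilon> *\<^sub>R y) < r"
        using r ny by (simp add: \<epsilon>_def divide_simps)
      then have "x + \<epsilon> *\<^sub>R y \<in> ball x r" by (simp add: dist_norm)
      then have xy: "x + \<epsilon> *\<^sub>R y \<in> open_cone (E - {p})" using r by blast
      have "f p y = 0" by (simp add: y_def f_lin)
      have "x + \<epsilon> *\<^sub>R y \<in> graph_cone E"
      proof -
        have "0 \<le> f q (x + \<epsilon> *\<^sub>R y)" if "q \<in> E" for q
        proof (cases "q = p")
          case True
          then show ?thesis using x(1) \<open>f p y = 0\<close> by (simp add: f_lin)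
        next
          case False
          then have "0 < f q (x + \<epsilon> *\<^sub>R y)"
            using xy that unfolding open_cone_def f_def by (cases q) fastforce
          then show ?thesis by simp
        qed
        then show ?thesis by (force simp: graph_cone_def f_def)
      qed
      then obtain d l' where d: "x + \<epsilon> *\<^sub>R y = (\<Sum>s\<in>S. d s *\<^sub>R s) + l'" "\<forall>s\<in>S. 0 \<le> d s" "l' \<in> ?L"
        using decomp by blast
      define g where "g i = c i + \<epsilon> * ((if i = s then f p t else 0) - (if i = t then f p s else 0))" for i
      have "y = (\<Sum>i\<in>S. ((if i = s then f p t else 0) - (if i = t then f p s else 0)) *\<^sub>R i)"
        using s t fin by (simp add: y_def scaleR_diff_left sum_subtractf if_distrib[of "\<lambda>c. c *\<^sub>R _"] cong: if_cong)
      then have "(\<Sum>i\<in>S. g i *\<^sub>R i) = (\<Sum>s\<in>S. c s *\<^sub>R s) + \<epsilon> *\<^sub>R y"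
        by (simp add: g_def scaleR_add_left sum.distrib scaleR_sum_right)
      then have "(\<Sum>i\<in>S. g i *\<^sub>R i) - (\<Sum>s\<in>S. d s *\<^sub>R s) = l' - l"
        using c(1) d(1) by (simp add: algebra_simps)
      then have "(\<Sum>i\<in>S. g i *\<^sub>R i) - (\<Sum>s\<in>S. d s *\<^sub>R s) \<in> ?L"
        using L_sub[OF d(3) c(3)] by metis
      \<comment> \<open>Coefficients are unique modulo \<open>?L\<close>, so the moved point would
        have a negative coefficient at \<open>t\<close>.\<close>
      from uniq[OF this t(1)] have "g t = d t" .
      moreover have "c t = 0" using c0[OF t(1)] ft by simp
      ultimately have "d t = - (\<epsilon> * f p s)" using t(2) by (simp add: g_def)
      then show False using d(2) t(1) eps s(2) by (metis mult_pos_pos neg_0_le_iff_le not_le)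
    qed
    moreover have "c s = 0" using c0[OF s(1)] s(2) by simp
    ultimately show ?thesis using s c x(2) by blast
  qed
  obtain s x c l where s: "s \<in> S" "0 < f (u, v) s" "\<forall>t\<in>S. t \<noteq> s \<longrightarrow> f (u, v) t = 0"
    "x = (\<Sum>s\<in>S. c s *\<^sub>R s) + l" "l \<in> ?L" "c s = 0" "\<forall>q\<in>E. q \<noteq> (u, v) \<longrightarrow> 0 < f q x"
    using facet[OF e] by blast
  \<comment> \<open>Otherwise \<open>s\<close> is also the only generator off the facet of
    \<open>q\<close>. Since \<open>x\<close> has coefficient 0 at \<open>s\<close>, this gives
    \<open>f q x = 0\<close>, although \<open>x\<close> is interior to the facet of
    \<open>(u, v)\<close>.\<close>
  have "f q s = 0" if q: "q \<in> ?F" "q \<noteq> (u, v)" for q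
  proof (rule ccontr)
    assume n: "f q s \<noteq> 0"
    obtain t where t: "t \<in> S" "0 < f q t" "\<forall>t'\<in>S. t' \<noteq> t \<longrightarrow> f q t' = 0"
      using facet[OF q(1)] by blast
    then have "t = s" using n s(1) by metis
    then have "f q x = (\<Sum>i\<in>S. c i * f q i)"
      using f_L[OF s(5) FE[OF q(1)]] by (simp add: s(4) f_lin f_sum)
    also have "\<dots> = 0" using t(3) \<open>t = s\<close> s(6) by (intro sum.neutral) auto
    finally show False using s(7) FE[OF q(1)] q(2) by force
  qed
  then have "s $ a = s $ b" if "(a, b) \<in> ?F" "(a, b) \<noteq> (u, v)" for a b
    using that by (force simp: f_def)
  with s(2) that[of s] show thesis by (simp add: f_def)
qed

text \<open>The dual vector of the closing edge is constant along all other edges of the cycle, so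
  it cannot differ at the two ends of the closing edge.\<close>

lemma simplicial_imp_forest:
  fixes E :: "'v::finite rel"
  assumes ac: "acyclic E" and si: "simplicial_cone_mod {x. \<forall>(u, v) \<in> E. x $ u = x $ v} (graph_cone E)"
  shows "forest (reduced E)"
  unfolding forest_def
proof
  let ?F = "reduced E"
  assume "\<exists>c. undirected_cycle ?F c"
  then obtain c where c: "undirected_cycle ?F c" by blast
  then have n: "3 \<le> length c" and d: "distinct c" by (auto simp: undirected_cycle_def)
  have ne: "c \<noteq> []" using n by auto
  have "(last c, hd c) \<in> edges ?F" using c by (simp add: undirected_cycle_iff)
  then have "(c ! (length c - 1), c ! 0) \<in> edges ?F" using ne by (simp add: hd_conv_nth last_conv_nth)
  then obtain u v where uv: "(u, v) \<in> ?F" "{u, v} = {c ! 0, c ! (length c - 1)}"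
    by (auto simp: edges_orient)
  obtain z :: "real ^ 'v" where z: "z $ u < z $ v"
    "\<And>a b. (a, b) \<in> ?F \<Longrightarrow> (a, b) \<noteq> (u, v) \<Longrightarrow> z $ a = z $ b"
    using simplicial_imp_dual_vectors[OF ac si uv(1)] by blast
  have eq: "z $ (c ! i) = z $ (c ! 0)" if "i < length c" for i
    using that
  proof (induction i)
    case (Suc i)
    have e: "(c ! i, c ! Suc i) \<in> edges ?F"
      using c Suc.prems successively_nth[of _ c i] unfolding undirected_cycle_iff by blast
    have "{c ! i, c ! Suc i} \<noteq> {u, v}"
    proof
      assume "{c ! i, c ! Suc i} = {u, v}"
      then have "c ! i = c ! 0 \<and> c ! Suc i = c ! (length c - 1) \<or> c ! i = c ! (length c - 1) \<and> c ! Suc i = c ! 0"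
        unfolding uv(2) by (metis doubleton_eq_iff)
      then show False
        using Suc.prems n nth_eq_iff_index_eq[OF d, of i 0] nth_eq_iff_index_eq[OF d, of "Suc i" "length c - 1"]
          nth_eq_iff_index_eq[OF d, of "Suc i" 0] by linarith
    qed
    then have "z $ (c ! i) = z $ (c ! Suc i)" using e z(2) unfolding edges_orient by fastforce
    then show ?case using Suc by simp
  qed simp
  have "length c - 1 < length c" using n by linarith
  from eq[OF this] have "z $ (c ! (length c - 1)) = z $ (c ! 0)" .
  then have "z $ u = z $ v" using uv(2) by (auto simp: doubleton_eq_iff)
  with z(1) show False by simp
qed

lemma Inter_graphical_arrangement:
  assumes "reorientation A E"
  shows "\<Inter> (graphical_arrangement A) = {x. \<forall>(u, v) \<in> E. x $ u = x $ v}"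
proof -
  have sym: "{x :: real ^ 'a. \<forall>(u, v) \<in> edges B. x $ u = x $ v} = {x. \<forall>(u, v) \<in> B. x $ u = x $ v}"
    for B by (auto simp: edges_def)
  have "\<Inter> (graphical_arrangement A) = {x. \<forall>(u, v) \<in> A. x $ u = x $ v}"
    unfolding graphical_arrangement_def by blast
  also have "\<dots> = {x. \<forall>(u, v) \<in> edges E. x $ u = x $ v}"
    using sym[of A] assms by (simp add: reorientation_def)
  finally show ?thesis unfolding sym .
qed

lemma simplicial_arrangement_iff_chordful:
  fixes A :: "'v::finite rel"
  assumes ac: "acyclic A"
  shows "simplicial_arrangement (graphical_arrangement A) \<longleftrightarrow> chordful A"
proof -
  have "simplicial_arrangement (graphical_arrangement A) \<longleftrightarrow>
    (\<forall>E. reorientation A E \<longrightarrow> simplicial_cone_mod (\<Inter> (graphical_arrangement A)) (graph_cone E))"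
    unfolding simplicial_arrangement_def regions_graphical_arrangement[OF ac] by blast
  also have "\<dots> \<longleftrightarrow> (\<forall>E. reorientation A E \<longrightarrow> forest (reduced E))"
  proof -
    have "simplicial_cone_mod (\<Inter> (graphical_arrangement A)) (graph_cone E) \<longleftrightarrow> forest (reduced E)"
      if "reorientation A E" for E
      using Inter_graphical_arrangement[OF that] that graph_cone_mod_simplicial[of E] simplicial_imp_forest[of E]
      by (auto simp: reorientation_def)
    then show ?thesis by blast
  qed
  also have "\<dots> \<longleftrightarrow> chordful A"
    using chordful_imp_reduction_forest[OF ac] reduction_forest_imp_chordful[OF ac] by blast
  finally show ?thesis .
qed

section \<open>Tight arrangements\<close>

lemma aff_dim_annihilator:
  fixes D :: "'a::euclidean_space set"
  assumes "independent D"
  shows "aff_dim {x. \<forall>d\<in>D. d \<bullet> x = 0} = int DIM('a) - int (card D)"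
proof -
  have eq: "{x. \<forall>d\<in>D. d \<bullet> x = 0} = {y \<in> UNIV. \<forall>x\<in>span D. orthogonal x y}"
  proof (intro subset_antisym subsetI)
    fix x assume x: "x \<in> {x. \<forall>d\<in>D. d \<bullet> x = 0}"
    have "orthogonal a x" if "a \<in> span D" for a
      using orthogonal_to_span[OF that, of x] x by (simp add: orthogonal_def inner_commute)
    then show "x \<in> {y \<in> UNIV. \<forall>x\<in>span D. orthogonal x y}" by simp
  next
    fix x assume "x \<in> {y \<in> UNIV. \<forall>x\<in>span D. orthogonal x y}"
    then show "x \<in> {x. \<forall>d\<in>D. d \<bullet> x = 0}" by (simp add: orthogonal_def span_base)
  qed
  have "subspace {x. \<forall>d\<in>D. d \<bullet> x = 0}"
    by (auto simp: subspace_def inner_add_right)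
  moreover have "dim {x. \<forall>d\<in>D. d \<bullet> x = 0} + card D = DIM('a)"
    using dim_subspace_orthogonal_to_vectors[of "span D" UNIV] dim_span_eq_card_independent[OF assms]
    unfolding eq by simp
  ultimately show ?thesis by (simp add: aff_dim_subspace)
qed

lemma not_in_span_of_orthogonal:
  fixes y :: "'a::euclidean_space"
  assumes "\<And>d. d \<in> D \<Longrightarrow> d \<bullet> y = 0" "g \<bullet> y \<noteq> 0"
  shows "g \<notin> span D"
  using orthogonal_to_span[of g D y] assms by (auto simp: orthogonal_def inner_commute)

text \<open>The test vector is an interior point of one of the two facets: it kills the normal of
  that facet but not the other one.\<close>

lemma independent_arc_vectors:
  fixes E :: "'v::finite rel"
  assumes ac: "acyclic E" and e: "(u, v) \<in> reduced E" "(w, z) \<in> reduced E"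
    and ne: "(u, v) \<noteq> (w, z)"
  shows "independent {arc_vector u v, arc_vector w z}" "arc_vector u v \<noteq> arc_vector w z"
proof -
  obtain y :: "real ^ 'v" where y: "y $ w = y $ z"
    "\<And>a b. (a, b) \<in> E \<Longrightarrow> (a, b) \<noteq> (w, z) \<Longrightarrow> y $ a < y $ b"
    using facet_interior_point[OF ac e(2)] by blast
  have uv: "y $ u < y $ v" using y(2) e(1) ne reduced_subset by blast
  have "arc_vector u v \<notin> span {arc_vector w z}"
    by (rule not_in_span_of_orthogonal[of _ y]) (use y uv in auto)
  moreover have "arc_vector w z \<noteq> 0"
  proof
    assume "arc_vector w z = 0"
    then have "arc_vector w z \<bullet> height E = 0" by (simp only: inner_zero_left)
    moreover have "height E $ w < height E $ z" using height_acyclic[OF ac] e(2) reduced_subset by blast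
    ultimately show False by simp
  qed
  moreover from calculation(1) show "arc_vector u v \<noteq> arc_vector w z"
    using span_base[of "arc_vector u v" "{arc_vector w z}"] by auto
  ultimately show "independent {arc_vector u v, arc_vector w z}"
    by (simp add: independent_insert)
qed

lemma aff_dim_two_equations:
  fixes E :: "'v::finite rel"
  assumes ac: "acyclic E" and e: "(u, v) \<in> reduced E" "(w, z) \<in> reduced E"
    and ne: "(u, v) \<noteq> (w, z)"
  shows "aff_dim {x :: real ^ 'v. x $ u = x $ v \<and> x $ w = x $ z} = int DIM(real ^ 'v) - 2"
proof -
  have "{x :: real ^ 'v. x $ u = x $ v \<and> x $ w = x $ z} =
      {x. \<forall>d\<in>{arc_vector u v, arc_vector w z}. d \<bullet> x = 0}"
    by auto
  then show ?thesis
    using aff_dim_annihilator[OF independent_arc_vectors(1)[OF assms]] independent_arc_vectors(2)[OF assms]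
    by (simp add: card_insert_if)
qed

lemma face_of_graph_cone:
  fixes E :: "'v::finite rel"
  assumes "acyclic E" "(u, v) \<in> reduced E"
  shows "graph_facet E u v face_of graph_cone E"
  using facet_of_graph_cone[OF assms(1)] assms(2) facet_of_imp_face_of by blast

text \<open>\<open>height ?T\<close> lies on both hyperplanes and satisfies strictly the
  inequalities of all arcs without a return path. The remaining arcs hold with equality on
  \<open>?M\<close>, so the intersection contains a relatively open piece of
  \<open>?M\<close>.\<close>

lemma codim2_faceI:
  fixes E :: "'v::finite rel"
  assumes ac: "acyclic E" and e: "(u, v) \<in> reduced E" "(w, z) \<in> reduced E"
    and ne: "(u, v) \<noteq> (w, z)"
    and forced: "\<And>a b (x :: real ^ 'v). (a, b) \<in> E \<Longrightarrow> (b, a) \<in> (E \<union> {(v, u), (z, w)})\<^sup>* \<Longrightarrow>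
      x $ u = x $ v \<Longrightarrow> x $ w = x $ z \<Longrightarrow> x $ a = x $ b"
  shows "codim2_face (graph_cone E) (graph_facet E u v \<inter> graph_facet E w z)"
proof -
  let ?T = "E \<union> {(v, u), (z, w)}"
  let ?M = "{x :: real ^ 'v. x $ u = x $ v \<and> x $ w = x $ z}"
  let ?O = "open_cone {(a, b) \<in> E. (b, a) \<notin> ?T\<^sup>*}"
  let ?G = "graph_facet E u v \<inter> graph_facet E w z"
  have eE: "(u, v) \<in> E" "(w, z) \<in> E" using e reduced_subset by blast+
  have "height ?T $ u = height ?T $ v"
    using eE by (intro order_antisym height_mono) auto
  moreover have "height ?T $ w = height ?T $ z"
    using eE by (intro order_antisym height_mono) auto
  moreover have "height ?T \<in> ?O"
    unfolding open_cone_def by (auto intro!: height_less)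
  ultimately have "height ?T \<in> ?M \<inter> ?O" by simp
  then have ne': "?M \<inter> ?O \<noteq> {}" by blast
  have "?M = {x. arc_vector u v \<bullet> x = 0} \<inter> {x. arc_vector w z \<bullet> x = 0}" by auto
  then have "convex ?M" by (simp only: convex_Int convex_hyperplane)
  from aff_dim_convex_Int_open[OF this open_open_cone ne']
  have "aff_dim (?M \<inter> ?O) = int DIM(real ^ 'v) - 2"
    using aff_dim_two_equations[OF ac e ne] by simp
  moreover have "?M \<inter> ?O \<subseteq> ?G"
  proof
    fix x assume x: "x \<in> ?M \<inter> ?O"
    have "x $ a \<le> x $ b" if "(a, b) \<in> E" for a b
    proof (cases "(b, a) \<in> ?T\<^sup>*")
      case True
      then show ?thesis using forced[OF that True, of x] x by simp
    next
      case False
      then show ?thesis using x that by (fastforce simp: open_cone_def)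
    qed
    then show "x \<in> ?G" using x by (auto simp: graph_facet_def graph_cone_def)
  qed
  moreover have "?G \<subseteq> ?M" by (auto simp: graph_facet_def)
  ultimately have "aff_dim ?G = int DIM(real ^ 'v) - 2"
    using aff_dim_subset[of "?M \<inter> ?O" ?G] aff_dim_subset[of ?G ?M] aff_dim_two_equations[OF ac e ne] by simp
  moreover have "?G face_of graph_cone E"
    by (intro face_of_Int face_of_graph_cone ac e)
  ultimately show ?thesis by (simp add: codim2_face_def)
qed

text \<open>An equation \<open>x $ a = x $ b\<close> that is forced on the intersection but
  independent of the two facet equations lowers the dimension further. The vector \<open>y\<close>
  certifies the independence.\<close>

lemma not_codim2_faceI:
  fixes E :: "'v::finite rel" and y :: "real ^ 'v"
  assumes ac: "acyclic E" and e: "(u, v) \<in> reduced E" "(w, z) \<in> reduced E"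
    and ne: "(u, v) \<noteq> (w, z)"
    and extra: "\<And>x. x \<in> graph_cone E \<Longrightarrow> x $ u = x $ v \<Longrightarrow> x $ w = x $ z \<Longrightarrow> x $ a = x $ b"
    and y: "y $ u = y $ v" "y $ w = y $ z" "y $ a \<noteq> y $ b"
  shows "\<not> codim2_face (graph_cone E) (graph_facet E u v \<inter> graph_facet E w z)"
proof
  let ?D = "{arc_vector u v, arc_vector w z}"
  let ?D' = "insert (arc_vector a b) ?D"
  let ?G = "graph_facet E u v \<inter> graph_facet E w z"
  have ns: "arc_vector a b \<notin> span ?D"
    by (rule not_in_span_of_orthogonal[of _ y]) (use y in auto)
  then have nin: "arc_vector a b \<notin> ?D" using span_base[of "arc_vector a b" ?D] by metis
  have "independent ?D'"
    using ns independent_arc_vectors(1)[OF ac e ne] nin by (subst independent_insert) (simp only: if_False simp_thms)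
  moreover have "card ?D' = 3"
    using nin independent_arc_vectors(2)[OF ac e ne] by simp
  moreover have "?G \<subseteq> {x. \<forall>d\<in>?D'. d \<bullet> x = 0}"
    using extra by (auto simp: graph_facet_def)
  ultimately have "aff_dim ?G \<le> int DIM(real ^ 'v) - 3"
    using aff_dim_subset[of ?G "{x. \<forall>d\<in>?D'. d \<bullet> x = 0}"] aff_dim_annihilator[of ?D'] by simp
  moreover assume "codim2_face (graph_cone E) ?G"
  ultimately show False by (simp add: codim2_face_def)
qed

lemma graph_facet_inject:
  fixes E :: "'v::finite rel"
  assumes ac: "acyclic E" and e: "(u, v) \<in> reduced E" "(w, z) \<in> reduced E"
    and eq: "graph_facet E u v = graph_facet E w z"
  shows "(u, v) = (w, z)"
proof (rule ccontr)
  assume ne: "(u, v) \<noteq> (w, z)"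
  have "{x :: real ^ 'v. x $ u = x $ v} = {x. x $ w = x $ z}"
    using affine_hull_graph_facet[OF ac e(1)] affine_hull_graph_facet[OF ac e(2)] eq by simp
  moreover obtain y :: "real ^ 'v" where y: "y $ u = y $ v"
    "\<And>a b. (a, b) \<in> E \<Longrightarrow> (a, b) \<noteq> (u, v) \<Longrightarrow> y $ a < y $ b"
    using facet_interior_point[OF ac e(1)] by blast
  moreover have "y $ w < y $ z" using y(2) e(2) ne reduced_subset by blast
  ultimately show False by (metis (mono_tags) less_irrefl mem_Collect_eq)
qed

text \<open>A facet is upper or lower according to whether its arc agrees with \<open>A\<close> or
  is reversed in \<open>A\<close>, so two facets on the same side are two arcs of the same
  kind.\<close>

lemma tight_graphical_arrangement_iff:
  fixes A :: "'v::finite rel"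
  assumes ac: "acyclic A"
  shows "tight_arrangement (graphical_arrangement A) (graph_cone A) \<longleftrightarrow>
    (\<forall>E u v w z. reorientation A E \<and> (u, v) \<in> reduced E \<and> (w, z) \<in> reduced E \<and>
      (u, v) \<noteq> (w, z) \<and> ((u, v) \<in> A \<and> (w, z) \<in> A \<or> (v, u) \<in> A \<and> (z, w) \<in> A) \<longrightarrow>
      codim2_face (graph_cone E) (graph_facet E u v \<inter> graph_facet E w z))" (is "?l \<longleftrightarrow> ?r")
proof
  assume l: ?l
  show ?r
  proof (intro allI impI, elim conjE)
    fix E u v w z
    assume E: "reorientation A E" and e: "(u, v) \<in> reduced E" "(w, z) \<in> reduced E"
      and ne: "(u, v) \<noteq> (w, z)" and type: "(u, v) \<in> A \<and> (w, z) \<in> A \<or> (v, u) \<in> A \<and> (z, w) \<in> A"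
    have "acyclic E" using E by (simp add: reorientation_def)
    then have ne': "graph_facet E u v \<noteq> graph_facet E w z" using graph_facet_inject e ne by blast
    have "graph_cone E \<in> regions (graphical_arrangement A)"
      using E by (auto simp: regions_graphical_arrangement[OF ac])
    note t = bspec[OF l[unfolded tight_arrangement_def] this]
    from type show "codim2_face (graph_cone E) (graph_facet E u v \<inter> graph_facet E w z)"
    proof
      assume "(u, v) \<in> A \<and> (w, z) \<in> A"
      then have "upper_facet (graph_cone A) (graph_cone E) (graph_facet E u v)"
        "upper_facet (graph_cone A) (graph_cone E) (graph_facet E w z)"
        using e unfolding upper_facet_graph_cone[OF ac E] by blast+
      with ne' show ?thesis using t[THEN conjunct1, rule_format, of "graph_facet E u v" "graph_facet E w z"] by simp
    next
      assume "(v, u) \<in> A \<and> (z, w) \<in> A"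
      then have "lower_facet (graph_cone A) (graph_cone E) (graph_facet E u v)"
        "lower_facet (graph_cone A) (graph_cone E) (graph_facet E w z)"
        using e unfolding lower_facet_graph_cone[OF ac E] by blast+
      with ne' show ?thesis using t[THEN conjunct2, rule_format, of "graph_facet E u v" "graph_facet E w z"] by simp
    qed
  qed
next
  assume r: ?r
  show ?l
    unfolding tight_arrangement_def regions_graphical_arrangement[OF ac]
  proof (intro ballI, elim imageE CollectE)
    fix R E assume R: "R = graph_cone E" and E: "reorientation A E"
    have up: "codim2_face R (F \<inter> G)"
      if FG: "upper_facet (graph_cone A) R F" "upper_facet (graph_cone A) R G" "F \<noteq> G" for F G
    proof -
      obtain u v w z where "(u, v) \<in> reduced E" "(u, v) \<in> A" "F = graph_facet E u v"
        "(w, z) \<in> reduced E" "(w, z) \<in> A" "G = graph_facet E w z"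
        using FG(1,2) unfolding R upper_facet_graph_cone[OF ac E] by blast
      moreover from this FG(3) have "(u, v) \<noteq> (w, z)" by auto
      ultimately show ?thesis using r[rule_format, of E u v w z] E unfolding R by simp
    qed
    have low: "codim2_face R (F \<inter> G)"
      if FG: "lower_facet (graph_cone A) R F" "lower_facet (graph_cone A) R G" "F \<noteq> G" for F G
    proof -
      obtain u v w z where "(u, v) \<in> reduced E" "(v, u) \<in> A" "F = graph_facet E u v"
        "(w, z) \<in> reduced E" "(z, w) \<in> A" "G = graph_facet E w z"
        using FG(1,2) unfolding R lower_facet_graph_cone[OF ac E] by blast
      moreover from this FG(3) have "(u, v) \<noteq> (w, z)" by auto
      ultimately show ?thesis using r[rule_format, of E u v w z] E unfolding R by simp
    qed
    show "(\<forall>F G. upper_facet (graph_cone A) R F \<and> upper_facet (graph_cone A) R G \<and> F \<noteq> G \<longrightarrow> codim2_face R (F \<inter> G)) \<and>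
      (\<forall>F G. lower_facet (graph_cone A) R F \<and> lower_facet (graph_cone A) R G \<and> F \<noteq> G \<longrightarrow> codim2_face R (F \<inter> G))"
      by (intro conjI allI impI; elim conjE) (rule up low; assumption)+
  qed
qed

lemma chordal_diamond_imp_tight:
  fixes A :: "'v::finite rel"
  assumes "acyclic A" "chordal A" "diamond_condition A"
  shows "tight_arrangement (graphical_arrangement A) (graph_cone A)"
  unfolding tight_graphical_arrangement_iff[OF assms(1)]
proof (intro allI impI, elim conjE)
  fix E u v w z
  assume E: "reorientation A E" and e: "(u, v) \<in> reduced E" "(w, z) \<in> reduced E"
    and ne: "(u, v) \<noteq> (w, z)" and type: "(u, v) \<in> A \<and> (w, z) \<in> A \<or> (v, u) \<in> A \<and> (z, w) \<in> A"
  have ac: "acyclic E" using E by (simp add: reorientation_def)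
  show "codim2_face (graph_cone E) (graph_facet E u v \<inter> graph_facet E w z)"
  proof (rule codim2_faceI[OF ac e ne])
    fix a b and x :: "real ^ 'v"
    assume "(a, b) \<in> E" "(b, a) \<in> (E \<union> {(v, u), (z, w)})\<^sup>*" and x: "x $ u = x $ v" "x $ w = x $ z"
    from forced_arc[OF assms E e type this(1,2)] show "x $ a = x $ b" using x by auto
  qed
qed

text \<open>Contracting the closing arc and the arc reversed at \<open>k\<close> gives a chain of
  inequalities once round the cycle, which forces equality of the coordinates at positions 0 and
  1.\<close>

lemma tight_imp_chordal:
  fixes A :: "'v::finite rel"
  assumes ac: "acyclic A" and t: "tight_arrangement (graphical_arrangement A) (graph_cone A)"
  shows "chordal A"
  unfolding chordal_iff
proof
  assume "\<exists>c. chordless_cycle A c"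
  then obtain c0 where "chordless_cycle A c0" by blast
  then obtain c k where c: "chordless_cycle A c" and k: "1 \<le> k" "k + 2 \<le> length c"
    and type: "(c ! 0, c ! (length c - 1)) \<in> A \<and> (c ! Suc k, c ! k) \<in> A \<or>
     (c ! (length c - 1), c ! 0) \<in> A \<and> (c ! k, c ! Suc k) \<in> A"
    using chordless_aligned[OF ac] by metis
  obtain E where E: "reorientation A E"
    "\<And>i. Suc i < length c \<Longrightarrow> i \<noteq> k \<Longrightarrow> (c ! i, c ! Suc i) \<in> reduced E"
    "(c ! Suc k, c ! k) \<in> reduced E"
    "(c ! 0, c ! (length c - 1)) \<in> reduced E"
    using chordless_orientation[OF ac c k] by metis
  have acE: "acyclic E" using E(1) by (simp add: reorientation_def)
  have n4: "4 \<le> length c" and d: "distinct c"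
    using c by (auto simp: chordless_cycle_def undirected_cycle_def)
  define n where "n = length c"
  have eq: "c ! i = c ! j \<longleftrightarrow> i = j" if "i < n" "j < n" for i j
    using nth_eq_iff_index_eq[OF d] that by (simp add: n_def)
  have ix: "0 < n" "1 < n" "k < n" "Suc k < n" "n - 1 < n" "k \<noteq> 0" "n - 1 \<noteq> 0" "n - 1 \<noteq> 1" "k \<noteq> n - 1"
    using k n4 by (auto simp: n_def)
  have E4: "(c ! 0, c ! (n - 1)) \<in> reduced E" using E(4) by (simp add: n_def)
  have ne: "(c ! 0, c ! (n - 1)) \<noteq> (c ! Suc k, c ! k)"
    using eq[of 0 "Suc k"] ix by simp
  have extra: "x $ (c ! 0) = x $ (c ! 1)"
    if x: "x \<in> graph_cone E" "x $ (c ! 0) = x $ (c ! (n - 1))" "x $ (c ! Suc k) = x $ (c ! k)"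
    for x :: "real ^ 'v"
  proof -
    have step: "x $ (c ! i) \<le> x $ (c ! Suc i)" if "Suc i < n" for i
    proof (cases "i = k")
      case False
      then have "(c ! i, c ! Suc i) \<in> E" using E(2) that reduced_subset by (auto simp: n_def)
      then show ?thesis using x(1) by (auto simp: graph_cone_def)
    qed (use x in simp)
    have mono: "x $ (c ! i) \<le> x $ (c ! j)" if "i \<le> j" "j < n" for i j
      using that
    proof (induction j rule: dec_induct)
      case (step j)
      then show ?case using \<open>\<And>i. Suc i < n \<Longrightarrow> x $ (c ! i) \<le> x $ (c ! Suc i)\<close>[of j] by simp
    qed simp
    show ?thesis using mono[of 0 1] mono[of 1 "n - 1"] x(2) ix by simp
  qed
  \<comment> \<open>The class of \<open>c ! 0\<close> after the two identifications. It also
    contains \<open>c ! k\<close> when the contracted edges share the vertex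
    \<open>c ! (n - 1)\<close>; \<open>c ! 1\<close> stays outside because the length is at least
    4.\<close>
  define W where "W = (if Suc k = n - 1 then {c ! 0, c ! (n - 1), c ! k} else {c ! 0, c ! (n - 1)})"
  define y :: "real ^ 'v" where "y = (\<chi> v. if v \<in> W then 1 else 0)"
  have "\<not> codim2_face (graph_cone E)
    (graph_facet E (c ! 0) (c ! (n - 1)) \<inter> graph_facet E (c ! Suc k) (c ! k))"
  proof (rule not_codim2_faceI[where a = "c ! 0" and b = "c ! 1" and y = y, OF acE E4 E(3) ne])
    have k1: "k \<noteq> 1" if "Suc k = n - 1" using that n4 by (simp add: n_def)
    show "x $ (c ! 0) = x $ (c ! 1)"
      if "x \<in> graph_cone E" "x $ (c ! 0) = x $ (c ! (n - 1))" "x $ (c ! Suc k) = x $ (c ! k)" for x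
      using extra that .
    show "y $ (c ! 0) = y $ (c ! (n - 1))" by (simp add: y_def W_def)
    show "y $ (c ! Suc k) = y $ (c ! k)"
      using eq[of "Suc k" 0] eq[of "Suc k" "n - 1"] eq[of k 0] eq[of k "n - 1"] ix by (simp add: y_def W_def)
    show "y $ (c ! 0) \<noteq> y $ (c ! 1)"
      using eq[of 1 0] eq[of 1 "n - 1"] eq[of 1 k] ix k1 by (auto simp: y_def W_def)
  qed
  moreover have "(c ! 0, c ! (n - 1)) \<in> A \<and> (c ! Suc k, c ! k) \<in> A \<or> (c ! (n - 1), c ! 0) \<in> A \<and> (c ! k, c ! Suc k) \<in> A"
    using type by (simp add: n_def)
  ultimately show False
    using t[unfolded tight_graphical_arrangement_iff[OF ac], rule_format, of E "c ! 0" "c ! (n - 1)" "c ! Suc k" "c ! k"]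
      E(1) E4 E(3) ne by blast
qed

text \<open>Contracting \<open>(a, b)\<close> and \<open>(b, c)\<close> squeezes \<open>x\<close>
  between equal coordinates, although the equation for \<open>x\<close> is independent of the other
  two.\<close>

lemma tight_imp_diamond_condition:
  fixes A :: "'v::finite rel"
  assumes ac: "acyclic A" and t: "tight_arrangement (graphical_arrangement A) (graph_cone A)"
  shows "diamond_condition A"
  unfolding diamond_condition_def
proof (intro allI impI, elim conjE, rule ccontr)
  fix a b c x
  assume ab: "(a, b) \<in> A" and bc: "(b, c) \<in> A" and ca: "(a, c) \<in> A" and ax: "(a, x) \<in> edges A"
    and xc: "(x, c) \<in> edges A" and xb: "x \<noteq> b" and n: "(b, x) \<notin> edges A"
  have ne: "a \<noteq> c" "a \<noteq> b" "b \<noteq> c" "x \<noteq> a" "x \<noteq> c"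
    using ab bc ca ax xc edges_irrefl[OF ac] ac by (auto simp: acyclic_def)
  obtain E where E: "reorientation A E" "{(a, b), (b, c), (a, x), (x, c)} \<subseteq> reduced E"
    using diamond_orientation[OF ac, of a b c x] ab bc ax xc n xb ne by (auto simp: edges_orient)
  have acE: "acyclic E" using E(1) by (simp add: reorientation_def)
  have e: "(a, b) \<in> reduced E" "(b, c) \<in> reduced E" using E by auto
  have xE: "(a, x) \<in> E" "(x, c) \<in> E" using E(2) reduced_subset by blast+
  have ne': "(a, b) \<noteq> (b, c)" using ne by simp
  define y :: "real ^ 'v" where "y = (\<chi> v. if v = x then 1 else 0)"
  have "\<not> codim2_face (graph_cone E) (graph_facet E a b \<inter> graph_facet E b c)"
  proof (rule not_codim2_faceI[where a = a and b = x and y = y, OF acE e ne'])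
    fix z :: "real ^ 'v" assume z: "z \<in> graph_cone E" "z $ a = z $ b" "z $ b = z $ c"
    have "z $ a \<le> z $ x" "z $ x \<le> z $ c" using z(1) xE by (auto simp: graph_cone_def)
    then show "z $ a = z $ x" using z by simp
  qed (use ne xb in \<open>auto simp: y_def\<close>)
  then show False
    using t[unfolded tight_graphical_arrangement_iff[OF ac], rule_format, of E a b b c] E(1) e ne' ab bc by blast
qed

lemma tight_arrangement_iff_skeletal:
  fixes A :: "'v::finite rel"
  assumes "acyclic A"
  shows "tight_arrangement (graphical_arrangement A) (graph_cone A) \<longleftrightarrow> skeletal A"
  using skeletal_iff chordal_diamond_imp_tight tight_imp_chordal tight_imp_diamond_condition assms by blast

section \<open>Supersolvable arrangements\<close>

definition flat :: "'v rel \<Rightarrow> (real ^ 'v::finite) set" where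
  "flat S = {x. \<forall>(u, v) \<in> S. x $ u = x $ v}"

lemma flat_mono: "S \<subseteq> S' \<Longrightarrow> flat S' \<subseteq> flat S"
  by (auto simp: flat_def)

lemma flatD: "x \<in> flat S \<Longrightarrow> (u, v) \<in> S \<Longrightarrow> x $ u = x $ v"
  by (auto simp: flat_def)

lemma flatI: "(\<And>u v. (u, v) \<in> S \<Longrightarrow> x $ u = x $ v) \<Longrightarrow> x \<in> flat S"
  by (auto simp: flat_def)

lemma flat_Un: "flat (S \<union> S') = flat S \<inter> flat S'"
  by (auto simp: flat_def)

lemma flat_rtrancl:
  assumes "x \<in> flat S" "(u, v) \<in> (edges S)\<^sup>*"
  shows "x $ u = x $ v"
  using assms(2)
proof (induction rule: rtrancl_induct)
  case (step y z)
  then show ?case using flatD[OF assms(1)] by (auto simp: edges_orient)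
qed simp

text \<open>The indicator of the connected component of \<open>p\<close> lies in the flat, so it has
  to take the same value at \<open>q\<close>.\<close>

lemma flat_subset_hyperplane:
  fixes S :: "'v::finite rel"
  assumes "flat S \<subseteq> {x. x $ p = x $ q}"
  shows "(p, q) \<in> (edges S)\<^sup>*"
proof -
  define y :: "real ^ 'v" where "y = (\<chi> w. if (p, w) \<in> (edges S)\<^sup>* then 1 else 0)"
  have "y \<in> flat S"
  proof (rule flatI)
    fix u v assume "(u, v) \<in> S"
    then have "(u, v) \<in> edges S" "(v, u) \<in> edges S" by (auto simp: edges_orient)
    then have "(p, u) \<in> (edges S)\<^sup>* \<longleftrightarrow> (p, v) \<in> (edges S)\<^sup>*" by (meson rtrancl.rtrancl_into_rtrancl)
    then show "y $ u = y $ v" by (simp add: y_def)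
  qed
  then have "y $ p = y $ q" using assms by blast
  then show ?thesis by (simp add: y_def split: if_splits)
qed

lemma intersection_lattice_graphical:
  "X \<in> intersection_lattice (graphical_arrangement A) \<longleftrightarrow> (\<exists>S \<subseteq> A. X = flat S)"
proof
  assume "X \<in> intersection_lattice (graphical_arrangement A)"
  then obtain T where T: "T \<subseteq> graphical_arrangement A" "X = \<Inter> T"
    by (auto simp: intersection_lattice_def)
  have "\<Inter> T = flat {(u, v) \<in> A. {x. x $ u = x $ v} \<in> T}"
  proof (intro subset_antisym subsetI)
    fix x assume "x \<in> flat {(u, v) \<in> A. {x. x $ u = x $ v} \<in> T}"
    note x = flatD[OF this]
    show "x \<in> \<Inter> T"
    proof
      fix H assume H: "H \<in> T"
      then have "H \<in> graphical_arrangement A" using T(1) by (rule subsetD[rotated])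
      then obtain u v where "(u, v) \<in> A" "H = {x. x $ u = x $ v}"
        unfolding graphical_arrangement_def mem_Collect_eq by (elim exE conjE)
      then show "x \<in> H" using x[of u v] H by auto
    qed
  qed (auto simp: flat_def)
  with T(2) show "\<exists>S \<subseteq> A. X = flat S"
    by (intro exI[of _ "{(u, v) \<in> A. {x. x $ u = x $ v} \<in> T}"]) auto
next
  assume "\<exists>S \<subseteq> A. X = flat S"
  then obtain S where S: "S \<subseteq> A" "X = flat S" by blast
  let ?T = "{{x. x $ u = x $ v} | u v. (u, v) \<in> S}"
  have "X = \<Inter> ?T" using S(2) by (auto simp: flat_def)
  moreover have "?T \<subseteq> graphical_arrangement A"
    using S(1) by (auto simp: graphical_arrangement_def)
  then have "?T \<in> Pow (graphical_arrangement A)" by (rule PowI)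
  ultimately show "X \<in> intersection_lattice (graphical_arrangement A)"
    unfolding intersection_lattice_def by (rule image_eqI)
qed

lemma flat_meet_graphical:
  "flat_meet (graphical_arrangement A) X Y =
    flat {(u, v) \<in> A. X \<subseteq> {x. x $ u = x $ v} \<and> Y \<subseteq> {x. x $ u = x $ v}}" (is "_ = flat ?S")
proof
  have "flat ?S \<in> intersection_lattice (graphical_arrangement A)"
    unfolding intersection_lattice_graphical by (intro exI[of _ ?S]) auto
  moreover have "X \<subseteq> flat ?S" "Y \<subseteq> flat ?S" by (auto simp: flat_def)
  ultimately show "flat_meet (graphical_arrangement A) X Y \<subseteq> flat ?S"
    unfolding flat_meet_def by blast
  show "flat ?S \<subseteq> flat_meet (graphical_arrangement A) X Y"
    unfolding flat_meet_def
  proof (intro Inter_greatest)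
    fix Z assume "Z \<in> {Z \<in> intersection_lattice (graphical_arrangement A). X \<subseteq> Z \<and> Y \<subseteq> Z}"
    then obtain S where S: "S \<subseteq> A" "Z = flat S" "X \<subseteq> Z" "Y \<subseteq> Z"
      unfolding intersection_lattice_graphical by blast
    then have "S \<subseteq> ?S" by (auto simp: flat_def)
    then show "flat ?S \<subseteq> Z" using S(2) flat_mono by blast
  qed
qed

lemma modular_flatD:
  assumes "modular_flat \<H> X" "Y \<in> intersection_lattice \<H>" "Z \<in> intersection_lattice \<H>" "Y \<subseteq> Z"
  shows "Z \<inter> flat_meet \<H> X Y = flat_meet \<H> (Z \<inter> X) Y"
  using assms by (simp add: modular_flat_def)

text \<open>Maximality as saturation: whatever is comparable to the whole chain belongs to it. One
  direction of the main equivalence checks this form, the other inserts an element by it.\<close>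

lemma maxchain_iff:
  "subset.maxchain L C \<longleftrightarrow> C \<subseteq> L \<and> (\<forall>X\<in>C. \<forall>Y\<in>C. X \<subseteq> Y \<or> Y \<subseteq> X) \<and>
     (\<forall>T\<in>L. (\<forall>X\<in>C. X \<subseteq> T \<or> T \<subseteq> X) \<longrightarrow> T \<in> C)"
proof -
  have ch: "subset.chain L C \<longleftrightarrow> C \<subseteq> L \<and> (\<forall>X\<in>C. \<forall>Y\<in>C. X \<subseteq> Y \<or> Y \<subseteq> X)" for C
    unfolding subset.chain_def by (auto simp: subset_iff_psubset_eq)
  show ?thesis
  proof
    assume m: "subset.maxchain L C"
    then have C: "subset.chain L C" "\<And>S. subset.chain L S \<Longrightarrow> \<not> C \<subset> S"
      unfolding subset.maxchain_def by auto
    have "T \<in> C" if T: "T \<in> L" "\<forall>X\<in>C. X \<subseteq> T \<or> T \<subseteq> X" for T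
    proof (rule ccontr)
      assume "T \<notin> C"
      moreover have "subset.chain L (insert T C)" using C(1) T unfolding ch by blast
      ultimately show False using C(2)[of "insert T C"] by blast
    qed
    then show "C \<subseteq> L \<and> (\<forall>X\<in>C. \<forall>Y\<in>C. X \<subseteq> Y \<or> Y \<subseteq> X) \<and>
     (\<forall>T\<in>L. (\<forall>X\<in>C. X \<subseteq> T \<or> T \<subseteq> X) \<longrightarrow> T \<in> C)"
      using C(1)[unfolded ch] by simp
  next
    assume r: "C \<subseteq> L \<and> (\<forall>X\<in>C. \<forall>Y\<in>C. X \<subseteq> Y \<or> Y \<subseteq> X) \<and>
     (\<forall>T\<in>L. (\<forall>X\<in>C. X \<subseteq> T \<or> T \<subseteq> X) \<longrightarrow> T \<in> C)"
    have "\<not> (subset.chain L S \<and> C \<subset> S)" for S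
    proof
      assume S: "subset.chain L S \<and> C \<subset> S"
      then obtain T where "T \<in> S" "T \<notin> C" by blast
      moreover have "T \<in> L" "\<forall>X\<in>C. X \<subseteq> T \<or> T \<subseteq> X"
        using S \<open>T \<in> S\<close> unfolding ch by auto
      ultimately show False using r by simp
    qed
    moreover have "subset.chain L C" using r unfolding ch by simp
    ultimately show "subset.maxchain L C" unfolding subset.maxchain_def by simp
  qed
qed

text \<open>An edge forced by two others lies in one of them, or joins their free ends across a
  shared vertex. The latter would be a triangle on a chordless cycle.\<close>

lemma two_edges_closed:
  fixes A :: "'v::finite rel"
  assumes c: "chordless_cycle A c" and v: "{g1, g2, h1, h2} \<subseteq> set c"
    and e: "(g1, g2) \<in> edges A" "(h1, h2) \<in> edges A" and pq: "(p, q) \<in> edges A" "p \<noteq> q"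
    and forced: "\<And>y :: real ^ 'v. y $ g1 = y $ g2 \<Longrightarrow> y $ h1 = y $ h2 \<Longrightarrow> y $ p = y $ q"
  shows "{p, q} = {g1, g2} \<or> {p, q} = {h1, h2}"
proof -
  have sep: "(p \<in> W) = (q \<in> W)" if "(g1 \<in> W) = (g2 \<in> W)" "(h1 \<in> W) = (h2 \<in> W)" for W
    using forced[of "\<chi> w. if w \<in> W then 1 else 0"] that by (auto split: if_splits)
  have e': "(g2, g1) \<in> edges A" "(h2, h1) \<in> edges A" using e edges_sym by metis+
  have "p \<in> {g1, g2} \<union> {h1, h2}"
    using sep[of "{p}"] pq(2) by (cases "p \<in> {g1, g2} \<union> {h1, h2}") auto
  moreover have "q \<in> {g1, g2} \<union> {h1, h2}"
    using sep[of "{q}"] pq(2) by (cases "q \<in> {g1, g2} \<union> {h1, h2}") auto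
  ultimately consider "p \<in> {g1, g2}" "q \<in> {g1, g2}" | "p \<in> {h1, h2}" "q \<in> {h1, h2}"
    | "p \<in> {g1, g2}" "q \<in> {h1, h2}" "p \<notin> {h1, h2}" "q \<notin> {g1, g2}"
    | "p \<in> {h1, h2}" "q \<in> {g1, g2}" "p \<notin> {g1, g2}" "q \<notin> {h1, h2}" by blast
  then show ?thesis
  proof cases
    case 3
    then obtain r where r: "r \<in> {g1, g2}" "r \<in> {h1, h2}" using sep[of "{g1, g2}"] by auto
    then have "(p, r) \<in> edges A" "(r, q) \<in> edges A" "r \<noteq> p" "r \<noteq> q"
      using 3 e e' by auto
    then show ?thesis using chordless_trianglefree[OF c, of p r q] 3 r v pq by auto
  next
    case 4
    then obtain r where r: "r \<in> {g1, g2}" "r \<in> {h1, h2}" using sep[of "{g1, g2}"] by auto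
    then have "(p, r) \<in> edges A" "(r, q) \<in> edges A" "r \<noteq> p" "r \<noteq> q"
      using 4 e e' by auto
    then show ?thesis using chordless_trianglefree[OF c, of p r q] 4 r v pq by auto
  qed (use pq in auto)
qed

lemma supersolvable_imp_chordal:
  fixes A :: "'v::finite rel"
  assumes ac: "acyclic A" and ss: "supersolvable_arrangement (graphical_arrangement A)"
  shows "chordal A"
  unfolding chordal_iff
proof
  let ?H = "\<lambda>u v. {x :: real ^ 'v. x $ u = x $ v}"
  let ?G = "graphical_arrangement A"
  have lat: "?H u v \<in> intersection_lattice ?G" if "(u, v) \<in> edges A" for u v
    unfolding intersection_lattice_graphical
    using that by (cases "(u, v) \<in> A")
      (auto simp: flat_def edges_orient intro: exI[of _ "{(u, v)}"] exI[of _ "{(v, u)}"])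
  have lat_Int: "X \<inter> Y \<in> intersection_lattice ?G"
    if XY: "X \<in> intersection_lattice ?G" "Y \<in> intersection_lattice ?G" for X Y
    using XY unfolding intersection_lattice_graphical by (metis Un_least flat_Un)
  assume "\<exists>c. chordless_cycle A c"
  then obtain c0 where c0: "chordless_cycle A c0" by blast
  obtain \<C> where max: "subset.maxchain (intersection_lattice ?G) \<C>" and mod: "\<forall>X\<in>\<C>. modular_flat ?G X"
    using ss unfolding supersolvable_arrangement_def by blast
  have sub: "\<C> \<subseteq> intersection_lattice ?G" and chain: "\<And>X Y. X \<in> \<C> \<Longrightarrow> Y \<in> \<C> \<Longrightarrow> X \<subseteq> Y \<or> Y \<subseteq> X"
    and maximal: "\<And>T. T \<in> intersection_lattice ?G \<Longrightarrow> (\<forall>X\<in>\<C>. X \<subseteq> T \<or> T \<subseteq> X) \<Longrightarrow> T \<in> \<C>"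
    using max unfolding maxchain_iff by blast+
  have "finite ?G"
  proof -
    have "?G = (\<lambda>(u, v). ?H u v) ` A" by (auto simp: graphical_arrangement_def)
    then show ?thesis by simp
  qed
  then have "finite (intersection_lattice ?G)" by (simp add: intersection_lattice_def)
  then have fin: "finite \<C>" using sub finite_subset by blast
  \<comment> \<open>The flat that contracts the whole chordless cycle.\<close>
  define Q where "Q = {x :: real ^ 'v. \<forall>u\<in>set c0. \<forall>v\<in>set c0. x $ u = x $ v}"
  have n0: "4 \<le> length c0" and d0: "distinct c0"
    using c0 by (auto simp: chordless_cycle_def undirected_cycle_def)
  have "UNIV \<in> intersection_lattice ?G"
    unfolding intersection_lattice_graphical by (rule exI[of _ "{}"]) (simp add: flat_def)
  then have "UNIV \<in> \<C>" using maximal by blast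
  moreover have "\<not> UNIV \<subseteq> Q"
  proof
    assume "UNIV \<subseteq> Q"
    then have "axis (c0 ! 0) 1 \<in> Q" by blast
    moreover have "c0 ! 0 \<in> set c0" "c0 ! 1 \<in> set c0" using n0 nth_mem[of 0 c0] nth_mem[of 1 c0] by linarith+
    ultimately have "axis (c0 ! 0) (1 :: real) $ (c0 ! 0) = axis (c0 ! 0) 1 $ (c0 ! 1)"
      unfolding Q_def by blast
    moreover have "0 < length c0" "1 < length c0" using n0 by linarith+
    ultimately show False using nth_eq_iff_index_eq[OF d0, of 0 1] by (simp add: axis_def split: if_splits)
  qed
  ultimately have nonempty: "{X \<in> \<C>. \<not> X \<subseteq> Q} \<noteq> {}" by blast
  have "finite {X \<in> \<C>. \<not> X \<subseteq> Q}" using fin by simp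
  from finite_has_minimal[OF this nonempty] obtain X where X': "X \<in> {X \<in> \<C>. \<not> X \<subseteq> Q}"
    "\<forall>Y\<in>{X \<in> \<C>. \<not> X \<subseteq> Q}. Y \<subseteq> X \<longrightarrow> X = Y" by (elim bexE)
  then have X: "X \<in> \<C>" "\<not> X \<subseteq> Q" by simp_all
  have Xmin: "Y \<subseteq> Q" if "Y \<in> \<C>" "Y \<subset> X" for Y
    using bspec[OF X'(2), of Y] that by (cases "Y \<subseteq> Q") (simp_all add: psubset_eq)
  \<comment> \<open>All edges of the cycle but one already force membership in \<open>Q\<close>, so
    a flat not contained in \<open>Q\<close> misses at least two edges.\<close>
  have wrapped: "x \<in> Q" if x: "\<And>i. Suc i < length c \<Longrightarrow> x $ (c ! i) = x $ (c ! Suc i)"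
    and c: "set c = set c0" for c x
  proof -
    have "x $ (c ! i) = x $ (c ! 0)" if "i < length c" for i
      using that by (induction i) (use x in auto)
    then have "x $ u = x $ (c ! 0)" if "u \<in> set c0" for u
      using that unfolding c[symmetric] by (metis in_set_conv_nth)
    then show ?thesis unfolding Q_def by simp
  qed
  obtain m where m: "Suc m < length c0" "\<not> X \<subseteq> ?H (c0 ! m) (c0 ! Suc m)"
    using wrapped[of c0] X(2) by blast
  \<comment> \<open>The rotation makes the first missed edge the closing one, so that the second
    missed edge is found among the others.\<close>
  define c where "c = rotate (Suc m) c0"
  define n where "n = length c"
  have c: "chordless_cycle A c" using chordless_cycle_rotate[OF c0] unfolding c_def .
  have setc: "set c = set c0" by (simp add: c_def)
  have n4: "4 \<le> n" and d: "distinct c" and nn: "n = length c0"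
    using n0 d0 by (auto simp: n_def c_def)
  have nth: "c ! i = c0 ! ((Suc m + i) mod n)" if "i < n" for i
    using that nth_rotate[of i c0 "Suc m"] unfolding c_def n_def by (simp del: rotate_Suc)
  define g1 g2 where "g1 = c ! (n - 1)" and "g2 = c ! 0"
  have g: "g1 = c0 ! m" "g2 = c0 ! Suc m"
    using nth[of "n - 1"] nth[of 0] m(1) n4 by (simp_all add: g1_def g2_def nn[symmetric] mod_if)
  obtain i where i: "Suc i < n" "\<not> X \<subseteq> ?H (c ! i) (c ! Suc i)"
    using wrapped[of c] X(2) setc unfolding n_def by blast
  define h1 h2 where "h1 = c ! i" and "h2 = c ! Suc i"
  have Xg: "\<not> X \<subseteq> ?H g1 g2" and Xh: "\<not> X \<subseteq> ?H h1 h2"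
    using m(2) i(2) by (auto simp: g h1_def h2_def)
  have cyc: "undirected_cycle A c" using c by (simp add: chordless_cycle_def)
  have ge: "(g1, g2) \<in> edges A"
  proof -
    have "c \<noteq> []" using n4 by (auto simp: n_def)
    then show ?thesis using cyc
      by (simp add: undirected_cycle_iff g1_def g2_def n_def hd_conv_nth last_conv_nth)
  qed
  have he: "(h1, h2) \<in> edges A"
    using cyc i successively_nth[of _ c i] unfolding undirected_cycle_iff h1_def h2_def n_def by blast
  have inc: "{g1, g2, h1, h2} \<subseteq> set c"
  proof -
    have "c ! k \<in> set c" if "k < n" for k using that by (simp add: n_def)
    moreover have "n - 1 < n" "0 < n" "i < n" using i(1) n4 by linarith+
    ultimately show ?thesis using i(1) by (simp add: g1_def g2_def h1_def h2_def)
  qed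
  have eq: "c ! i = c ! j \<longleftrightarrow> i = j" if "i < n" "j < n" for i j
    using nth_eq_iff_index_eq[OF d] that by (simp add: n_def)
  have gh: "{g1, g2} \<noteq> {h1, h2}"
  proof
    assume "{g1, g2} = {h1, h2}"
    then consider "c ! 0 = c ! Suc i" | "c ! (n - 1) = c ! Suc i" "c ! 0 = c ! i"
      unfolding g1_def g2_def h1_def h2_def doubleton_eq_iff by blast
    then show False
    proof cases
      case 1
      then show False using eq[of 0 "Suc i"] i(1) by linarith
    next
      case 2
      then show False using eq[of "n - 1" "Suc i"] eq[of 0 i] i(1) n4 by linarith
    qed
  qed
  \<comment> \<open>Chain members strictly below \<open>X\<close> lie in \<open>Q\<close>, hence in
    the hyperplane of \<open>g\<close>. The intersection is therefore comparable to the whole chain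
    and belongs to it; minimality of \<open>X\<close> then puts it inside \<open>Q\<close>.\<close>
  have XgQ: "X \<inter> ?H g1 g2 \<subseteq> Q"
  proof (rule Xmin)
    show "X \<inter> ?H g1 g2 \<subset> X" using Xg by blast
    show "X \<inter> ?H g1 g2 \<in> \<C>"
    proof (rule maximal)
      show "X \<inter> ?H g1 g2 \<in> intersection_lattice ?G" using X(1) sub lat[OF ge] lat_Int by blast
      show "\<forall>T\<in>\<C>. T \<subseteq> X \<inter> ?H g1 g2 \<or> X \<inter> ?H g1 g2 \<subseteq> T"
      proof
        fix T assume T: "T \<in> \<C>"
        have "g1 \<in> set c0" "g2 \<in> set c0" using inc setc by auto
        then have "Q \<subseteq> ?H g1 g2" unfolding Q_def by blast
        moreover have "T \<subset> X \<Longrightarrow> T \<subseteq> Q" using Xmin[OF T] .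
        ultimately show "T \<subseteq> X \<inter> ?H g1 g2 \<or> X \<inter> ?H g1 g2 \<subseteq> T"
          using chain[OF T X(1)] by blast
      qed
    qed
  qed
  let ?Y = "?H g1 g2 \<inter> ?H h1 h2"
  \<comment> \<open>Only the edges \<open>g\<close> and \<open>h\<close> hold on \<open>?Y\<close>,
    and \<open>X\<close> satisfies neither, so the meet of \<open>X\<close> and \<open>?Y\<close> is
    the whole space.\<close>
  have "\<not> (X \<subseteq> ?H u v \<and> ?Y \<subseteq> ?H u v)" if uv: "(u, v) \<in> A" for u v
  proof
    assume h: "X \<subseteq> ?H u v \<and> ?Y \<subseteq> ?H u v"
    have "(u, v) \<in> edges A" "u \<noteq> v" using uv ac by (auto simp: edges_orient acyclic_def)
    moreover have "y $ u = y $ v" if "y $ g1 = y $ g2" "y $ h1 = y $ h2" for y :: "real ^ 'v"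
      using subsetD[OF conjunct2[OF h], of y] that by simp
    ultimately have "{u, v} = {g1, g2} \<or> {u, v} = {h1, h2}"
      using two_edges_closed[OF c inc ge he] by presburger
    then have "?H u v = ?H g1 g2 \<or> ?H u v = ?H h1 h2"
      unfolding doubleton_eq_iff by (elim disjE conjE) auto
    then show False using conjunct1[OF h] Xg Xh by (elim disjE) simp_all
  qed
  then have "{(u, v) \<in> A. X \<subseteq> ?H u v \<and> ?Y \<subseteq> ?H u v} = {}" by blast
  then have "flat_meet ?G X ?Y = UNIV"
    unfolding flat_meet_graphical by (simp only: flat_def) simp
  moreover have "flat_meet ?G (?H g1 g2 \<inter> X) ?Y \<subseteq> ?H h1 h2"
  proof -
    have "h1 \<in> set c0" "h2 \<in> set c0" using inc setc by auto
    then have "Q \<subseteq> ?H h1 h2" unfolding Q_def by blast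
    with XgQ have "?H g1 g2 \<inter> X \<subseteq> ?H h1 h2" by blast
    then show ?thesis unfolding flat_meet_def by (intro Inter_lower) (simp add: lat[OF he])
  qed
  moreover have "?H g1 g2 \<inter> flat_meet ?G X ?Y = flat_meet ?G (?H g1 g2 \<inter> X) ?Y"
    by (rule modular_flatD[OF bspec[OF mod X(1)] lat_Int[OF lat[OF ge] lat[OF he]] lat[OF ge] Int_lower1])
  \<comment> \<open>The modular law would now make the equation of \<open>h\<close> a consequence of
    that of \<open>g\<close>; the axis vector of an end of \<open>h\<close> not on \<open>g\<close>
    refutes this.\<close>
  ultimately have sub': "?H g1 g2 \<subseteq> ?H h1 h2" by simp
  have "h1 \<noteq> h2" using eq[of i "Suc i"] i by (simp add: h1_def h2_def)
  have "g1 \<noteq> g2" using eq[of "n - 1" 0] n4 by (simp add: g1_def g2_def)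
  then have "h1 \<notin> {g1, g2} \<or> h2 \<notin> {g1, g2}" using gh \<open>h1 \<noteq> h2\<close> by auto
  then obtain h where h: "h \<in> {h1, h2}" "h \<notin> {g1, g2}" by blast
  have "axis h 1 \<in> ?H g1 g2" using h(2) by (auto simp: axis_def)
  then have "axis h 1 \<in> ?H h1 h2" using sub' by blast
  then show False using h(1) \<open>h1 \<noteq> h2\<close> by (auto simp: axis_def)
qed

section \<open>Simplicial vertices and perfect elimination orderings\<close>

definition simplicial_in :: "'v rel \<Rightarrow> 'v set \<Rightarrow> 'v \<Rightarrow> bool" where
  "simplicial_in A U s \<longleftrightarrow> (\<forall>a\<in>U. \<forall>b\<in>U. (s, a) \<in> edges A \<and> (s, b) \<in> edges A \<and> a \<noteq> b \<longrightarrow> (a, b) \<in> edges A)"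

text \<open>If \<open>s\<close> and \<open>t\<close> were not adjacent, an induced path between them
  through the connected set \<open>C\<close>, closed by \<open>x\<close>, would be a chordless
  cycle, since \<open>x\<close> has no neighbour in \<open>C\<close>.\<close>

lemma separator_clique:
  assumes ch: "chordal A"
    and conn: "\<And>z z'. z \<in> C \<Longrightarrow> z' \<in> C \<Longrightarrow> (z, z') \<in> (edges A \<inter> C \<times> C)\<^sup>*"
    and far: "x \<notin> C" "\<And>z. z \<in> C \<Longrightarrow> (x, z) \<notin> edges A"
    and s: "(x, s) \<in> edges A" "z \<in> C" "(z, s) \<in> edges A"
    and t: "(x, t) \<in> edges A" "z' \<in> C" "(z', t) \<in> edges A"
    and xst: "x \<noteq> s" "x \<noteq> t" and st: "s \<noteq> t"
  shows "(s, t) \<in> edges A"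
proof (rule ccontr)
  assume nst: "(s, t) \<notin> edges A"
  let ?D = "insert s (insert t C)"
  let ?R = "edges A \<inter> ?D \<times> ?D"
  have "(edges A \<inter> C \<times> C)\<^sup>* \<subseteq> ?R\<^sup>*" by (rule rtrancl_mono) auto
  then have zz: "(z, z') \<in> ?R\<^sup>*" using conn[OF s(2) t(2)] by blast
  have sz: "(s, z) \<in> ?R" using s edges_sym[of s z A] by simp
  have zt: "(z', t) \<in> ?R" using t by simp
  have st': "(s, t) \<in> ?R\<^sup>*"
    using zz sz zt by (meson converse_rtrancl_into_rtrancl rtrancl.rtrancl_into_rtrancl)
  obtain p where p: "p \<noteq> []" "hd p = s" "last p = t" "walk ?R p"
    "distinct p" "\<And>i j. Suc i < j \<Longrightarrow> j < length p \<Longrightarrow> (p ! i, p ! j) \<notin> ?R"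
    using induced_path[OF st'] by blast
  have pD: "y \<in> ?D" if y: "y \<in> set p" for y
  proof -
    obtain i where i: "i < length p" "p ! i = y" using y by (metis in_set_conv_nth)
    show ?thesis
    proof (cases i)
      case 0
      then show ?thesis using i p(1,2) by (auto simp: hd_conv_nth)
    next
      case (Suc k)
      then have "(p ! k, y) \<in> ?R" using successively_nth[OF p(4), of k] i by simp
      then show ?thesis by blast
    qed
  qed
  have "length p \<noteq> 0" using p(1) by simp
  moreover have "length p \<noteq> 1" using p st by (auto simp: length_Suc_conv)
  moreover have "length p \<noteq> 2" using p nst by (auto simp: numeral_2_eq_2 length_Suc_conv)
  ultimately have len: "3 \<le> length p" by linarith
  have ends: "p ! 0 = s" "p ! (length p - 1) = t" using p by (auto simp: hd_conv_nth last_conv_nth)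
  have pA: "walk (edges A) p" using p(4) by (rule successively_mono) simp
  have cyc: "undirected_cycle A (x # p)"
  proof (rule closed_path_cycle)
    show "walk (edges A) (x # p)"
      using pA p(1,2) s(1) by (simp add: successively_Cons)
    show "distinct (x # p)" using p(5) pD far(1) xst by auto
    show "3 \<le> length (x # p)" using len by simp
    show "(hd (x # p), last (x # p)) \<in> edges A" using p(1,3) t(1) by simp
  qed
  have "j = Suc i \<or> i = 0 \<and> Suc j = length (x # p)"
    if ij: "i < j" "j < length (x # p)" "((x # p) ! i, (x # p) ! j) \<in> edges A" for i j
  proof -
    obtain j' where j': "j = Suc j'" "j' < length p" using ij(1,2) by (cases j) auto
    show ?thesis
    proof (cases i)
      case 0
      then have "(x, p ! j') \<in> edges A" using ij(3) j' by simp
      moreover have "p ! j' \<in> ?D" using pD j' by simp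
      ultimately have "p ! j' = p ! 0 \<or> p ! j' = p ! (length p - 1)" using far(2) ends by auto
      then have "j' = 0 \<or> j' = length p - 1"
        using nth_eq_iff_index_eq[OF p(5), of j' 0] nth_eq_iff_index_eq[OF p(5), of j' "length p - 1"] j' len
        by linarith
      then show ?thesis using 0 j' by auto
    next
      case (Suc i')
      then have "(p ! i', p ! j') \<in> edges A" "i' < j'" using ij j' by auto
      moreover have "p ! i' \<in> ?D" "p ! j' \<in> ?D" using pD j' \<open>i' < j'\<close> by simp_all
      ultimately have "(p ! i', p ! j') \<in> ?R" by blast
      then have "\<not> Suc i' < j'" using p(6) j' by blast
      then show ?thesis using \<open>i' < j'\<close> Suc j' by simp
    qed
  qed
  moreover have "4 \<le> length (x # p)" using len by simp
  ultimately have "chordless_cycle A (x # p)" using cyc unfolding chordless_cycle_def by blast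
  with ch show False by (auto simp: chordal_iff)
qed

text \<open>Dirac's lemma: the simplicial vertex can be found away from any given non-universal vertex.\<close>

lemma simplicial_vertex_nonadjacent:
  fixes A :: "'v::finite rel"
  assumes ac: "acyclic A" and ch: "chordal A"
  shows "x \<in> U \<Longrightarrow> y \<in> U \<Longrightarrow> x \<noteq> y \<Longrightarrow> (x, y) \<notin> edges A \<Longrightarrow>
    \<exists>s\<in>U. s \<noteq> x \<and> (x, s) \<notin> edges A \<and> simplicial_in A U s"
proof (induction "card U" arbitrary: U x y rule: less_induct)
  case less
  \<comment> \<open>\<open>C\<close> is the component of \<open>y\<close> among the non-neighbours
    of \<open>x\<close>, and \<open>S\<close> is its boundary. \<open>S\<close> consists of
    neighbours of \<open>x\<close> and is a clique because it separates \<open>x\<close> from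
    \<open>C\<close>.\<close>
  define N where "N = {w \<in> U. w \<noteq> x \<and> (x, w) \<notin> edges A}"
  define K where "K = edges A \<inter> N \<times> N"
  define C where "C = {w. (y, w) \<in> K\<^sup>*}"
  define S where "S = {w \<in> U. w \<notin> C \<and> (\<exists>z\<in>C. (z, w) \<in> edges A)}"
  have yN: "y \<in> N" using less.prems by (simp add: N_def)
  have yC: "y \<in> C" by (simp add: C_def)
  have CN: "C \<subseteq> N"
  proof
    fix w assume "w \<in> C"
    then have "(y, w) \<in> K\<^sup>*" by (simp add: C_def)
    then show "w \<in> N" using yN by (induction rule: rtrancl_induct) (auto simp: K_def)
  qed
  have Cstep: "w \<in> C" if "z \<in> C" "(z, w) \<in> edges A" "w \<in> N" for z w
  proof -
    have "(z, w) \<in> K" using that CN by (auto simp: K_def)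
    then show ?thesis using that(1) by (auto simp: C_def)
  qed
  have symK: "(w, z) \<in> K" if "(z, w) \<in> K" for z w
    using that edges_sym[of z w A] by (simp add: K_def)
  have conn: "(z, z') \<in> (edges A \<inter> C \<times> C)\<^sup>*" if zz: "z \<in> C" "z' \<in> C" for z z'
  proof -
    have from_y: "(y, w) \<in> (edges A \<inter> C \<times> C)\<^sup>*" if "w \<in> C" for w
    proof -
      have "(y, w) \<in> K\<^sup>*" using that by (simp add: C_def)
      then show ?thesis
      proof (induction rule: rtrancl_induct)
        case (step a b)
        then have "a \<in> C" "b \<in> C" by (auto simp: C_def)
        then have "(a, b) \<in> edges A \<inter> C \<times> C" using step(2) by (simp add: K_def)
        then show ?case using step by (meson rtrancl.rtrancl_into_rtrancl)
      qed simp
    qed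
    have "sym (edges A \<inter> C \<times> C)" by (auto simp: edges_def sym_def)
    then have "(z, y) \<in> (edges A \<inter> C \<times> C)\<^sup>*" using from_y[OF zz(1)] by (meson sym_rtrancl symD)
    then show ?thesis using from_y[OF zz(2)] by simp
  qed
  have xC: "x \<notin> C" using CN by (auto simp: N_def)
  have far: "(x, z) \<notin> edges A" if "z \<in> C" for z using that CN by (auto simp: N_def)
  have Sx: "(x, s) \<in> edges A \<and> x \<noteq> s" if s: "s \<in> S" for s
  proof -
    obtain z where z: "z \<in> C" "(z, s) \<in> edges A" and sU: "s \<in> U" "s \<notin> C" using s by (auto simp: S_def)
    have "s \<notin> N" using Cstep[OF z] sU by blast
    moreover have "s \<noteq> x" using far[OF z(1)] z(2) edges_sym[of z x A] by auto
    ultimately show ?thesis using sU by (auto simp: N_def)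
  qed
  have clique: "(s, t) \<in> edges A" if st: "s \<in> S" "t \<in> S" "s \<noteq> t" for s t
  proof -
    obtain z where z: "z \<in> C" "(z, s) \<in> edges A" using st(1) by (auto simp: S_def)
    obtain z' where z': "z' \<in> C" "(z', t) \<in> edges A" using st(2) by (auto simp: S_def)
    show ?thesis
      using separator_clique[OF ch conn xC far, of s z t z'] Sx[OF st(1)] Sx[OF st(2)] z z' st(3) by blast
  qed
  let ?U = "C \<union> S"
  have sub: "?U \<subseteq> U" using CN by (auto simp: N_def S_def)
  have xU: "x \<notin> ?U" using xC Sx by blast
  then have small: "card ?U < card U"
    using sub less.prems(1) by (intro psubset_card_mono) auto
  \<comment> \<open>All neighbours in \<open>U\<close> of a vertex of \<open>C\<close> lie in
    \<open>C\<close> or in its boundary, so being simplicial carries over to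
    \<open>U\<close>.\<close>
  have lift: "simplicial_in A U s" if s: "s \<in> C" "simplicial_in A ?U s" for s
  proof -
    have "a \<in> ?U" if "a \<in> U" "(s, a) \<in> edges A" for a
      using that s(1) by (auto simp: S_def)
    then show ?thesis using s(2) unfolding simplicial_in_def by meson
  qed
  have "\<exists>s\<in>C. simplicial_in A ?U s"
  \<comment> \<open>The induction is to end in \<open>C\<close>, not in \<open>S\<close>. Avoiding a
    vertex of \<open>S\<close> does this because \<open>S\<close> is a clique; if every vertex of
    \<open>S\<close> is universal, avoiding any non-universal vertex does; a complete
    \<open>?U\<close> allows \<open>y\<close> itself.\<close>
  proof (cases "\<exists>s\<in>S. \<exists>w\<in>?U. s \<noteq> w \<and> (s, w) \<notin> edges A")
    case True
    then obtain s w where sw: "s \<in> S" "w \<in> ?U" "s \<noteq> w" "(s, w) \<notin> edges A" by blast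
    have "s \<in> ?U" using sw(1) by simp
    then obtain s' where s': "s' \<in> ?U" "s' \<noteq> s" "(s, s') \<notin> edges A" "simplicial_in A ?U s'"
      using less.hyps[OF small _ sw(2-4)] by metis
    then have "s' \<notin> S" using clique[OF sw(1)] by blast
    then show ?thesis using s' by blast
  next
    case univ: False
    show ?thesis
    proof (cases "\<exists>a\<in>?U. \<exists>b\<in>?U. a \<noteq> b \<and> (a, b) \<notin> edges A")
      case True
      then obtain a b where ab: "a \<in> ?U" "b \<in> ?U" "a \<noteq> b" "(a, b) \<notin> edges A" by blast
      then obtain s' where s': "s' \<in> ?U" "s' \<noteq> a" "(a, s') \<notin> edges A" "simplicial_in A ?U s'"
        using less.hyps[OF small ab] by metis
      have "(s', a) \<notin> edges A" using s'(3) edges_sym by metis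
      then have "s' \<notin> S" using univ ab(1) s'(2) by blast
      then show ?thesis using s' by blast
    next
      case False
      then have "simplicial_in A ?U y" unfolding simplicial_in_def by blast
      then show ?thesis using yC by blast
    qed
  qed
  then obtain s where s: "s \<in> C" "simplicial_in A U s" using lift by blast
  have "s \<in> U" "s \<noteq> x" "(x, s) \<notin> edges A" using s(1) CN by (auto simp: N_def)
  then show ?case using s(2) by blast
qed

lemma simplicial_vertex_exists:
  fixes A :: "'v::finite rel"
  assumes "acyclic A" "chordal A" "U \<noteq> {}"
  shows "\<exists>s\<in>U. simplicial_in A U s"
proof (cases "\<exists>x\<in>U. \<exists>y\<in>U. x \<noteq> y \<and> (x, y) \<notin> edges A")
  case True
  then show ?thesis using simplicial_vertex_nonadjacent[OF assms(1,2)] by metis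
next
  case False
  then have "simplicial_in A U s" for s unfolding simplicial_in_def by blast
  then show ?thesis using assms(3) by blast
qed

text \<open>A perfect elimination ordering is encoded by a rank function, highest rank first.\<close>

lemma perfect_elimination_rank:
  fixes A :: "'v::finite rel"
  assumes ac: "acyclic A" and ch: "chordal A"
  obtains r :: "'v \<Rightarrow> nat" where "inj r" "\<And>s. simplicial_in A {v. r v < r s} s"
proof -
  have "\<exists>r :: 'v \<Rightarrow> nat. inj_on r U \<and> (\<forall>s\<in>U. simplicial_in A {v \<in> U. r v < r s} s)" for U
  proof (induction "card U" arbitrary: U)
    case 0
    then have "U = {}" by simp
    then show ?case by simp
  next
    case (Suc n)
    then have "U \<noteq> {}" by auto
    then obtain s where s: "s \<in> U" "simplicial_in A U s" using simplicial_vertex_exists[OF ac ch] by blast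
    have "n = card (U - {s})" using Suc(2) s(1) by simp
    then obtain r :: "'v \<Rightarrow> nat" where r: "inj_on r (U - {s})"
      "\<forall>t\<in>U - {s}. simplicial_in A {v \<in> U - {s}. r v < r t} t"
      using Suc(1) by blast
    \<comment> \<open>The eliminated vertex \<open>s\<close> gets the top rank. A sum bounds the
      other ranks even when \<open>U - {s}\<close> is empty.\<close>
    define M where "M = Suc (sum r (U - {s}))"
    have M: "r v < M" if "v \<in> U - {s}" for v
      using member_le_sum[of v "U - {s}" r] that by (simp add: M_def less_Suc_eq_le)
    define r' where "r' = r(s := M)"
    have "inj_on r' U"
    proof (rule inj_onI)
      fix a b assume "a \<in> U" "b \<in> U" "r' a = r' b"
      then show "a = b" using r(1) M[of a] M[of b]
        by (auto simp: r'_def inj_on_def split: if_splits)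
    qed
    moreover have "simplicial_in A {v \<in> U. r' v < r' t} t" if t: "t \<in> U" for t
    proof (cases "t = s")
      case True
      then show ?thesis using s(2) unfolding simplicial_in_def by blast
    next
      case False
      then have "{v \<in> U. r' v < r' t} = {v \<in> U - {s}. r v < r t}"
        using M[of t] t by (auto simp: r'_def)
      then show ?thesis using r(2) t False by simp
    qed
    ultimately show ?case by blast
  qed
  from this[of UNIV] that show thesis by auto
qed

section \<open>The maximal chain of modular flats given by an elimination ordering\<close>

context
  fixes A :: "'v::finite rel" and r :: "'v \<Rightarrow> nat"
  assumes ac: "acyclic A" and r: "inj r" and peo: "\<And>s. simplicial_in A {v. r v < r s} s"
begin

text \<open>Consecutive flats coincide if no vertex has rank \<open>i\<close>, or if the one that
  does has no neighbour of lower rank. The chain is therefore taken as a range over all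
  naturals.\<close>

definition initial_flat :: "nat \<Rightarrow> (real ^ 'v) set" where
  "initial_flat i = flat (A \<inter> {v. r v < i} \<times> {v. r v < i})"

text \<open>The vertex of highest rank on an induced path has adjacent neighbours, so it is an end.\<close>

lemma outside_path_imp_adjacent:
  assumes w: "r w < i" and y: "r y < i"
    and path: "(w, y) \<in> (edges A \<inter> insert w (insert y {v. i \<le> r v}) \<times> insert w (insert y {v. i \<le> r v}))\<^sup>*"
  shows "w = y \<or> (w, y) \<in> edges A"
proof -
  let ?T = "insert w (insert y {v. i \<le> r v})"
  let ?R = "edges A \<inter> ?T \<times> ?T"
  obtain p where p: "p \<noteq> []" "hd p = w" "last p = y" "walk ?R p"
    "distinct p" "\<And>i j. Suc i < j \<Longrightarrow> j < length p \<Longrightarrow> (p ! i, p ! j) \<notin> ?R"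
    using induced_path[OF path] by blast
  have ends: "p ! 0 = w" "p ! (length p - 1) = y" using p by (auto simp: hd_conv_nth last_conv_nth)
  have "finite (r ` set p)" "r ` set p \<noteq> {}" using p(1) by auto
  then have "Max (r ` set p) \<in> r ` set p" by (rule Max_in)
  then obtain v where "v \<in> set p" "r v = Max (r ` set p)" by auto
  then have v: "v \<in> set p" "\<And>u. u \<in> set p \<Longrightarrow> r u \<le> r v" by simp_all
  obtain m where m: "m < length p" "p ! m = v" using v(1) by (metis in_set_conv_nth)
  have step: "(p ! k, p ! Suc k) \<in> ?R" if "Suc k < length p" for k
    using successively_nth[OF p(4) that] .
  show ?thesis
  proof (cases "m = 0 \<or> m = length p - 1")
    case True
    \<comment> \<open>With the maximum at an end, every vertex of the path ranks below
      \<open>i\<close>, which leaves only \<open>w\<close> and \<open>y\<close>.\<close>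
    then have "r v < i" using ends m w y by auto
    have inner: "p ! k \<in> {w, y}" if k: "k < length p" for k
    proof -
      have "p ! k \<in> ?T"
      proof (cases k)
        case 0 then show ?thesis using ends by simp
      next
        case (Suc l)
        then have "(p ! l, p ! k) \<in> ?R" using step[of l] k by simp
        then show ?thesis by blast
      qed
      moreover have "r (p ! k) < i" using v(2)[of "p ! k"] k \<open>r v < i\<close> by simp
      ultimately show ?thesis by auto
    qed
    have "set p \<subseteq> {w, y}" using inner by (metis in_set_conv_nth subsetI)
    then have "card (set p) \<le> card {w, y}" by (intro card_mono) auto
    also have "\<dots> \<le> 2" by (cases "w = y") auto
    finally have "length p \<le> 2" using distinct_card[OF p(5)] by simp
    moreover have "length p \<noteq> 0" using p(1) by simp
    ultimately have "length p = 1 \<or> length p = 2" by linarith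
    then show ?thesis
    proof
      assume "length p = 1"
      then show ?thesis using ends by simp
    next
      assume "length p = 2"
      then show ?thesis using ends step[of 0] by simp
    qed
  next
    case False
    then obtain k where k: "m = Suc k" "Suc m < length p" using m by (cases m) auto
    have e: "(p ! k, v) \<in> ?R" "(v, p ! Suc m) \<in> ?R" using step[of k] step[of m] k m by auto
    have less: "r u < r v" if "u \<in> set p" "u \<noteq> v" for u
      using v(2)[OF that(1)] r that(2) by (metis injD le_neq_implies_less)
    have "p ! k \<noteq> v" "p ! Suc m \<noteq> v" "p ! k \<noteq> p ! Suc m"
      using m k nth_eq_iff_index_eq[OF p(5)] by auto
    moreover have "p ! k \<in> set p" "p ! Suc m \<in> set p" using k by simp_all
    \<comment> \<open>The path neighbours of an inner maximum are its lower neighbours, hence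
      adjacent, which gives a chord.\<close>
    ultimately have "(p ! k, p ! Suc m) \<in> edges A"
      using peo[of v] e edges_sym[of "p ! k" v A] less unfolding simplicial_in_def by blast
    then have "(p ! k, p ! Suc m) \<in> ?R" using e by blast
    then show ?thesis using p(6)[of k "Suc m"] k by simp
  qed
qed

text \<open>One inclusion is general lattice theory. For the other, an equation forced by
  \<open>Z\<close> and the initial segment has to be derived from \<open>Z\<close> and those edges
  inside the segment that hold on \<open>Y\<close>.\<close>

lemma initial_flat_modular: "modular_flat (graphical_arrangement A) (initial_flat i)"
  unfolding modular_flat_def
proof (intro conjI ballI impI)
  let ?G = "graphical_arrangement A"
  let ?H = "\<lambda>u v. {x :: real ^ 'v. x $ u = x $ v}"
  define W where "W = {v. r v < i}"
  let ?B = "A \<inter> W \<times> W"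
  have X: "initial_flat i = flat ?B" by (simp add: initial_flat_def W_def)
  show "initial_flat i \<in> intersection_lattice ?G"
    unfolding intersection_lattice_graphical X by (intro exI[of _ ?B]) simp
  fix Y Z assume "Y \<in> intersection_lattice ?G" and Z: "Z \<in> intersection_lattice ?G" and YZ: "Y \<subseteq> Z"
  obtain Sz where Sz: "Sz \<subseteq> A" "Z = flat Sz" using Z unfolding intersection_lattice_graphical by blast
  show "Z \<inter> flat_meet ?G (initial_flat i) Y = flat_meet ?G (Z \<inter> initial_flat i) Y"
  proof
    show "flat_meet ?G (Z \<inter> initial_flat i) Y \<subseteq> Z \<inter> flat_meet ?G (initial_flat i) Y"
    proof
      fix x assume "x \<in> flat_meet ?G (Z \<inter> initial_flat i) Y"
      then have x: "x $ u = x $ v" if "(u, v) \<in> A" "Z \<inter> initial_flat i \<subseteq> ?H u v" "Y \<subseteq> ?H u v" for u v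
        using that unfolding flat_meet_graphical by (auto simp: flat_def)
      have "x \<in> Z"
        unfolding Sz(2)
      proof (rule flatI)
        fix u v assume uv: "(u, v) \<in> Sz"
        then have "Z \<subseteq> ?H u v" unfolding Sz(2) by (auto simp: flat_def)
        then show "x $ u = x $ v" using x[of u v] uv Sz(1) YZ by blast
      qed
      moreover have "x \<in> flat_meet ?G (initial_flat i) Y"
        unfolding flat_meet_graphical by (rule flatI) (use x in blast)
      ultimately show "x \<in> Z \<inter> flat_meet ?G (initial_flat i) Y" by blast
    qed
    show "Z \<inter> flat_meet ?G (initial_flat i) Y \<subseteq> flat_meet ?G (Z \<inter> initial_flat i) Y"
    proof
      fix x assume x: "x \<in> Z \<inter> flat_meet ?G (initial_flat i) Y"
      have xX: "x $ a = x $ b" if "(a, b) \<in> A" "a \<in> W" "b \<in> W" "Y \<subseteq> ?H a b" for a b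
      proof -
        have "initial_flat i \<subseteq> ?H a b" unfolding X using that by (auto simp: flat_def)
        then show ?thesis using x that unfolding flat_meet_graphical by (auto simp: flat_def)
      qed
      have xS: "x $ a = x $ b" if "(a, b) \<in> (edges Sz)\<^sup>*" for a b
        using x that flat_rtrancl unfolding Sz(2) by blast
      show "x \<in> flat_meet ?G (Z \<inter> initial_flat i) Y"
        unfolding flat_meet_graphical
      proof (rule flatI)
        fix u v assume "(u, v) \<in> {(u, v) \<in> A. Z \<inter> initial_flat i \<subseteq> ?H u v \<and> Y \<subseteq> ?H u v}"
        then have uv: "(u, v) \<in> A" "Z \<inter> initial_flat i \<subseteq> ?H u v" "Y \<subseteq> ?H u v" by auto
        have "flat (Sz \<union> ?B) \<subseteq> ?H u v" using uv(2) unfolding flat_Un X Sz(2) .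
        then have "(u, v) \<in> (edges (Sz \<union> ?B))\<^sup>*" by (rule flat_subset_hyperplane)
        \<comment> \<open>Only the first entry \<open>a\<close> into \<open>W\<close> and the last
          exit \<open>b\<close> from \<open>W\<close> matter; outside of them the path uses edges of
          \<open>Sz\<close>.\<close>
        then have "(u, v) \<in> (edges Sz)\<^sup>* \<or> (\<exists>a\<in>W. \<exists>b\<in>W. (u, a) \<in> (edges Sz)\<^sup>* \<and> (b, v) \<in> (edges Sz)\<^sup>*)"
        proof (induction rule: rtrancl_induct)
          case (step y z)
          then have "(y, z) \<in> edges Sz \<or> y \<in> W \<and> z \<in> W" by (auto simp: edges_def)
          with step.IH show ?case by (meson rtrancl.rtrancl_into_rtrancl rtrancl.rtrancl_refl)
        qed simp
        then show "x $ u = x $ v"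
        proof (elim disjE bexE conjE)
          assume "(u, v) \<in> (edges Sz)\<^sup>*"
          then show ?thesis by (rule xS)
        next
          fix a b assume a: "a \<in> W" "(u, a) \<in> (edges Sz)\<^sup>*" and b: "b \<in> W" "(b, v) \<in> (edges Sz)\<^sup>*"
          \<comment> \<open>All edges of \<open>K\<close> hold on \<open>Y\<close>. Going from
            \<open>a\<close> back to \<open>u\<close>, across to \<open>v\<close> and back to
            \<open>b\<close> joins \<open>a\<close> and \<open>b\<close> by edges that hold on
            \<open>Y\<close>.\<close>
          define K where "K = insert (u, v) Sz"
          have KA: "K \<subseteq> A" using Sz(1) uv(1) by (simp add: K_def)
          have YK: "Y \<subseteq> flat K"
            using YZ uv(3) Sz(2) by (auto simp: K_def flat_def)
          have mono: "(edges Sz)\<^sup>* \<subseteq> (edges K)\<^sup>*"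
            by (rule rtrancl_mono) (auto simp: K_def edges_def)
          have "sym (edges K)" by (auto simp: edges_def sym_def)
          then have symK: "(q, p) \<in> (edges K)\<^sup>*" if "(p, q) \<in> (edges K)\<^sup>*" for p q
            using that by (meson sym_rtrancl symD)
          have "(u, v) \<in> (edges K)\<^sup>*" by (auto simp: K_def edges_def)
          then have "(a, b) \<in> (edges K)\<^sup>*"
            using a(2) b(2) mono symK by (meson rtrancl_trans subsetD)
          \<comment> \<open>Invariant: \<open>w\<close> is the latest vertex of \<open>W\<close> on
            the \<open>K\<close>-path, and the path has run outside \<open>W\<close> since. On
            return to \<open>W\<close> at \<open>z\<close>, the edge from \<open>w\<close> to
            \<open>z\<close>, if they differ, holds on \<open>Y\<close> and lies inside
            \<open>W\<close>, so \<open>x\<close> satisfies it.\<close>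
          then have "\<exists>w\<in>W. x $ a = x $ w \<and> (a, w) \<in> (edges K)\<^sup>* \<and>
            (b = w \<or> b \<notin> W \<and> (w, b) \<in> (edges A \<inter> insert w (- W) \<times> insert w (- W))\<^sup>*)"
          proof (induction rule: rtrancl_induct)
            case base
            show ?case using a(1) by (intro bexI[of _ a]) auto
          next
            case (step y z)
            obtain w where w: "w \<in> W" "x $ a = x $ w" "(a, w) \<in> (edges K)\<^sup>*"
              "y = w \<or> y \<notin> W \<and> (w, y) \<in> (edges A \<inter> insert w (- W) \<times> insert w (- W))\<^sup>*"
              using step.IH by blast
            have yz: "(y, z) \<in> edges A" using step(2) KA by (auto simp: edges_def)
            have wy: "(w, y) \<in> (edges A \<inter> insert w (- W) \<times> insert w (- W))\<^sup>*" "y \<in> insert w (- W)"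
              using w(4) by auto
            show ?case
            proof (cases "z \<in> W")
              case False
              then have "(y, z) \<in> edges A \<inter> insert w (- W) \<times> insert w (- W)" using yz wy(2) by blast
              then have "(w, z) \<in> (edges A \<inter> insert w (- W) \<times> insert w (- W))\<^sup>*"
                using wy(1) by (rule rtrancl.rtrancl_into_rtrancl[rotated])
              then show ?thesis using w False by blast
            next
              case True
              let ?T = "insert w (insert z {v. i \<le> r v})"
              have T: "insert w (- W) \<subseteq> ?T" by (auto simp: W_def)
              then have "(edges A \<inter> insert w (- W) \<times> insert w (- W))\<^sup>* \<subseteq> (edges A \<inter> ?T \<times> ?T)\<^sup>*"
                by (intro rtrancl_mono) blast
              moreover have "(y, z) \<in> edges A \<inter> ?T \<times> ?T" using yz wy(2) T by blast
              ultimately have "(w, z) \<in> (edges A \<inter> ?T \<times> ?T)\<^sup>*" using wy(1)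
                by (meson rtrancl.rtrancl_into_rtrancl subsetD)
              then have adj: "w = z \<or> (w, z) \<in> edges A"
                using outside_path_imp_adjacent[of w i z] w(1) True by (simp add: W_def)
              have az: "(a, z) \<in> (edges K)\<^sup>*" using step(1,2) by simp
              have "x $ w = x $ z"
              proof (cases "w = z")
                case False
                have "t $ w = t $ z" if "t \<in> Y" for t
                  using flat_rtrancl[of t K a w] flat_rtrancl[of t K a z] w(3) az YK that by auto
                then have "Y \<subseteq> ?H w z" "Y \<subseteq> ?H z w" by auto
                then show ?thesis
                  using adj False xX[of w z] xX[of z w] w(1) True unfolding edges_orient by auto
              qed simp
              then show ?thesis using w(2) az True by (intro bexI[of _ z]) auto
            qed
          qed
          then have "x $ a = x $ b" using b(1) by auto
          then show ?thesis using xS[OF a(2)] xS[OF b(2)] by simp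
        qed
      qed
    qed
  qed
qed

lemma initial_flat_antimono: "i \<le> j \<Longrightarrow> initial_flat j \<subseteq> initial_flat i"
  unfolding initial_flat_def by (rule flat_mono) auto

text \<open>An additional arc of \<open>T\<close> joins the vertex \<open>s\<close> of rank
  \<open>i\<close> to a lower neighbour \<open>t\<close>. The lower neighbours of \<open>s\<close>
  form a clique, already contracted by the initial flat, so equating \<open>s\<close> with
  \<open>t\<close> equates it with all of them.\<close>

lemma initial_flat_Suc:
  assumes T: "T \<in> intersection_lattice (graphical_arrangement A)"
    and sub: "T \<subseteq> initial_flat i" "initial_flat (Suc i) \<subseteq> T"
  shows "T = initial_flat i \<or> T = initial_flat (Suc i)"
proof (cases "T \<subseteq> initial_flat (Suc i)")
  case True
  then show ?thesis using sub(2) by blast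
next
  case False
  obtain S where S: "S \<subseteq> A" "T = flat S" using T unfolding intersection_lattice_graphical by blast
  let ?W = "{v. r v < Suc i}"
  have "initial_flat i \<subseteq> T"
  proof
    fix x assume x: "x \<in> initial_flat i"
    have xi: "x $ a = x $ b" if "(a, b) \<in> A" "r a < i" "r b < i" for a b
      using x that unfolding initial_flat_def by (auto dest: flatD)
    show "x \<in> T"
      unfolding S(2)
    proof (rule flatI)
      fix u v assume uv: "(u, v) \<in> S"
      have uvA: "(u, v) \<in> A" using uv S(1) by blast
      then have ne: "u \<noteq> v" using ac by (auto simp: acyclic_def)
      have Tuv: "t $ u = t $ v" if "t \<in> T" for t using that flatD[of t S u v] uv S(2) by simp
      then have "flat (A \<inter> ?W \<times> ?W) \<subseteq> {x. x $ u = x $ v}"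
        using sub(2) unfolding initial_flat_def by blast
      then have *: "(u, v) \<in> (edges (A \<inter> ?W \<times> ?W))\<^sup>*" by (rule flat_subset_hyperplane)
      have uW: "r u < Suc i"
        using * ne by (cases rule: converse_rtranclE) (auto simp: edges_def)
      have vW: "r v < Suc i"
        using * ne by (cases rule: rtranclE) (auto simp: edges_def)
      show "x $ u = x $ v"
      proof (cases "r u < i \<and> r v < i")
        case True
        then show ?thesis using xi uvA by blast
      next
        case top: False
        then have "r u = i \<and> r v < i \<or> r v = i \<and> r u < i"
          using uW vW ne r by (metis injD less_antisym)
        then obtain s t where st: "{u, v} = {s, t}" "r s = i" "r t < i" by blast
        have Tst: "y $ s = y $ t" if "y \<in> T" for y using Tuv[OF that] st(1) by (auto simp: doubleton_eq_iff)
        have stA: "(s, t) \<in> edges A" using uvA st(1) by (auto simp: doubleton_eq_iff edges_orient)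
        have "T \<subseteq> initial_flat (Suc i)"
        proof
          fix y assume y: "y \<in> T"
          have "y \<in> initial_flat i" using y sub(1) by blast
          note yi' = flatD[OF this[unfolded initial_flat_def]]
          have yi: "y $ a = y $ b" if "(a, b) \<in> edges A" "r a < i" "r b < i" for a b
            using that yi'[of a b] yi'[of b a] unfolding edges_orient by auto
          have sy: "y $ s = y $ b" if sb: "(s, b) \<in> edges A" "r b < i" for b
          proof (cases "b = t")
            case True then show ?thesis using Tst[OF y] by simp
          next
            case False
            then have "(t, b) \<in> edges A"
              using peo[of s] sb stA st(2,3) unfolding simplicial_in_def by auto
            then show ?thesis using yi[of t b] Tst[OF y] sb(2) st(3) by simp
          qed
          show "y \<in> initial_flat (Suc i)"
            unfolding initial_flat_def
          proof (rule flatI)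
            fix a b assume "(a, b) \<in> A \<inter> ?W \<times> ?W"
            then have ab: "(a, b) \<in> edges A" "(b, a) \<in> edges A" "r a < Suc i" "r b < Suc i"
              by (auto simp: edges_orient)
            have top: "c = s" if "r c < Suc i" "\<not> r c < i" for c
              using that st(2) r by (metis injD less_antisym)
            consider "r a < i" "r b < i" | "a = s" "r b < i" | "r a < i" "b = s" | "a = s" "b = s"
              using top[OF ab(3)] top[OF ab(4)] by blast
            then show "y $ a = y $ b"
            proof cases
              case 1
              then show ?thesis using yi[OF ab(1)] by simp
            next
              case 2
              then show ?thesis using sy[of b] ab(1) by simp
            next
              case 3
              then show ?thesis using sy[of a] ab(2) by simp
            qed simp
          qed
        qed
        with False show ?thesis by blast
      qed
    qed
  qed
  then show ?thesis using sub(1) by blast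
qed

lemma initial_flats_maxchain:
  "subset.maxchain (intersection_lattice (graphical_arrangement A)) (range initial_flat)"
  unfolding maxchain_iff
proof (intro conjI ballI impI)
  show "range initial_flat \<subseteq> intersection_lattice (graphical_arrangement A)"
    using initial_flat_modular unfolding modular_flat_def by blast
  show "X \<subseteq> Y \<or> Y \<subseteq> X" if XY: "X \<in> range initial_flat" "Y \<in> range initial_flat" for X Y
  proof -
    obtain i j where "X = initial_flat i" "Y = initial_flat j" using XY by blast
    then show ?thesis using initial_flat_antimono linear[of i j] by blast
  qed
  fix T assume T: "T \<in> intersection_lattice (graphical_arrangement A)"
    and comp: "\<forall>X\<in>range initial_flat. X \<subseteq> T \<or> T \<subseteq> X"
  show "T \<in> range initial_flat"
  proof (cases "\<exists>j. \<not> T \<subseteq> initial_flat j")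
    case False
    obtain S where S: "S \<subseteq> A" "T = flat S" using T unfolding intersection_lattice_graphical by blast
    \<comment> \<open>Above all ranks the initial flat is the smallest flat, the intersection of all
      hyperplanes.\<close>
    define N where "N = Suc (Max (range r))"
    have "r v < N" for v by (simp add: N_def less_Suc_eq_le)
    then have "initial_flat N = flat A" by (simp add: initial_flat_def)
    also have "\<dots> \<subseteq> T" using S flat_mono by blast
    finally have "T = initial_flat N" using False by blast
    then show ?thesis by blast
  next
    case True
    \<comment> \<open>The first initial flat not containing \<open>T\<close> lies inside
      \<open>T\<close> by comparability, so \<open>T\<close> sits between two consecutive
      members.\<close>
    define j where "j = (LEAST j. \<not> T \<subseteq> initial_flat j)"
    have j: "\<not> T \<subseteq> initial_flat j" using True unfolding j_def by (rule LeastI_ex)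
    have "initial_flat 0 = UNIV" by (simp add: initial_flat_def flat_def)
    then obtain i where i: "j = Suc i" using j by (cases j) auto
    have "T \<subseteq> initial_flat i" using not_less_Least[of i "\<lambda>j. \<not> T \<subseteq> initial_flat j"] i by (simp add: j_def)
    moreover have "initial_flat (Suc i) \<subseteq> T" using comp j i by blast
    ultimately show ?thesis using initial_flat_Suc[OF T, of i] by blast
  qed
qed

end

lemma chordal_imp_supersolvable:
  fixes A :: "'v::finite rel"
  assumes "acyclic A" "chordal A"
  shows "supersolvable_arrangement (graphical_arrangement A)"
proof -
  obtain r :: "'v \<Rightarrow> nat" where r: "inj r" "\<And>s. simplicial_in A {v. r v < r s} s"
    using perfect_elimination_rank[OF assms] by metis
  show ?thesis
    unfolding supersolvable_arrangement_def
    using initial_flats_maxchain[OF assms(1) r] initial_flat_modular[OF assms(1) r] by blast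
qed

theorem theorem5:
  fixes A :: "'v::finite rel"
  assumes "acyclic A"
  shows "(simplicial_arrangement (graphical_arrangement A) \<longleftrightarrow> chordful A) \<and>
         (tight_arrangement (graphical_arrangement A) (graph_cone A) \<longleftrightarrow> skeletal A) \<and>
         (supersolvable_arrangement (graphical_arrangement A) \<longleftrightarrow> chordal A)"
  using simplicial_arrangement_iff_chordful[OF assms] tight_arrangement_iff_skeletal[OF assms]
    supersolvable_imp_chordal[OF assms] chordal_imp_supersolvable[OF assms] by blast

end
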